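(* Let $K$ be a field and let $\mathcal{A}$ and $\mathcal{B}$ be superadditive categories over $K$. Then the shuffle map $\mathrm{sh}:C_*(\mathcal{A})\otimes C_*(\mathcal{B})\to C_*(\mathcal{A}\otimes\mathcal{B})$ induces an isomorphism $$\mathrm{sh}_*:\ \mathrm{HH}_*(\mathcal{A})\otimes\mathrm{HH}_*(\mathcal{B})\xrightarrow{\ \sim\ }\mathrm{HH}_*(\mathcal{A}\otimes\mathcal{B}).$$
   Context: $K$ is a field, $\otimes=\otimes_K$. A superspace is a $\mathbb{Z}_2$-graded $K$-vector space; $|v|\in\mathbb{Z}_2$ is the degree of a homogeneous $v$. Formulas with parity signs are stated for homogeneous elements and extended linearly. Superadditive category. A category $\mathcal{A}$ in which each $\mathcal{A}(X,Y)$ is a superspace and composition is $K$-bilinear with $\mathcal{A}(X,Y)_i\cdot\mathcal{A}(Y,Z)_j\subseteq\mathcal{A}(X,Z)_{i+j}$. $\alpha\beta$ means first $\alpha$, then $\beta$. Tensor product. $\mathcal{A}\otimes\mathcal{B}$ has objects $X\otimes Y$ ($X\in\mathcal{A}$, $Y\in\mathcal{B}$), morphism superspaces $\mathcal{A}(X,X')\otimes\mathcal{B}(Y,Y')$ with the total grading, and composition $(\phi_1\otimes\phi_2)(\psi_1\otimes\psi_2)=(-1)^{|\phi_2||\psi_1|}\phi_1\psi_1\otimes\phi_2\psi_2$. Hochschild complex. $C_n(\mathcal{A})=\bigoplus_{(X_n,\dots,X_0)}\mathcal{A}(X_0,X_n)\otimes\mathcal{A}(X_n,X_{n-1})\otimes\cdots\otimes\mathcal{A}(X_1,X_0)$,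 with elements written as sums of $(a_0,a_1,\dots,a_n)$, and $\partial_n=\sum_{i=0}^n(-1)^id_n^i$, where $d_n^i(a_0,\dots,a_n)=(a_0,\dots,a_ia_{i+1},\dots,a_n)$ for $0\le i<n$ and $d_n^n(a_0,\dots,a_n)=(-1)^{|a_n|(|a_0|+\cdots+|a_{n-1}|)}(a_na_0,a_1,\dots,a_{n-1})$. $\mathrm{HH}_n(\mathcal{A})$ is its $n$-th homology. On $C_*(\mathcal{A})\otimes C_*(\mathcal{B})$ the differential is $x\otimes y\mapsto\partial x\otimes y+(-1)^px\otimes\partial y$ for $x\in C_p(\mathcal{A})$. Shuffle map. A $(p,q)$-shuffle is a permutation $\sigma$ of $\{1,\dots,p+q\}$ with $\sigma(1)<\cdots<\sigma(p)$ and $\sigma(p+1)<\cdots<\sigma(p+q)$. Permutations of $\{1,\dots,n\}$ act by $\sigma(c_0,c_1,\dots,c_n)=(c_0,c_{\sigma^{-1}(1)},\dots,c_{\sigma^{-1}(n)})$ (no parity sign is included). For $a=(a_0,\dots,a_p)\in C_p(\mathcal{A})$ and $b=(b_0,\dots,b_q)\in C_q(\mathcal{B})$, $$\mathrm{sh}_{pq}(a\otimes b)=\sum_\sigma\mathrm{sgn}(\sigma)\,\sigma(a_0\otimes b_0,\ a_1\otimes1,\dots,a_p\otimes1,\ 1\otimes b_1,\dots,1\otimes b_q)\in C_{p+q}(\mathcal{A}\otimes\mathcal{B}),$$ summed over all $(p,q)$-shuffles, where each $1$ denotes the appropriate identity morphism. In degree $n$, $\mathrm{sh}$ is the sum of the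 maps $\mathrm{sh}_{pq}$ with $p+q=n$.
   Formalization: Each shuffle summand carries an extra Koszul sign (b_0 moved past a_1,…,a_p; each b_j past every a_i it precedes); without it sh is not a chain map in char ≠ 2 (A=B=K[ε]/ε², ε odd, a=b=(1,ε)). The sign is 1 in char 2 or if one factor is purely even. *)

theory Defs
  imports Complex_Main "HOL-Library.Z2" "HOL-Library.Poly_Mapping" "HOL-Combinatorics.Permutations"
begin

section \<open>Free vector spaces and quotients\<close>

text \<open>The free \<open>K\<close>-vector space on the elements of \<open>'x\<close> is \<open>'x \<Rightarrow>\<^sub>0 'k\<close>.\<close>

definition fscale :: "'k::field \<Rightarrow> ('x \<Rightarrow>\<^sub>0 'k) \<Rightarrow> ('x \<Rightarrow>\<^sub>0 'k)" where
  "fscale c x = Poly_Mapping.map ((*) c) x"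

lemma lookup_fscale [simp]: "Poly_Mapping.lookup (fscale c x) t = c * Poly_Mapping.lookup x t"
  by (simp add: fscale_def map.rep_eq when_def)

interpretation fvs: vector_space "fscale :: 'k::field \<Rightarrow> ('x \<Rightarrow>\<^sub>0 'k) \<Rightarrow> ('x \<Rightarrow>\<^sub>0 'k)"
  by unfold_locales (auto intro!: poly_mapping_eqI simp: lookup_add algebra_simps)

abbreviation gen :: "'x \<Rightarrow> ('x \<Rightarrow>\<^sub>0 'k::field)" where
  "gen t \<equiv> Poly_Mapping.single t 1"

definition lin_ext :: "('x \<Rightarrow> ('y \<Rightarrow>\<^sub>0 'k::field)) \<Rightarrow> ('x \<Rightarrow>\<^sub>0 'k) \<Rightarrow> ('y \<Rightarrow>\<^sub>0 'k)" where
  "lin_ext h x = (\<Sum>t\<in>Poly_Mapping.keys x. fscale (Poly_Mapping.lookup x t) (h t))"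

text \<open>
  Quotients by a subspace \<open>R\<close>: \<open>quo R\<close> is a linear idempotent with kernel exactly \<open>R\<close>
  (one exists since \<open>K\<close> is a field), so \<open>x \<mapsto> quo R x\<close> is the quotient map modulo \<open>R\<close> and,
  for a subspace \<open>V \<supseteq> R\<close>, its image \<open>quo R ` V\<close> is the quotient space \<open>V / R\<close>. The class of
  \<open>x\<close> is thus represented by one chosen element of the coset \<open>x + R\<close>, and a linear map out of
  a quotient can be given by applying a formula to this representative.
\<close>

definition quo :: "('x \<Rightarrow>\<^sub>0 'k::field) set \<Rightarrow> ('x \<Rightarrow>\<^sub>0 'k) \<Rightarrow> ('x \<Rightarrow>\<^sub>0 'k)" where
  "quo R = (SOME f. Vector_Spaces.linear fscale fscale f \<and> (\<forall>x. f (f x) = f x) \<and>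
                    (\<forall>x. f x = 0 \<longleftrightarrow> x \<in> R))"

lemma quo_exists:
  fixes R :: "('x \<Rightarrow>\<^sub>0 'k::field) set"
  assumes "fvs.subspace R"
  shows "\<exists>f. Vector_Spaces.linear fscale fscale f \<and> (\<forall>x. f (f x) = f x) \<and>
             (\<forall>x. f x = 0 \<longleftrightarrow> x \<in> R)"
proof -
  interpret vp: vector_space_pair "fscale :: 'k \<Rightarrow> ('x \<Rightarrow>\<^sub>0 'k) \<Rightarrow> _" "fscale :: 'k \<Rightarrow> ('x \<Rightarrow>\<^sub>0 'k) \<Rightarrow> _"
    by unfold_locales
  obtain g :: "('x \<Rightarrow>\<^sub>0 'k) \<Rightarrow> ('x \<Rightarrow>\<^sub>0 'k)" where
    g: "g ` UNIV \<subseteq> R" "Vector_Spaces.linear fscale fscale g" "\<And>v. v \<in> R \<Longrightarrow> g v = v"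
    using vp.linear_exists_left_inverse_on[OF fvs.linear_id assms] by auto
  interpret g: Vector_Spaces.linear fscale fscale g by (rule g(2))
  have "Vector_Spaces.linear fscale fscale (\<lambda>x. x - g x)"
    by (rule vp.linear_compose_sub[OF fvs.linear_ident g(2)])
  moreover have "g (g x) = g x" for x using g by blast
  moreover have "x - g x = 0 \<longleftrightarrow> x \<in> R" for x using g(1) g(3)[of x] by (metis UNIV_I eq_iff_diff_eq_0 image_subset_iff)
  ultimately show ?thesis
    by (intro exI[of _ "\<lambda>x. x - g x"]) (simp add: g.diff)
qed

lemma
  fixes R :: "('x \<Rightarrow>\<^sub>0 'k::field) set"
  assumes "fvs.subspace R"
  shows quo_linear: "Vector_Spaces.linear fscale fscale (quo R)"
    and quo_idem: "quo R (quo R x) = quo R x"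
    and quo_eq_0_iff: "quo R x = 0 \<longleftrightarrow> x \<in> R"
  using someI_ex[OF quo_exists[OF assms]] unfolding quo_def by blast+

lemma quo_eq_iff:
  fixes R :: "('x \<Rightarrow>\<^sub>0 'k::field) set"
  assumes "fvs.subspace R"
  shows "quo R x = quo R y \<longleftrightarrow> x - y \<in> R"
proof -
  interpret l: Vector_Spaces.linear fscale fscale "quo R" by (rule quo_linear[OF assms])
  show ?thesis using quo_eq_0_iff[OF assms, of "x - y"] by (simp add: l.diff)
qed

section \<open>Tensor products of graded vector spaces\<close>

text \<open>
  A graded vector space is given by its family of homogeneous components, each a subspace of an
  ambient vector space. A generator \<open>((i, v), (j, w))\<close> of the tensor product stands for \<open>v \<otimes> w\<close>
  with \<open>v\<close> of degree \<open>i\<close> and \<open>w\<close> of degree \<open>j\<close>; dividing by bilinearity in each bidegree gives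
  the direct sum of the spaces \<open>V i \<otimes> W j\<close>.
\<close>

type_synonym ('i, 'v, 'w) tgen = "('i \<times> 'v) \<times> ('i \<times> 'w)"

definition tensor_rels :: "('k::field \<Rightarrow> 'v::ab_group_add \<Rightarrow> 'v) \<Rightarrow> ('k \<Rightarrow> 'w::ab_group_add \<Rightarrow> 'w) \<Rightarrow>
    ('i \<Rightarrow> 'v set) \<Rightarrow> ('i \<Rightarrow> 'w set) \<Rightarrow> (('i, 'v, 'w) tgen \<Rightarrow>\<^sub>0 'k) set" where
  "tensor_rels s1 s2 V W = fvs.span
     ({gen ((i, v + v'), (j, w)) - gen ((i, v), (j, w)) - gen ((i, v'), (j, w)) | i j v v' w.
         v \<in> V i \<and> v' \<in> V i \<and> w \<in> W j} \<union>
      {gen ((i, v), (j, w + w')) - gen ((i, v), (j, w)) - gen ((i, v), (j, w')) | i j v w w'.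
         v \<in> V i \<and> w \<in> W j \<and> w' \<in> W j} \<union>
      {gen ((i, s1 c v), (j, w)) - fscale c (gen ((i, v), (j, w))) | i j c v w.
         v \<in> V i \<and> w \<in> W j} \<union>
      {gen ((i, v), (j, s2 c w)) - fscale c (gen ((i, v), (j, w))) | i j c v w.
         v \<in> V i \<and> w \<in> W j})"

definition tensor_deg :: "('k::field \<Rightarrow> 'v::ab_group_add \<Rightarrow> 'v) \<Rightarrow> ('k \<Rightarrow> 'w::ab_group_add \<Rightarrow> 'w) \<Rightarrow>
    ('i::plus \<Rightarrow> 'v set) \<Rightarrow> ('i \<Rightarrow> 'w set) \<Rightarrow> 'i \<Rightarrow> (('i, 'v, 'w) tgen \<Rightarrow>\<^sub>0 'k) set" where
  "tensor_deg s1 s2 V W n = quo (tensor_rels s1 s2 V W) `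
     fvs.span {gen ((i, v), (j, w)) | i j v w. v \<in> V i \<and> w \<in> W j \<and> i + j = n}"

definition tensor :: "('k::field \<Rightarrow> 'v::ab_group_add \<Rightarrow> 'v) \<Rightarrow> ('k \<Rightarrow> 'w::ab_group_add \<Rightarrow> 'w) \<Rightarrow>
    ('i \<Rightarrow> 'v set) \<Rightarrow> ('i \<Rightarrow> 'w set) \<Rightarrow> 'i \<Rightarrow> 'v \<Rightarrow> 'i \<Rightarrow> 'w \<Rightarrow> (('i, 'v, 'w) tgen \<Rightarrow>\<^sub>0 'k)" where
  "tensor s1 s2 V W i v j w = quo (tensor_rels s1 s2 V W) (gen ((i, v), (j, w)))"

section \<open>Superadditive categories\<close>

text \<open>
  Parities are elements of the two-element field \<open>bit\<close>. \<open>homd A X Y i\<close> is the homogeneous part of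
  degree \<open>i\<close> of the morphism superspace from \<open>X\<close> to \<open>Y\<close>. All morphism spaces are realised inside
  one ambient vector space (possible for any small category: take the direct sum of all
  of them); spaces for different pairs of objects may overlap, which is why composition takes the
  three objects as arguments. \<open>cmp A X Y Z f g\<close> means first \<open>f\<close>, then \<open>g\<close>.
\<close>

record ('k, 'o, 'm) supercat =
  scl :: "'k \<Rightarrow> 'm \<Rightarrow> 'm"
  Ob :: "'o set"
  homd :: "'o \<Rightarrow> 'o \<Rightarrow> bit \<Rightarrow> 'm set"
  cmp :: "'o \<Rightarrow> 'o \<Rightarrow> 'o \<Rightarrow> 'm \<Rightarrow> 'm \<Rightarrow> 'm"
  ident :: "'o \<Rightarrow> 'm"

definition mor :: "('k, 'o, 'm::ab_group_add) supercat \<Rightarrow> 'o \<Rightarrow> 'o \<Rightarrow> 'm set" where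
  "mor A X Y = {f + g | f g. f \<in> homd A X Y 0 \<and> g \<in> homd A X Y 1}"

locale superadditive_category =
  fixes A :: "('k::field, 'o, 'm::ab_group_add) supercat"
  assumes vector_space_scl: "vector_space (scl A)"
    and subspace_homd: "\<lbrakk>X \<in> Ob A; Y \<in> Ob A\<rbrakk> \<Longrightarrow> module.subspace (scl A) (homd A X Y i)"
    and homd_disjoint: "\<lbrakk>X \<in> Ob A; Y \<in> Ob A\<rbrakk> \<Longrightarrow> homd A X Y 0 \<inter> homd A X Y 1 = {0}"
    and cmp_homd: "\<lbrakk>X \<in> Ob A; Y \<in> Ob A; Z \<in> Ob A; f \<in> homd A X Y i; g \<in> homd A Y Z j\<rbrakk>
          \<Longrightarrow> cmp A X Y Z f g \<in> homd A X Z (i + j)"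
    and cmp_add_left: "\<lbrakk>X \<in> Ob A; Y \<in> Ob A; Z \<in> Ob A; f \<in> mor A X Y; f' \<in> mor A X Y; g \<in> mor A Y Z\<rbrakk>
          \<Longrightarrow> cmp A X Y Z (f + f') g = cmp A X Y Z f g + cmp A X Y Z f' g"
    and cmp_add_right: "\<lbrakk>X \<in> Ob A; Y \<in> Ob A; Z \<in> Ob A; f \<in> mor A X Y; g \<in> mor A Y Z; g' \<in> mor A Y Z\<rbrakk>
          \<Longrightarrow> cmp A X Y Z f (g + g') = cmp A X Y Z f g + cmp A X Y Z f g'"
    and cmp_scl_left: "\<lbrakk>X \<in> Ob A; Y \<in> Ob A; Z \<in> Ob A; f \<in> mor A X Y; g \<in> mor A Y Z\<rbrakk>
          \<Longrightarrow> cmp A X Y Z (scl A c f) g = scl A c (cmp A X Y Z f g)"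
    and cmp_scl_right: "\<lbrakk>X \<in> Ob A; Y \<in> Ob A; Z \<in> Ob A; f \<in> mor A X Y; g \<in> mor A Y Z\<rbrakk>
          \<Longrightarrow> cmp A X Y Z f (scl A c g) = scl A c (cmp A X Y Z f g)"
    and cmp_assoc: "\<lbrakk>W \<in> Ob A; X \<in> Ob A; Y \<in> Ob A; Z \<in> Ob A;
            f \<in> mor A W X; g \<in> mor A X Y; h \<in> mor A Y Z\<rbrakk>
          \<Longrightarrow> cmp A W Y Z (cmp A W X Y f g) h = cmp A W X Z f (cmp A X Y Z g h)"
    and ident_mor: "X \<in> Ob A \<Longrightarrow> ident A X \<in> mor A X X"
    and cmp_ident_left: "\<lbrakk>X \<in> Ob A; Y \<in> Ob A; f \<in> mor A X Y\<rbrakk> \<Longrightarrow> cmp A X X Y (ident A X) f = f"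
    and cmp_ident_right: "\<lbrakk>X \<in> Ob A; Y \<in> Ob A; f \<in> mor A X Y\<rbrakk> \<Longrightarrow> cmp A X Y Y f (ident A Y) = f"
begin

text \<open>Identities are automatically even; the definitions below use this.\<close>

lemma ident_even: "X \<in> Ob A \<Longrightarrow> ident A X \<in> homd A X X 0"
proof -
  assume X: "X \<in> Ob A"
  interpret vs: vector_space "scl A" by (rule vector_space_scl)
  note S = subspace_homd[OF X X]
  obtain e d where ed: "e \<in> homd A X X 0" "d \<in> homd A X X 1" "ident A X = e + d"
    using ident_mor[OF X] by (auto simp: mor_def)
  have em: "e \<in> mor A X X"
    using ed(1) vs.subspace_0[OF S[of 1]] by (force simp: mor_def)
  have dm: "d \<in> mor A X X"
    using ed(2) vs.subspace_0[OF S[of 0]] by (force simp: mor_def)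
  let ?c = "cmp A X X X"
  have c: "?c e e \<in> homd A X X 0" "?c e d \<in> homd A X X 1" "?c d e \<in> homd A X X 1" "?c d d \<in> homd A X X 0"
    using cmp_homd[OF X X X ed(1) ed(1)] cmp_homd[OF X X X ed(1) ed(2)]
      cmp_homd[OF X X X ed(2) ed(1)] cmp_homd[OF X X X ed(2) ed(2)] by simp_all
  have "e = ?c e e + ?c e d"
    using cmp_ident_right[OF X X em] cmp_add_right[OF X X X em em dm] ed(3) by simp
  hence "?c e d = e - ?c e e" by (simp add: algebra_simps)
  hence "?c e d \<in> homd A X X 0" using vs.subspace_diff[OF S ed(1) c(1)] by simp
  hence 1: "?c e d = 0" using c homd_disjoint[OF X X] by blast
  have "d = ?c d e + ?c d d"
    using cmp_ident_right[OF X X dm] cmp_add_right[OF X X X dm em dm] ed(3) by simp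
  hence "?c d d = d - ?c d e" by (simp add: algebra_simps)
  hence "?c d d \<in> homd A X X 1" using vs.subspace_diff[OF S ed(2) c(3)] by simp
  hence 2: "?c d d = 0" using c homd_disjoint[OF X X] by blast
  have "d = ?c e d + ?c d d"
    using cmp_ident_left[OF X X dm] cmp_add_left[OF X X X em dm dm] ed(3) by simp
  thus ?thesis using 1 2 ed by simp
qed

end

definition psign :: "bit \<Rightarrow> 'k::field" where
  "psign e = (if e = 0 then 1 else - 1)"

abbreviation hom_rels where
  "hom_rels A B P Q \<equiv> tensor_rels (scl A) (scl B) (homd A (fst P) (fst Q)) (homd B (snd P) (snd Q))"

definition tensor_cat :: "('k::field, 'o, 'a::ab_group_add) supercat \<Rightarrow>
    ('k, 'p, 'b::ab_group_add) supercat \<Rightarrow>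
    ('k, 'o \<times> 'p, (bit, 'a, 'b) tgen \<Rightarrow>\<^sub>0 'k) supercat" where
  "tensor_cat A B = \<lparr>
     scl = fscale,
     Ob = Ob A \<times> Ob B,
     homd = (\<lambda>P Q. tensor_deg (scl A) (scl B) (homd A (fst P) (fst Q)) (homd B (snd P) (snd Q))),
     cmp = (\<lambda>P Q R f g. quo (hom_rels A B P R)
       (lin_ext (\<lambda>((i1, f1), (i2, f2)). lin_ext (\<lambda>((j1, g1), (j2, g2)).
          fscale (psign (i2 * j1))
            (gen ((i1 + j1, cmp A (fst P) (fst Q) (fst R) f1 g1),
                  (i2 + j2, cmp B (snd P) (snd Q) (snd R) f2 g2)))) g) f)),
     ident = (\<lambda>P. tensor (scl A) (scl B) (homd A (fst P) (fst P)) (homd B (snd P) (snd P))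
                    0 (ident A (fst P)) 0 (ident B (snd P))) \<rparr>"

section \<open>The Hochschild complex\<close>

text \<open>
  A homogeneous tuple \<open>(a\<^sub>0, \<dots>, a\<^sub>n)\<close> is a list of \<open>n + 1\<close> entries \<open>(Y\<^sub>i, e\<^sub>i, a\<^sub>i)\<close>, where
  \<open>Y\<^sub>i\<close> is the source and \<open>e\<^sub>i\<close> the degree of \<open>a\<^sub>i\<close>; the target of \<open>a\<^sub>i\<close> is the source of the
  cyclically next entry. So \<open>Y\<^sub>0 = X\<^sub>0\<close> and \<open>Y\<^sub>i = X\<^bsub>n+1-i\<^esub>\<close> for \<open>i > 0\<close> when
  \<open>a\<^sub>0 : X\<^sub>0 \<rightarrow> X\<^sub>n\<close>, \<open>a\<^sub>1 : X\<^sub>n \<rightarrow> X\<^bsub>n-1\<^esub>\<close>, \<dots>, \<open>a\<^sub>n : X\<^sub>1 \<rightarrow> X\<^sub>0\<close>.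
\<close>

type_synonym ('o, 'm) entry = "'o \<times> bit \<times> 'm"

definition src :: "('o, 'm) entry list \<Rightarrow> nat \<Rightarrow> 'o" where
  "src ts i = fst (ts ! (i mod length ts))"

definition deg :: "('o, 'm) entry list \<Rightarrow> nat \<Rightarrow> bit" where
  "deg ts i = fst (snd (ts ! i))"

definition arr :: "('o, 'm) entry list \<Rightarrow> nat \<Rightarrow> 'm" where
  "arr ts i = snd (snd (ts ! i))"

definition cyc_tuple :: "('k, 'o, 'm) supercat \<Rightarrow> ('o, 'm) entry list \<Rightarrow> bool" where
  "cyc_tuple A ts \<longleftrightarrow> ts \<noteq> [] \<and>
     (\<forall>i<length ts. src ts i \<in> Ob A \<and> arr ts i \<in> homd A (src ts i) (src ts (i + 1)) (deg ts i))"

definition chain_rels :: "('k::field, 'o, 'm::ab_group_add) supercat \<Rightarrow>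
    (('o, 'm) entry list \<Rightarrow>\<^sub>0 'k) set" where
  "chain_rels A = fvs.span
     ({gen (ts[i := (src ts i, deg ts i, f + g)]) - gen (ts[i := (src ts i, deg ts i, f)])
         - gen (ts[i := (src ts i, deg ts i, g)]) | ts i f g.
         cyc_tuple A ts \<and> i < length ts \<and>
         f \<in> homd A (src ts i) (src ts (i + 1)) (deg ts i) \<and>
         g \<in> homd A (src ts i) (src ts (i + 1)) (deg ts i)} \<union>
      {gen (ts[i := (src ts i, deg ts i, scl A c f)])
         - fscale c (gen (ts[i := (src ts i, deg ts i, f)])) | ts i c f.
         cyc_tuple A ts \<and> i < length ts \<and>
         f \<in> homd A (src ts i) (src ts (i + 1)) (deg ts i)})"

definition hoch_chains :: "('k::field, 'o, 'm::ab_group_add) supercat \<Rightarrow> nat \<Rightarrow>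
    (('o, 'm) entry list \<Rightarrow>\<^sub>0 'k) set" where
  "hoch_chains A n = quo (chain_rels A) ` fvs.span {gen ts | ts. cyc_tuple A ts \<and> length ts = n + 1}"

definition face :: "('k, 'o, 'm) supercat \<Rightarrow> nat \<Rightarrow> ('o, 'm) entry list \<Rightarrow> ('o, 'm) entry list" where
  "face A i ts = take i ts @
     [(src ts i, deg ts i + deg ts (i + 1),
       cmp A (src ts i) (src ts (i + 1)) (src ts (i + 2)) (arr ts i) (arr ts (i + 1)))]
     @ drop (i + 2) ts"

definition last_face :: "('k, 'o, 'm) supercat \<Rightarrow> ('o, 'm) entry list \<Rightarrow> ('o, 'm) entry list" where
  "last_face A ts = (let n = length ts - 1 in
     (src ts n, deg ts n + deg ts 0, cmp A (src ts n) (src ts 0) (src ts 1) (arr ts n) (arr ts 0))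
     # take (n - 1) (tl ts))"

text \<open>\<open>boundary A\<close> is the differential on all chains at once; it vanishes on \<open>hoch_chains A 0\<close>.\<close>

definition boundary_tuple :: "('k::field, 'o, 'm) supercat \<Rightarrow> ('o, 'm) entry list \<Rightarrow>
    (('o, 'm) entry list \<Rightarrow>\<^sub>0 'k)" where
  "boundary_tuple A ts = (let n = length ts - 1 in
     if n = 0 then 0 else
       (\<Sum>i<n. fscale ((- 1) ^ i) (gen (face A i ts))) +
       fscale ((- 1) ^ n * psign (deg ts n * (\<Sum>i<n. deg ts i))) (gen (last_face A ts)))"

definition boundary :: "('k::field, 'o, 'm::ab_group_add) supercat \<Rightarrow>
    (('o, 'm) entry list \<Rightarrow>\<^sub>0 'k) \<Rightarrow> (('o, 'm) entry list \<Rightarrow>\<^sub>0 'k)" where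
  "boundary A x = quo (chain_rels A) (lin_ext (boundary_tuple A) x)"

definition cycles :: "('k::field, 'o, 'm::ab_group_add) supercat \<Rightarrow> nat \<Rightarrow>
    (('o, 'm) entry list \<Rightarrow>\<^sub>0 'k) set" where
  "cycles A n = {x \<in> hoch_chains A n. boundary A x = 0}"

definition hclass :: "('k::field, 'o, 'm::ab_group_add) supercat \<Rightarrow> nat \<Rightarrow>
    (('o, 'm) entry list \<Rightarrow>\<^sub>0 'k) \<Rightarrow> (('o, 'm) entry list \<Rightarrow>\<^sub>0 'k)" where
  "hclass A n = quo (boundary A ` hoch_chains A (n + 1))"

definition HH :: "('k::field, 'o, 'm::ab_group_add) supercat \<Rightarrow> nat \<Rightarrow>
    (('o, 'm) entry list \<Rightarrow>\<^sub>0 'k) set" where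
  "HH A n = hclass A n ` cycles A n"

section \<open>The tensor product of two Hochschild complexes\<close>

type_synonym ('k, 'o, 'a, 'p, 'b) tensor_chain =
  "(nat, ('o, 'a) entry list \<Rightarrow>\<^sub>0 'k, ('p, 'b) entry list \<Rightarrow>\<^sub>0 'k) tgen \<Rightarrow>\<^sub>0 'k"

abbreviation tensor_chains :: "('k::field, 'o, 'a::ab_group_add) supercat \<Rightarrow>
    ('k, 'p, 'b::ab_group_add) supercat \<Rightarrow> nat \<Rightarrow> ('k, 'o, 'a, 'p, 'b) tensor_chain set" where
  "tensor_chains A B \<equiv> tensor_deg fscale fscale (hoch_chains A) (hoch_chains B)"

text \<open>For \<open>p = 0\<close> the first summand is \<open>0 \<otimes> y\<close>, which is zero modulo the relations,
  so the truncated subtraction does no harm; likewise for \<open>q = 0\<close>.\<close>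

definition tensor_boundary :: "('k::field, 'o, 'a::ab_group_add) supercat \<Rightarrow>
    ('k, 'p, 'b::ab_group_add) supercat \<Rightarrow>
    ('k, 'o, 'a, 'p, 'b) tensor_chain \<Rightarrow> ('k, 'o, 'a, 'p, 'b) tensor_chain" where
  "tensor_boundary A B z = quo (tensor_rels fscale fscale (hoch_chains A) (hoch_chains B))
     (lin_ext (\<lambda>((p, x), (q, y)).
        gen ((p - 1, boundary A x), (q, y)) +
        fscale ((- 1) ^ p) (gen ((p, x), (q - 1, boundary B y)))) z)"

section \<open>The shuffle map\<close>

definition pq_shuffles :: "nat \<Rightarrow> nat \<Rightarrow> (nat \<Rightarrow> nat) set" where
  "pq_shuffles p q = {\<sigma>. \<sigma> permutes {1..p + q} \<and>
     strict_mono_on {1..p} \<sigma> \<and> strict_mono_on {p + 1..p + q} \<sigma>}"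

text \<open>
  The tuple \<open>\<sigma>(a\<^sub>0 \<otimes> b\<^sub>0, a\<^sub>1 \<otimes> 1, \<dots>, a\<^sub>p \<otimes> 1, 1 \<otimes> b\<^sub>1, \<dots>, 1 \<otimes> b\<^sub>q)\<close>: its entry at position
  \<open>k > 0\<close> is \<open>a\<^sub>j \<otimes> 1\<close> or \<open>1 \<otimes> b\<^bsub>j-p\<^esub>\<close>, where \<open>j = \<sigma>\<^sup>-\<^sup>1 k\<close>. The identity in it belongs to the
  object reached by the entries of the other factor at the positions before \<open>k\<close>.
\<close>

definition shuffle_tuple :: "('k::field, 'o, 'a::ab_group_add) supercat \<Rightarrow>
    ('k, 'p, 'b::ab_group_add) supercat \<Rightarrow> (nat \<Rightarrow> nat) \<Rightarrow>
    ('o, 'a) entry list \<Rightarrow> ('p, 'b) entry list \<Rightarrow>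
    ('o \<times> 'p, (bit, 'a, 'b) tgen \<Rightarrow>\<^sub>0 'k) entry list" where
  "shuffle_tuple A B \<sigma> s t =
     (let p = length s - 1; q = length t - 1;
          ten = (\<lambda>X X' Y Y'. tensor (scl A) (scl B) (homd A X X') (homd B Y Y'))
      in ((src s 0, src t 0), deg s 0 + deg t 0,
          ten (src s 0) (src s 1) (src t 0) (src t 1) (deg s 0) (arr s 0) (deg t 0) (arr t 0)) #
         map (\<lambda>k. let j = inv \<sigma> k in
           if j \<le> p then
             let Y = src t (1 + card {l \<in> {1..<k}. inv \<sigma> l > p})
             in ((src s j, Y), deg s j,
                 ten (src s j) (src s (j + 1)) Y Y (deg s j) (arr s j) 0 (ident B Y))
           else
             let i = j - p; X = src s (1 + card {l \<in> {1..<k}. inv \<sigma> l \<le> p})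
             in ((X, src t i), deg t i,
                 ten X X (src t i) (src t (i + 1)) 0 (ident A X) (deg t i) (arr t i)))
         [1..<p + q + 1])"

text \<open>
  The Koszul sign of the rearrangement of \<open>(a\<^sub>0, \<dots>, a\<^sub>p, b\<^sub>0, \<dots>, b\<^sub>q)\<close> effected by \<open>\<sigma>\<close>:
  \<open>b\<^sub>0\<close> moves past \<open>a\<^sub>1, \<dots>, a\<^sub>p\<close>, and \<open>b\<^sub>j\<close> moves past every \<open>a\<^sub>i\<close> that it precedes in the
  shuffled tuple. The action of \<open>\<sigma>\<close> on tuples itself carries no parity sign, so this factor has to
  be supplied separately: with the composition and last face as above, the sum without it is
  not a chain map. (If \<open>A = B\<close> is the exterior algebra on one odd generator \<open>\<epsilon>\<close> and
  \<open>a = b = (1, \<epsilon>)\<close>, both of them cycles, then \<open>(1, \<epsilon> \<otimes> 1, 1 \<otimes> \<epsilon>) - (1, 1 \<otimes> \<epsilon>, \<epsilon> \<otimes> 1)\<close> has the boundary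
  \<open>2 ((\<epsilon> \<otimes> 1, 1 \<otimes> \<epsilon>) - (1 \<otimes> \<epsilon>, \<epsilon> \<otimes> 1) - (1, \<epsilon> \<otimes> \<epsilon>))\<close>.) The factor is 1 if one of the
  two tuples is even in all entries, or if \<open>K\<close> has characteristic 2.
\<close>

definition koszul_sign :: "(nat \<Rightarrow> nat) \<Rightarrow> ('o, 'a) entry list \<Rightarrow> ('p, 'b) entry list \<Rightarrow> 'k::field" where
  "koszul_sign \<sigma> s t =
     (let p = length s - 1; q = length t - 1
      in psign (deg t 0 * (\<Sum>i=1..p. deg s i) +
                (\<Sum>(i, j)\<in>{(i, j). i \<in> {1..p} \<and> j \<in> {1..q} \<and> \<sigma> (p + j) < \<sigma> i}. deg s i * deg t j)))"

lemma koszul_sign_char_2: "(2::'k::field) = 0 \<Longrightarrow> koszul_sign \<sigma> s t = (1::'k)"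
proof -
  assume "(2::'k) = 0"
  hence "- 1 = (1::'k)" by (metis add.inverse_unique one_add_one)
  thus ?thesis by (simp add: koszul_sign_def psign_def Let_def)
qed

lemma koszul_sign_even_left:
  assumes "\<And>i. i < length s \<Longrightarrow> deg s i = 0"
  shows "koszul_sign \<sigma> s t = 1"
proof -
  have "(\<Sum>i=1..length s - 1. deg s i) = 0" by (rule sum.neutral) (auto intro!: assms)
  moreover have "(\<Sum>(i, j)\<in>{(i, j). i \<in> {1..length s - 1} \<and> j \<in> {1..length t - 1} \<and>
      \<sigma> (length s - 1 + j) < \<sigma> i}. deg s i * deg t j) = 0"
    by (rule sum.neutral) (auto simp: assms)
  ultimately show ?thesis by (simp add: koszul_sign_def psign_def)
qed

lemma koszul_sign_even_right:
  assumes "t \<noteq> []" "\<And>j. j < length t \<Longrightarrow> deg t j = 0"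
  shows "koszul_sign \<sigma> s t = 1"
proof -
  have "deg t 0 = 0" using assms by simp
  moreover have "(\<Sum>(i, j)\<in>{(i, j). i \<in> {1..length s - 1} \<and> j \<in> {1..length t - 1} \<and>
      \<sigma> (length s - 1 + j) < \<sigma> i}. deg s i * deg t j) = 0"
    by (rule sum.neutral) (auto simp: assms)
  ultimately show ?thesis by (simp add: koszul_sign_def psign_def)
qed

definition shuffle_gen :: "('k::field, 'o, 'a::ab_group_add) supercat \<Rightarrow>
    ('k, 'p, 'b::ab_group_add) supercat \<Rightarrow> ('o, 'a) entry list \<Rightarrow> ('p, 'b) entry list \<Rightarrow>
    (('o \<times> 'p, (bit, 'a, 'b) tgen \<Rightarrow>\<^sub>0 'k) entry list \<Rightarrow>\<^sub>0 'k)" where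
  "shuffle_gen A B s t = (\<Sum>\<sigma>\<in>pq_shuffles (length s - 1) (length t - 1).
     fscale (of_int (sign \<sigma>) * koszul_sign \<sigma> s t) (gen (shuffle_tuple A B \<sigma> s t)))"

definition sh :: "('k::field, 'o, 'a::ab_group_add) supercat \<Rightarrow>
    ('k, 'p, 'b::ab_group_add) supercat \<Rightarrow> ('k, 'o, 'a, 'p, 'b) tensor_chain \<Rightarrow>
    (('o \<times> 'p, (bit, 'a, 'b) tgen \<Rightarrow>\<^sub>0 'k) entry list \<Rightarrow>\<^sub>0 'k)" where
  "sh A B z = quo (chain_rels (tensor_cat A B))
     (lin_ext (\<lambda>((p, x), (q, y)). lin_ext (\<lambda>s. lin_ext (\<lambda>t. shuffle_gen A B s t) y) x) z)"

end

theory Submission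
  imports Defs
begin

text \<open>
  Because identities are even, the Koszul sign of the rearrangement
  \<open>(a\<^sub>0, \<dots>, a\<^sub>n, b\<^sub>0, \<dots>, b\<^sub>n) \<mapsto> (a\<^sub>0 \<otimes> b\<^sub>0, \<dots>, a\<^sub>n \<otimes> b\<^sub>n)\<close> turns \<open>C\<^sub>n(A) \<otimes> C\<^sub>n(B)\<close> into
  \<open>C\<^sub>n(A \<otimes> B)\<close>, compatibly with all faces. So \<open>C\<^sub>*(A \<otimes> B)\<close> is the diagonal of the bisimplicial vector
  space \<open>C\<^sub>m(A) \<otimes> C\<^sub>n(B)\<close>, and the shuffle map is the one of Eilenberg and Zilber. That it is a homotopy
  equivalence is proved by acyclic models on unnormalised chains: a natural operator is
  extended to all decalages (the shift parameters \<open>k\<close>, \<open>l\<close>), and composing the operator on the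
  decalage with the degeneracy \<open>s\<^sub>0\<close> is the cone with vertex 0. This contraction yields, by
  recursion on the degree, an inverse up to homotopy and both homotopies. Finally, over a field a complex
  is homotopy equivalent to its homology, which gives the Kuenneth isomorphism.
\<close>

section \<open>The Eilenberg--Zilber theorem for bisimplicial abelian groups\<close>

text \<open>The method of acyclic models usually quantifies over all bisimplicial groups and
  evaluates natural maps on products of simplices. To cone off a value on decalage (k, l) one has to
  know the operator on decalage (k + 1, l) or (k + 1, l + 1), and its naturality only along the
  faces that the larger shift forgets. The inverse and both homotopies solve equations of one form,
  "the boundary of the unknown is a given natural cycle", so one construction serves all three.

  The other obstacle is that a class in a quotient is represented by one chosen element of its
  coset. A map out of a quotient is the linear extension of a formula on generators; such a formula
  is shown to respect the relations (\<open>bilin\<close>, \<open>multilin\<close>), and only then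
  may it be evaluated on the classes \<open>tensor\<close> and \<open>cl\<close>. The comparison of
  the diagonal with the chains of the tensor category is inverted in the same way, by a formula for
  its left inverse.\<close>

definition sg :: "nat \<Rightarrow> 'v::ab_group_add \<Rightarrow> 'v" where
  "sg n x = (if even n then x else - x)"

lemma sg_0 [simp]: "sg 0 x = x"
  and sg_Suc [simp]: "sg (Suc n) x = - sg n x"
  and sg_zero [simp]: "sg n 0 = (0::'v::ab_group_add)"
  and sg_add: "sg n (x + y) = sg n x + sg n y"
  and sg_diff: "sg n (x - y) = sg n x - sg n y"
  and sg_sg: "sg m (sg n x) = sg (m + n) x"
  for x y :: "'v::ab_group_add"
  by (auto simp: sg_def)

lemma sg_sum: "sg n (\<Sum>i\<in>I. f i) = (\<Sum>i\<in>I. sg n (f i))"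
  by (simp add: sg_def sum_negf)

lemma sg_self [simp]: "sg n (sg n x) = x"
  by (simp add: sg_def)

lemma additive_sg: "additive f \<Longrightarrow> f (sg n x) = sg n (f x)"
  by (simp add: sg_def additive.minus)

text \<open>The case \<open>n = 0\<close> is separate because the sum over \<open>i \<le> 0\<close>
  would leave the term \<open>d 0 x\<close>, whereas the boundary of a 0-chain is 0.\<close>

definition alt_sum :: "nat \<Rightarrow> (nat \<Rightarrow> 'v \<Rightarrow> 'v) \<Rightarrow> 'v \<Rightarrow> 'v::ab_group_add" where
  "alt_sum n d x = (if n = 0 then 0 else (\<Sum>i\<le>n. sg i (d i x)))"

lemma alt_sum_0 [simp]: "alt_sum 0 d x = 0"
  by (simp add: alt_sum_def)

lemma alt_sum_Suc: "alt_sum (Suc n) d x = d 0 x - (\<Sum>i\<le>n. sg i (d (Suc i) x))"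
  unfolding alt_sum_def by (subst sum.atMost_Suc_shift) (simp add: sum_negf)

lemma alt_sum_Suc_Suc: "alt_sum (Suc (Suc n)) d x = d 0 x - alt_sum (Suc n) (\<lambda>i. d (Suc i)) x"
  by (subst alt_sum_Suc) (simp add: alt_sum_def)

lemma additive_alt: "(\<And>i. additive (d i)) \<Longrightarrow> additive (alt_sum n d)"
  by (auto simp: additive_def alt_sum_def sum.distrib sg_add)

text \<open>The index pairs split into those with j \<le> i and those with i < j. The map from (i,
  j) to (j - 1, i) carries the second half onto the first, keeps the value by the assumption and
  changes the parity of the exponent, so the halves cancel.\<close>

lemma alt_sum_alt_sum:
  fixes f :: "nat \<Rightarrow> nat \<Rightarrow> 'v::ab_group_add"
  assumes "\<And>i j. i \<le> j \<Longrightarrow> j \<le> n \<Longrightarrow> f i (Suc j) = f j i"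
  shows "(\<Sum>i\<le>n. \<Sum>j\<le>Suc n. sg (i + j) (f i j)) = 0"
proof -
  let ?S = "\<lambda>P. \<Sum>(i, j)\<in>{(i, j). i \<le> n \<and> j \<le> Suc n \<and> P i j}. sg (i + j) (f i j)"
  have fin: "finite {(i, j). i \<le> n \<and> j \<le> Suc n \<and> P i j}" for P
    by (rule finite_subset[of _ "{..n} \<times> {..Suc n}"]) auto
  have "(\<Sum>i\<le>n. \<Sum>j\<le>Suc n. sg (i + j) (f i j)) = (\<Sum>(i, j)\<in>{..n} \<times> {..Suc n}. sg (i + j) (f i j))"
    by (rule sum.cartesian_product)
  also have "{..n} \<times> {..Suc n} =
      {(i, j). i \<le> n \<and> j \<le> Suc n \<and> j \<le> i} \<union> {(i, j). i \<le> n \<and> j \<le> Suc n \<and> i < j}"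
    by auto
  also have "(\<Sum>(i, j)\<in>\<dots>. sg (i + j) (f i j)) = ?S (\<lambda>i j. j \<le> i) + ?S (\<lambda>i j. i < j)"
    by (rule sum.union_disjoint[OF fin fin]) auto
  also have "?S (\<lambda>i j. i < j) = (\<Sum>(i, j)\<in>{(i, j). i \<le> n \<and> j \<le> Suc n \<and> j \<le> i}. - sg (i + j) (f i j))"
    by (rule sum.reindex_bij_witness[of _ "\<lambda>(i, j). (j, Suc i)" "\<lambda>(i, j). (j - 1, i)"])
      (auto simp: assms[symmetric] add.commute elim!: less_natE intro: assms)
  finally show ?thesis unfolding case_prod_beta sum_negf by simp
qed

lemma alt_sum_alt:
  assumes "\<And>i. additive (d i)"
    and "\<And>i j. i \<le> j \<Longrightarrow> j \<le> n \<Longrightarrow> d i (d (Suc j) x) = d j (d i x)"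
  shows "alt_sum n d (alt_sum (Suc n) d x) = 0"
proof (cases "n = 0")
  case False
  have "alt_sum n d (alt_sum (Suc n) d x) = (\<Sum>i\<le>n. \<Sum>j\<le>Suc n. sg (i + j) (d i (d j x)))"
    using False by (simp only: alt_sum_def if_False additive.sum[OF assms(1)] additive_sg[OF assms(1)] sg_sum sg_sg
        nat.distinct simp_thms)
  also have "\<dots> = 0" by (rule alt_sum_alt_sum) (rule assms(2))
  finally show ?thesis .
qed simp

text \<open>The boundary of the decalage of shift \<open>k\<close>: an element of degree
  \<open>n\<close> there has degree \<open>n + k\<close> in the original object.\<close>

definition shifted_alt :: "(nat \<Rightarrow> 'v \<Rightarrow> 'v) \<Rightarrow> nat \<Rightarrow> nat \<Rightarrow> 'v \<Rightarrow> 'v::ab_group_add" where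
  "shifted_alt d n k = alt_sum n (\<lambda>i. d (i + k))"

text \<open>Faces and degeneracies are maps on the whole carrier, one for each index, and their
  identities are demanded only on the components. The second degree is a mere parameter, so that the
  vertical structure is an instance with the two degrees exchanged.\<close>

locale simplicial_rows =
  fixes E :: "nat \<Rightarrow> nat \<Rightarrow> 'v::ab_group_add set" and dh uh :: "nat \<Rightarrow> 'v \<Rightarrow> 'v"
  assumes E_zero: "0 \<in> E m n"
    and E_add: "x \<in> E m n \<Longrightarrow> y \<in> E m n \<Longrightarrow> x + y \<in> E m n"
    and E_minus: "x \<in> E m n \<Longrightarrow> - x \<in> E m n"
    and additive_dh: "additive (dh i)" and additive_uh: "additive (uh i)"
    and dh_in: "x \<in> E (Suc m) n \<Longrightarrow> i \<le> Suc m \<Longrightarrow> dh i x \<in> E m n"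
    and uh_in: "x \<in> E m n \<Longrightarrow> i \<le> m \<Longrightarrow> uh i x \<in> E (Suc m) n"
    and dh_dh: "x \<in> E (Suc (Suc m)) n \<Longrightarrow> i \<le> j \<Longrightarrow> j \<le> Suc m \<Longrightarrow> dh i (dh (Suc j) x) = dh j (dh i x)"
    and dh_uh_less: "x \<in> E (Suc m) n \<Longrightarrow> i \<le> j \<Longrightarrow> j \<le> m \<Longrightarrow> dh i (uh (Suc j) x) = uh j (dh i x)"
    and dh_uh: "x \<in> E m n \<Longrightarrow> i \<le> m \<Longrightarrow> dh i (uh i x) = x"
    and dh_uh_Suc: "x \<in> E m n \<Longrightarrow> i \<le> m \<Longrightarrow> dh (Suc i) (uh i x) = x"
    and dh_uh_greater: "x \<in> E (Suc m) n \<Longrightarrow> j < i \<Longrightarrow> i \<le> Suc m \<Longrightarrow> dh (Suc i) (uh j x) = uh j (dh i x)"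
begin

lemmas dh_simps [simp] = additive.zero[OF additive_dh] additive.add[OF additive_dh]
  additive.minus[OF additive_dh] additive.diff[OF additive_dh] additive_sg[OF additive_dh]
lemmas uh_simps [simp] = additive.zero[OF additive_uh] additive.add[OF additive_uh]
  additive.minus[OF additive_uh] additive.diff[OF additive_uh] additive_sg[OF additive_uh]

lemma E_sg: "x \<in> E m n \<Longrightarrow> sg i x \<in> E m n"
  by (simp add: sg_def E_minus)

abbreviation hb :: "nat \<Rightarrow> nat \<Rightarrow> 'v \<Rightarrow> 'v" where "hb \<equiv> shifted_alt dh"

lemma additive_hb: "additive (hb n k)"
  by (simp add: shifted_alt_def additive_alt additive_dh)

lemmas hb_simps [simp] = additive.zero[OF additive_hb] additive.add[OF additive_hb]
  additive.minus[OF additive_hb] additive.diff[OF additive_hb] additive_sg[OF additive_hb]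

lemma hb_hb: "x \<in> E (Suc n + k) m \<Longrightarrow> hb n k (hb (Suc n) k x) = 0"
  unfolding shifted_alt_def
proof (cases n)
  case (Suc n')
  assume x: "x \<in> E (Suc n + k) m"
  show "alt_sum n (\<lambda>i. dh (i + k)) (alt_sum (Suc n) (\<lambda>i. dh (i + k)) x) = 0"
    by (rule alt_sum_alt) (use x Suc in \<open>auto simp: additive_dh intro!: dh_dh[of x "n' + k" m]\<close>)
qed simp

text \<open>\<open>uh k\<close> is an extra degeneracy for shift \<open>k + 1\<close>: the face with
  index \<open>k + 1\<close> cancels it and the higher ones commute with it. What then remains are
  the faces of \<open>hb (Suc p) k y\<close> apart from face \<open>k\<close>, which accounts for
  the last term.\<close>

lemma hb_uh:
  assumes y: "y \<in> E (Suc p + k) n"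
  shows "hb (Suc p) (Suc k) (uh k y) = y + uh k (hb (Suc p) k y) - uh k (dh k y)"
proof -
  have "hb (Suc p) (Suc k) (uh k y) = y - (\<Sum>i\<le>p. sg i (dh (Suc (Suc (i + k))) (uh k y)))"
    using dh_uh_Suc[OF y, of k] by (simp add: shifted_alt_def alt_sum_Suc)
  also have "(\<Sum>i\<le>p. sg i (dh (Suc (Suc (i + k))) (uh k y))) = (\<Sum>i\<le>p. sg i (uh k (dh (Suc (i + k)) y)))"
    by (rule sum.cong) (use y in \<open>auto simp: dh_uh_greater\<close>)
  also have "\<dots> = uh k (dh k y) - uh k (hb (Suc p) k y)"
    by (simp add: shifted_alt_def alt_sum_Suc additive.sum[OF additive_uh])
  finally show ?thesis by simp
qed

end

lemma shifted_alt_0 [simp]: "shifted_alt d 0 k x = 0"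
  and shifted_alt_1: "shifted_alt d (Suc 0) k x = d k x - d (Suc k) x"
  by (simp_all add: shifted_alt_def alt_sum_Suc)

text \<open>Face 0 minus the boundary of the next decalage: with this, a statement about boundaries
  becomes an induction over shifts. It fails for \<open>n = 0\<close>, where
  \<open>shifted_alt d 0\<close> is 0 instead of a face; hence the separate treatment of low degrees
  in the proofs below.\<close>

lemma shifted_alt_Suc: "0 < n \<Longrightarrow> shifted_alt d (Suc n) k x = d k x - shifted_alt d n (Suc k) x"
  by (cases n) (simp_all add: shifted_alt_def alt_sum_Suc_Suc)

locale bisimplicial = h: simplicial_rows E dh uh + v: simplicial_rows "\<lambda>m n. E n m" dv uv
  for E :: "nat \<Rightarrow> nat \<Rightarrow> 'v::ab_group_add set" and dh dv uh uv :: "nat \<Rightarrow> 'v \<Rightarrow> 'v" +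
  assumes dh_dv: "x \<in> E (Suc m) (Suc n) \<Longrightarrow> i \<le> Suc m \<Longrightarrow> j \<le> Suc n \<Longrightarrow> dh i (dv j x) = dv j (dh i x)"
    and dh_uv: "x \<in> E (Suc m) n \<Longrightarrow> i \<le> Suc m \<Longrightarrow> j \<le> n \<Longrightarrow> dh i (uv j x) = uv j (dh i x)"
    and uh_dv: "x \<in> E m (Suc n) \<Longrightarrow> i \<le> m \<Longrightarrow> j \<le> Suc n \<Longrightarrow> uh i (dv j x) = dv j (uh i x)"
    and uh_uv: "x \<in> E m n \<Longrightarrow> i \<le> m \<Longrightarrow> j \<le> n \<Longrightarrow> uh i (uv j x) = uv j (uh i x)"
begin

lemmas E_zero = h.E_zero and E_add = h.E_add and E_minus = h.E_minus and E_sg = h.E_sg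
  and additive_dh = h.additive_dh and additive_uh = h.additive_uh and dh_in = h.dh_in and uh_in = h.uh_in
  and dh_dh = h.dh_dh and dh_uh_less = h.dh_uh_less and dh_uh = h.dh_uh and dh_uh_Suc = h.dh_uh_Suc
  and hb_hb = h.hb_hb and hb_uh = h.hb_uh

lemmas additive_dv = v.additive_dh and additive_uv = v.additive_uh and dv_in = v.dh_in and uv_in = v.uh_in
  and dv_dv = v.dh_dh and dv_uv = v.dh_uh and dv_uv_Suc = v.dh_uh_Suc and vb_vb = v.hb_hb and vb_uv = v.hb_uh

abbreviation hb where "hb \<equiv> shifted_alt dh"
abbreviation vb where "vb \<equiv> shifted_alt dv"

text \<open>Lets vertical statements be read off from horizontal ones in the transposed
  object.\<close>

lemma swap: "bisimplicial (\<lambda>m n. E n m) dv dh uv uh"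
proof (intro bisimplicial.intro bisimplicial_axioms.intro)
  fix x :: 'v and m n i j
  show "dv i (dh j x) = dh j (dv i x)" if "x \<in> E (Suc n) (Suc m)" "i \<le> Suc m" "j \<le> Suc n"
    using dh_dv[OF that(1,3,2)] by simp
  show "dv i (uh j x) = uh j (dv i x)" if "x \<in> E n (Suc m)" "i \<le> Suc m" "j \<le> n"
    using uh_dv[OF that(1,3,2)] by simp
  show "uv i (dh j x) = dh j (uv i x)" if "x \<in> E (Suc n) m" "i \<le> m" "j \<le> Suc n"
    using dh_uv[OF that(1,3,2)] by simp
  show "uv i (uh j x) = uh j (uv i x)" if "x \<in> E n m" "i \<le> m" "j \<le> n"
    using uh_uv[OF that(1,3,2)] by simp
qed (fact v.simplicial_rows_axioms h.simplicial_rows_axioms)+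

text \<open>
  A natural operator is given together with its values \<open>U k l\<close> on all decalages, which forget the first
  \<open>k\<close> horizontal and the first \<open>l\<close> vertical faces and degeneracies. Naturality is needed only
  along the forgotten faces, which are maps between decalages.
\<close>

definition natural :: "nat \<Rightarrow> nat \<Rightarrow> nat \<Rightarrow> nat \<Rightarrow> (nat \<Rightarrow> nat \<Rightarrow> 'v \<Rightarrow> 'v) \<Rightarrow> bool" where
  "natural a b c d U \<longleftrightarrow> (\<forall>k l. additive (U k l)) \<and>
     (\<forall>k l. \<forall>x\<in>E (a + k) (b + l). U k l x \<in> E (c + k) (d + l)) \<and>
     (\<forall>k l j. \<forall>x\<in>E (Suc (a + k)) (b + l). j \<le> k \<longrightarrow> dh j (U (Suc k) l x) = U k l (dh j x)) \<and>
     (\<forall>k l j. \<forall>x\<in>E (a + k) (Suc (b + l)). j \<le> l \<longrightarrow> dv j (U k (Suc l) x) = U k l (dv j x))"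

lemma naturalI:
  assumes "\<And>k l. additive (U k l)"
    and "\<And>k l x. x \<in> E (a + k) (b + l) \<Longrightarrow> U k l x \<in> E (c + k) (d + l)"
    and "\<And>k l j x. x \<in> E (Suc (a + k)) (b + l) \<Longrightarrow> j \<le> k \<Longrightarrow> dh j (U (Suc k) l x) = U k l (dh j x)"
    and "\<And>k l j x. x \<in> E (a + k) (Suc (b + l)) \<Longrightarrow> j \<le> l \<Longrightarrow> dv j (U k (Suc l) x) = U k l (dv j x)"
  shows "natural a b c d U"
  using assms by (simp add: natural_def)

lemma natural_additive: "natural a b c d U \<Longrightarrow> additive (U k l)"
  and natural_in: "natural a b c d U \<Longrightarrow> x \<in> E (a + k) (b + l) \<Longrightarrow> U k l x \<in> E (c + k) (d + l)"
  and natural_dh: "natural a b c d U \<Longrightarrow> x \<in> E (Suc (a + k)) (b + l) \<Longrightarrow> j \<le> k \<Longrightarrow>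
    dh j (U (Suc k) l x) = U k l (dh j x)"
  and natural_dv: "natural a b c d U \<Longrightarrow> x \<in> E (a + k) (Suc (b + l)) \<Longrightarrow> j \<le> l \<Longrightarrow>
    dv j (U k (Suc l) x) = U k l (dv j x)"
  by (simp_all add: natural_def)

lemmas natural_simps = additive.zero[OF natural_additive] additive.add[OF natural_additive]
  additive.minus[OF natural_additive] additive.diff[OF natural_additive]
  additive_sg[OF natural_additive] additive.sum[OF natural_additive]

lemma natural_id: "natural a b a b (\<lambda>k l x. x)"
  by (rule naturalI) (auto simp: additive_def)

lemma natural_zero: "natural a b c d (\<lambda>k l x. 0)"
  by (rule naturalI) (auto simp: additive_def E_zero)

lemma natural_comp:
  assumes U: "natural a b c d U" and V: "natural c d e f V"
  shows "natural a b e f (\<lambda>k l x. V k l (U k l x))"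
proof (rule naturalI)
  show "additive (\<lambda>x. V k l (U k l x))" for k l
    by (simp add: additive_def natural_simps(2)[OF U] natural_simps(2)[OF V])
  show "V k l (U k l x) \<in> E (e + k) (f + l)" if "x \<in> E (a + k) (b + l)" for k l x
    by (rule natural_in[OF V natural_in[OF U that]])
  show "dh j (V (Suc k) l (U (Suc k) l x)) = V k l (U k l (dh j x))"
    if "x \<in> E (Suc (a + k)) (b + l)" "j \<le> k" for k l j x
    using natural_dh[OF V, of "U (Suc k) l x" k l j] natural_in[OF U, of x "Suc k" l] that
      natural_dh[OF U that] by simp
  show "dv j (V k (Suc l) (U k (Suc l) x)) = V k l (U k l (dv j x))"
    if "x \<in> E (a + k) (Suc (b + l))" "j \<le> l" for k l j x
    using natural_dv[OF V, of "U k (Suc l) x" k l j] natural_in[OF U, of x k "Suc l"] that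
      natural_dv[OF U that] by simp
qed

lemma natural_add:
  assumes U: "natural a b c d U" and V: "natural a b c d V"
  shows "natural a b c d (\<lambda>k l x. U k l x + V k l x)"
  by (rule naturalI) (simp_all add: additive_def natural_simps(2)[OF U] natural_simps(2)[OF V]
      natural_in[OF U] natural_in[OF V] E_add natural_dh[OF U] natural_dh[OF V] natural_dv[OF U] natural_dv[OF V])

lemma natural_sg:
  assumes U: "natural a b c d U"
  shows "natural a b c d (\<lambda>k l x. sg i (U k l x))"
  by (rule naturalI) (simp_all add: additive_def natural_simps(2)[OF U] sg_add
      natural_in[OF U] E_sg natural_dh[OF U] natural_dv[OF U])

lemma natural_diff:
  assumes U: "natural a b c d U" and V: "natural a b c d V"
  shows "natural a b c d (\<lambda>k l x. U k l x - V k l x)"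
  using natural_add[OF U natural_sg[OF V, of 1]] by simp

lemma natural_sum: "(\<And>i. i \<in> I \<Longrightarrow> natural a b c d (U i)) \<Longrightarrow> natural a b c d (\<lambda>k l x. \<Sum>i\<in>I. U i k l x)"
  by (induction I rule: infinite_finite_induct) (auto intro!: natural_zero natural_add)

text \<open>The index has to move with the shift: a forgotten face \<open>j \<le> k\<close> passes
  \<open>dh (i + Suc k)\<close> by a simplicial identity that lowers the index of the latter by
  one.\<close>

lemma natural_dh_op: "i \<le> Suc a \<Longrightarrow> natural (Suc a) b a b (\<lambda>k l. dh (i + k))"
proof (rule naturalI)
  fix k l j x assume "x \<in> E (Suc (Suc a + k)) (b + l)" "j \<le> k" "i \<le> Suc a"
  thus "dh j (dh (i + Suc k) x) = dh (i + k) (dh j x)"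
    using dh_dh[of x "a + k" "b + l" j "i + k"] by simp
next
  fix k l j x assume "x \<in> E (Suc a + k) (Suc (b + l))" "j \<le> l" "i \<le> Suc a"
  thus "dv j (dh (i + k) x) = dh (i + k) (dv j x)"
    using dh_dv[of x "a + k" "b + l" "i + k" j] by simp
qed (auto simp: additive_dh intro!: dh_in)

lemma natural_swapD: "natural a b c d U \<Longrightarrow> bisimplicial.natural (\<lambda>m n. E n m) dv dh b a d c (\<lambda>l k. U k l)"
  by (rule bisimplicial.naturalI[OF swap]) (fact natural_additive natural_in natural_dv natural_dh)+

lemma natural_swap: "bisimplicial.natural (\<lambda>m n. E n m) dv dh b a d c (\<lambda>l k. U k l) \<longleftrightarrow> natural a b c d U"
  using natural_swapD bisimplicial.natural_swapD[OF swap] by fast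

lemma natural_dv_op: "i \<le> Suc b \<Longrightarrow> natural a (Suc b) a b (\<lambda>k l. dv (i + l))"
  unfolding natural_swap[symmetric] by (rule bisimplicial.natural_dh_op[OF swap])

section \<open>The diagonal complex\<close>

definition db :: "nat \<Rightarrow> nat \<Rightarrow> nat \<Rightarrow> 'v \<Rightarrow> 'v" where "db n k l = alt_sum n (\<lambda>i x. dh (i + k) (dv (i + l) x))"

lemma db_0 [simp]: "db 0 k l x = 0"
  and db_1: "db (Suc 0) k l x = dh k (dv l x) - dh (Suc k) (dv (Suc l) x)"
  by (simp_all add: db_def alt_sum_Suc)

lemma db_Suc: "0 < n \<Longrightarrow> db (Suc n) k l x = dh k (dv l x) - db n (Suc k) (Suc l) x"
  by (cases n) (simp_all add: db_def alt_sum_Suc_Suc)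

lemma additive_db: "additive (db n k l)"
  unfolding db_def by (rule additive_alt) (simp add: additive_def)

lemmas db_simps [simp] = additive.zero[OF additive_db] additive.add[OF additive_db]
  additive.minus[OF additive_db] additive.diff[OF additive_db] additive_sg[OF additive_db]

lemma natural_hb: "natural n b (n - 1) b (\<lambda>k l. hb n k)"
proof (cases n)
  case 0 thus ?thesis using natural_zero[of 0 b 0 b] by (simp add: shifted_alt_def[abs_def] alt_sum_def[abs_def])
next
  case (Suc m)
  have "natural (Suc m) b m b (\<lambda>k l x. \<Sum>i\<in>{..Suc m}. sg i (dh (i + k) x))"
    by (rule natural_sum, rule natural_sg, rule natural_dh_op) simp
  thus ?thesis unfolding Suc by (simp add: shifted_alt_def[abs_def] alt_sum_def[abs_def])
qed

lemma natural_vb: "natural a n a (n - 1) (\<lambda>k l. vb n l)"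
  unfolding natural_swap[symmetric] by (rule bisimplicial.natural_hb[OF swap])

lemma natural_db: "natural n n (n - 1) (n - 1) (\<lambda>k l. db n k l)"
proof (cases n)
  case 0 thus ?thesis using natural_zero[of 0 0 0 0] by (simp add: db_def[abs_def] alt_sum_def[abs_def])
next
  case (Suc m)
  have "natural (Suc m) (Suc m) m m (\<lambda>k l x. \<Sum>i\<in>{..Suc m}. sg i (dh (i + k) (dv (i + l) x)))"
    by (rule natural_sum, rule natural_sg, rule natural_comp[OF natural_dv_op natural_dh_op]) auto
  thus ?thesis unfolding Suc by (simp add: db_def[abs_def] alt_sum_def[abs_def])
qed

lemma db_db: "x \<in> E (Suc n + k) (Suc n + l) \<Longrightarrow> db n k l (db (Suc n) k l x) = 0"
  unfolding db_def
proof (cases n)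
  case (Suc n')
  assume x: "x \<in> E (Suc n + k) (Suc n + l)"
  show "alt_sum n (\<lambda>i x. dh (i + k) (dv (i + l) x)) (alt_sum (Suc n) (\<lambda>i x. dh (i + k) (dv (i + l) x)) x) = 0"
  proof (rule alt_sum_alt)
    fix i j assume ij: "i \<le> j" "j \<le> n"
    have x': "x \<in> E (Suc (Suc (n' + k))) (Suc (Suc (n' + l)))" using x Suc by simp
    have "dh (i + k) (dv (i + l) (dh (Suc j + k) (dv (Suc j + l) x)))
        = dh (i + k) (dh (Suc j + k) (dv (i + l) (dv (Suc j + l) x)))"
      using ij Suc x' dh_dv[of "dv (Suc j + l) x" "Suc (n' + k)" "n' + l" "Suc j + k" "i + l"] dv_in[OF x', of "Suc j + l"] by simp
    also have "dv (i + l) (dv (Suc j + l) x) = dv (j + l) (dv (i + l) x)"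
      using dv_dv[OF x', of "i + l" "j + l"] ij Suc by simp
    also have "dh (i + k) (dh (Suc j + k) \<dots>) = dh (j + k) (dh (i + k) \<dots>)"
      using dh_dh[of "dv (j + l) (dv (i + l) x)" "n' + k" "n' + l" "i + k" "j + k"] ij Suc
      dv_in[OF x', of "i + l"] dv_in[of "dv (i + l) x" "Suc (Suc (n' + k))" "n' + l" "j + l"] by simp
    also have "dh (i + k) (dv (j + l) (dv (i + l) x)) = dv (j + l) (dh (i + k) (dv (i + l) x))"
      using dh_dv[of "dv (i + l) x" "Suc (n' + k)" "n' + l" "i + k" "j + l"] ij Suc dv_in[OF x', of "i + l"] by simp
    finally show "dh (i + k) (dv (i + l) (dh (Suc j + k) (dv (Suc j + l) x))) =
         dh (j + k) (dv (j + l) (dh (i + k) (dv (i + l) x)))" .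
  qed (simp add: additive_def)
qed simp

lemma hb_vb: "x \<in> E (m + k) (n + l) \<Longrightarrow> hb m k (vb n l x) = vb n l (hb m k x)"
proof (cases m; cases n)
  fix m' n' assume x: "x \<in> E (m + k) (n + l)" and mn: "m = Suc m'" "n = Suc n'"
  have c: "dh (i + k) (dv (j + l) x) = dv (j + l) (dh (i + k) x)" if "i \<le> m" "j \<le> n" for i j
    using dh_dv[of x "m' + k" "n' + l"] x mn that by simp
  have "hb m k (vb n l x) = (\<Sum>i\<le>m. \<Sum>j\<le>n. sg i (sg j (dv (j + l) (dh (i + k) x))))"
    using mn by (simp add: shifted_alt_def alt_sum_def additive.sum[OF additive_dh] sg_sum c del: sum.atMost_Suc)
  also have "\<dots> = (\<Sum>j\<le>n. \<Sum>i\<le>m. sg i (sg j (dv (j + l) (dh (i + k) x))))"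
    by (rule sum.swap)
  also have "\<dots> = vb n l (hb m k x)"
    using mn by (simp add: shifted_alt_def alt_sum_def additive.sum[OF additive_dv] sg_sum sg_sg add.commute del: sum.atMost_Suc)
  finally show ?thesis .
qed simp_all


text \<open>On simplices this prepends the vertex 0, so it is the cone of an acyclic model.\<close>

definition cone_h :: "(nat \<Rightarrow> nat \<Rightarrow> 'v \<Rightarrow> 'v) \<Rightarrow> nat \<Rightarrow> nat \<Rightarrow> 'v \<Rightarrow> 'v" where
  "cone_h U k l x = U (Suc k) l (uh k x)"

text \<open>A forgotten face \<open>j \<le> k\<close> passes \<open>uh (Suc k)\<close> and leaves
  \<open>uh k\<close> behind; the rest is the naturality of \<open>U\<close> at the next
  shift.\<close>

lemma natural_cone_h:
  assumes U: "natural a b c d U"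
  shows "natural a b (Suc c) d (cone_h U)"
proof (rule naturalI)
  fix k l j x assume x: "x \<in> E (Suc (a + k)) (b + l)" "j \<le> k"
  have "uh (Suc k) x \<in> E (Suc (a + Suc k)) (b + l)" using uh_in[OF x(1), of "Suc k"] by simp
  from natural_dh[OF U this, of j] x
  show "dh j (cone_h U (Suc k) l x) = cone_h U k l (dh j x)"
    by (simp add: cone_h_def dh_uh_less)
next
  fix k l j x assume x: "x \<in> E (a + k) (Suc (b + l))" "j \<le> l"
  have "uh k x \<in> E (a + Suc k) (Suc (b + l))" using uh_in[OF x(1), of k] by simp
  from natural_dv[OF U this, of j] x uh_dv[OF x(1), of k j]
  show "dv j (cone_h U k (Suc l) x) = cone_h U k l (dv j x)" by (simp add: cone_h_def)
next
  fix k l x assume "x \<in> E (a + k) (b + l)"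
  thus "cone_h U k l x \<in> E (Suc c + k) (d + l)"
    using natural_in[OF U, of "uh k x" "Suc k" l] uh_in[of x "a + k" "b + l" k] by (simp add: cone_h_def)
qed (simp add: additive_def cone_h_def natural_simps(2)[OF U])

lemma natural_cone_v: "natural a b c d U \<Longrightarrow> natural a b c (Suc d) (\<lambda>k l x. U k (Suc l) (uv l x))"
  using bisimplicial.natural_cone_h[OF swap, of b a d c "\<lambda>l k. U k l"] natural_swap[of b a "Suc d" c "\<lambda>k l x. U k (Suc l) (uv l x)"]
  by (simp add: natural_swap bisimplicial.cone_h_def[OF swap, abs_def])

text \<open>One step of the shuffle recursion. Vertically nothing happens to \<open>x\<close>:
  degree \<open>Suc b\<close> over shift \<open>l\<close> is reread as degree \<open>b\<close> over
  shift \<open>Suc l\<close>. Horizontally the degeneracy makes up for the larger shift.\<close>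

lemma natural_shift_h:
  assumes U: "natural a b c d U"
  shows "natural a (Suc b) (Suc c) (Suc d) (\<lambda>k l x. U (Suc k) (Suc l) (uh k x))"
proof (rule naturalI)
  fix k l j x assume x: "x \<in> E (Suc (a + k)) (Suc b + l)" "j \<le> k"
  have "uh (Suc k) x \<in> E (Suc (a + Suc k)) (b + Suc l)" using uh_in[OF x(1), of "Suc k"] by simp
  from natural_dh[OF U this, of j] x
  show "dh j (U (Suc (Suc k)) (Suc l) (uh (Suc k) x)) = U (Suc k) (Suc l) (uh k (dh j x))"
    by (simp add: dh_uh_less)
next
  fix k l j x assume x: "x \<in> E (a + k) (Suc (Suc b + l))" "j \<le> l"
  have "uh k x \<in> E (a + Suc k) (Suc (b + Suc l))" using uh_in[OF x(1), of k] by simp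
  from natural_dv[OF U this, of j] x uh_dv[OF x(1), of k j]
  show "dv j (U (Suc k) (Suc (Suc l)) (uh k x)) = U (Suc k) (Suc l) (uh k (dv j x))" by simp
next
  fix k l x assume "x \<in> E (a + k) (Suc b + l)"
  thus "U (Suc k) (Suc l) (uh k x) \<in> E (Suc c + k) (Suc d + l)"
    using natural_in[OF U, of "uh k x" "Suc k" "Suc l"] uh_in[of x "a + k" "Suc b + l" k] by simp
qed (simp add: additive_def natural_simps(2)[OF U])

lemma natural_shift_v: "natural a b c d U \<Longrightarrow> natural (Suc a) b (Suc c) (Suc d) (\<lambda>k l x. U (Suc k) (Suc l) (uv l x))"
  using bisimplicial.natural_shift_h[OF swap, of b a d c "\<lambda>l k. U k l"] natural_swap[of b "Suc a" "Suc d" "Suc c" "\<lambda>k l x. U (Suc k) (Suc l) (uv l x)"]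
  by (simp add: natural_swap)

text \<open>The two summands of the last equation collect the shuffles that start with an entry of the first
  and of the second factor.\<close>

fun shf :: "nat \<Rightarrow> nat \<Rightarrow> nat \<Rightarrow> nat \<Rightarrow> 'v \<Rightarrow> 'v" where
  "shf 0 0 k l x = x"
| "shf (Suc p) 0 k l x = shf p 0 (Suc k) (Suc l) (uv l x)"
| "shf 0 (Suc q) k l x = shf 0 q (Suc k) (Suc l) (uh k x)"
| "shf (Suc p) (Suc q) k l x = shf p (Suc q) (Suc k) (Suc l) (uv l x) +
     sg (Suc p) (shf (Suc p) q (Suc k) (Suc l) (uh k x))"

lemma natural_shf: "natural p q (p + q) (p + q) (shf p q)"
proof (induction n \<equiv> "p + q" arbitrary: p q)
  case 0
  thus ?case using natural_id[of 0 0] by (simp add: fun_eq_iff[of "shf 0 0"] cong: if_cong)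
next
  case (Suc n)
  consider p' where "p = Suc p'" "q = 0" | q' where "p = 0" "q = Suc q'" | p' q' where "p = Suc p'" "q = Suc q'"
    using Suc.hyps(2) by (cases p; cases q) auto
  thus ?case
  proof cases
    case 1
    have e: "shf (Suc p') 0 = (\<lambda>k l x. shf p' 0 (Suc k) (Suc l) (uv l x))" by (intro ext) simp
    show ?thesis using natural_shift_v[OF Suc.hyps(1)[of p' 0]] Suc.hyps(2) 1 by (simp add: e)
  next
    case 2
    have e: "shf 0 (Suc q') = (\<lambda>k l x. shf 0 q' (Suc k) (Suc l) (uh k x))" by (intro ext) simp
    show ?thesis using natural_shift_h[OF Suc.hyps(1)[of 0 q']] Suc.hyps(2) 2 by (simp add: e)
  next
    case 3
    have e: "shf (Suc p') (Suc q') = (\<lambda>k l x. shf p' (Suc q') (Suc k) (Suc l) (uv l x) +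
      sg (Suc p') (shf (Suc p') q' (Suc k) (Suc l) (uh k x)))" by (intro ext) simp
    have "natural p q (p + q) (p + q) (\<lambda>k l x. shf p' q (Suc k) (Suc l) (uv l x))"
      using natural_shift_v[OF Suc.hyps(1)[of p' q]] Suc.hyps(2) 3 by simp
    moreover have "natural p q (p + q) (p + q) (\<lambda>k l x. sg p (shf p q' (Suc k) (Suc l) (uh k x)))"
      using natural_sg[OF natural_shift_h[OF Suc.hyps(1)[of p q']]] Suc.hyps(2) 3 by (simp del: sg_Suc)
    ultimately show ?thesis using natural_add 3 by (simp only: e)
  qed
qed

lemmas shf_simps = natural_simps[OF natural_shf]

section \<open>The shuffle map commutes with the boundaries on every decalage\<close>

lemma hb_uv: "x \<in> E (p + k) n \<Longrightarrow> l \<le> n \<Longrightarrow> hb p k (uv l x) = uv l (hb p k x)"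
proof (cases p)
  case (Suc p')
  assume x: "x \<in> E (p + k) n" "l \<le> n"
  have "sg i (dh (i + k) (uv l x)) = uv l (sg i (dh (i + k) x))" if "i \<le> p" for i
    using dh_uv[of x "p' + k" n "i + k" l] x that Suc by simp
  thus ?thesis using Suc by (simp add: shifted_alt_def alt_sum_def additive.sum[OF additive_uv] del: sum.atMost_Suc)
qed simp

lemma vb_uh: "x \<in> E m (q + l) \<Longrightarrow> k \<le> m \<Longrightarrow> vb q l (uh k x) = uh k (vb q l x)"
  by (rule bisimplicial.hb_uv[OF swap])

lemma vb_dh: "x \<in> E (Suc m) (q + l) \<Longrightarrow> k \<le> Suc m \<Longrightarrow> dh k (vb q l x) = vb q l (dh k x)"
proof (cases q)
  case (Suc q')
  assume x: "x \<in> E (Suc m) (q + l)" "k \<le> Suc m"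
  have "dh k (sg i (dv (i + l) x)) = sg i (dv (i + l) (dh k x))" if "i \<le> q" for i
    using dh_dv[of x m "q' + l" k "i + l"] x that Suc by simp
  thus ?thesis using Suc by (simp add: shifted_alt_def alt_sum_def additive.sum[OF additive_dh] del: sum.atMost_Suc)
qed simp

text \<open>Face 0 of the diagonal acts on the beginning of the shuffle. Here the shuffle starts
  with an entry of the first factor, and the vertical face cancels the degeneracy
  \<open>uv l\<close>, so that only a horizontal face of \<open>x\<close> is left.\<close>

lemma d_shf_uv:
  assumes x: "x \<in> E (Suc p + k) (q + l)"
  shows "dh k (dv l (shf p q (Suc k) (Suc l) (uv l x))) = shf p q k l (dh k x)"
proof -
  have "uv l x \<in> E (p + Suc k) (Suc (q + l))" using uv_in[OF x, of l] by simp
  hence "dv l (shf p q (Suc k) (Suc l) (uv l x)) = shf p q (Suc k) l (dv l (uv l x))"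
    by (rule natural_dv[OF natural_shf]) simp
  also have "dv l (uv l x) = x" using dv_uv[OF x] by simp
  finally show ?thesis using natural_dh[OF natural_shf, of x p k q l k] x by simp
qed

lemma d_shf_uh:
  assumes x: "x \<in> E (p + k) (Suc q + l)"
  shows "dh k (dv l (shf p q (Suc k) (Suc l) (uh k x))) = shf p q k l (dv l x)"
proof -
  have x': "uh k x \<in> E (p + Suc k) (Suc (q + l))" using uh_in[OF x, of k] by simp
  hence "dv l (shf p q (Suc k) (Suc l) (uh k x)) = shf p q (Suc k) l (dv l (uh k x))"
    by (rule natural_dv[OF natural_shf]) simp
  also have "dh k \<dots> = shf p q k l (dh k (dv l (uh k x)))"
    using natural_dh[OF natural_shf, of "dv l (uh k x)" p k q l k] dv_in[OF x', of l] by simp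
  also have "dv l (uh k x) = uh k (dv l x)" using uh_dv[of x "p + k" "q + l" k l] x by simp
  also have "dh k \<dots> = dv l x" using dh_uh[of "dv l x" "p + k" "q + l" k] dv_in[of x "p + k" "q + l" l] x by simp
  finally show ?thesis .
qed

text \<open>Along the recursion of \<open>shf\<close>: face 0 of the diagonal is known from the two
  preceding lemmas, and the other faces form the boundary on decalage \<open>(Suc k, Suc l)\<close>,
  where the induction hypothesis applies.\<close>

lemma db_shf:
  assumes "x \<in> E (p + k) (q + l)"
  shows "db (p + q) k l (shf p q k l x) =
    (if p = 0 then 0 else shf (p - 1) q k l (hb p k x)) +
    (if q = 0 then 0 else sg p (shf p (q - 1) k l (vb q l x)))"
  using assms
proof (induction p q k l x rule: shf.induct)
  case (1 k l x)
  thus ?case by simp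
next
  case (2 p k l x)
  have y: "uv l x \<in> E (p + Suc k) (0 + Suc l)" using uv_in[OF 2(2), of l] by simp
  have h: "hb p (Suc k) (uv l x) = uv l (hb p (Suc k) x)"
    using hb_uv[of x p "Suc k" l l] 2(2) by simp
  show ?case
  proof (cases p)
    case 0
    thus ?thesis using d_shf_uv[of x p k 0 l] 2(2) dv_uv_Suc[of x _ l l] by (simp add: db_1 shifted_alt_1)
  next
    case (Suc p')
    thus ?thesis using d_shf_uv[of x p k 0 l] 2(2) 2(1)[OF y] h
      by (simp add: db_Suc shifted_alt_Suc shf_simps)
  qed
next
  case (3 q k l x)
  have y: "uh k x \<in> E (0 + Suc k) (q + Suc l)" using uh_in[OF 3(2), of k] by simp
  have h: "vb q (Suc l) (uh k x) = uh k (vb q (Suc l) x)"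
    using vb_uh[of x k q "Suc l" k] 3(2) by simp
  show ?case
  proof (cases q)
    case 0
    thus ?thesis using d_shf_uh[of x 0 k q l] 3(2) dh_uh_Suc[of x k _ k] dv_in[of x k l "Suc l"]
      uh_dv[of x k l k "Suc l"] dh_uh_Suc[of "dv (Suc l) x" k l k] by (simp add: db_1 shifted_alt_1)
  next
    case (Suc q')
    thus ?thesis using d_shf_uh[of x 0 k q l] 3(2) 3(1)[OF y] h
      by (simp add: db_Suc shifted_alt_Suc shf_simps)
  qed
next
  case (4 p q k l x)
  let ?K = "Suc k" and ?L = "Suc l"
  note x = 4(3)
  have y: "uv l x \<in> E (p + ?K) (Suc q + ?L)" using uv_in[OF x, of l] by simp
  have z: "uh k x \<in> E (Suc p + ?K) (q + ?L)" using uh_in[OF x, of k] by simp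
  have hy: "hb p ?K (uv l x) = uv l (hb p ?K x)" using hb_uv[of x p ?K _ l] x by simp
  have vy: "vb (Suc q) ?L (uv l x) = x + uv l (vb (Suc q) l x) - uv l (dv l x)"
    by (rule vb_uv[OF x])
  have vz: "vb q ?L (uh k x) = uh k (vb q ?L x)" using vb_uh[of x _ q ?L k] x by simp
  have hz: "hb (Suc p) ?K (uh k x) = x + uh k (hb (Suc p) k x) - uh k (dh k x)"
    by (rule hb_uh[OF x])
  note a = d_shf_uv[OF x] and b = d_shf_uh[OF x]
  have "db (Suc p + Suc q) k l (shf (Suc p) (Suc q) k l x) =
      shf p (Suc q) k l (dh k x) + sg (Suc p) (shf (Suc p) q k l (dv l x))
      - (db (p + Suc q) ?K ?L (shf p (Suc q) ?K ?L (uv l x)) +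
         sg (Suc p) (db (Suc p + q) ?K ?L (shf (Suc p) q ?K ?L (uh k x))))"
    using a b by (simp add: db_Suc sg_diff)
  also have "\<dots> = shf p (Suc q) k l (hb (Suc p) k x) + sg (Suc p) (shf (Suc p) q k l (vb (Suc q) l x))"
    \<comment> \<open>The summands \<open>x\<close> of \<open>vy\<close> and \<open>hz\<close> both
      give \<open>shf p q (Suc k) (Suc l) x\<close>, with opposite signs: this is the face that
      merges two leading entries of different factors. The case split reflects the separate
      equations of \<open>shf\<close> for index 0.\<close>
    unfolding 4(1)[OF y] 4(2)[OF z] hy vy vz hz
    by (cases p; cases q; cases "even p")
      (simp_all add: shf_simps shifted_alt_1 shifted_alt_Suc sg_def algebra_simps)
  finally show ?case by simp
qed


text \<open>A chain of total degree \<open>m\<close> is a family \<open>z\<close> with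
  \<open>z p\<close> in bidegree \<open>(p, m - p)\<close>, and this is the component of its
  boundary in bidegree \<open>(p, m - 1 - p)\<close> for \<open>p < m\<close>. The components stay
  apart because the spaces \<open>E p q\<close> are not assumed to be independent inside the
  carrier.\<close>

definition tot_bd :: "nat \<Rightarrow> nat \<Rightarrow> nat \<Rightarrow> (nat \<Rightarrow> 'v) \<Rightarrow> nat \<Rightarrow> 'v" where
  "tot_bd m k l z p = hb (Suc p) k (z (Suc p)) + sg p (vb (m - p) l (z p))"

lemma tot_bd_diff: "tot_bd m k l (\<lambda>p. z p - w p) p = tot_bd m k l z p - tot_bd m k l w p"
  and tot_bd_sg: "tot_bd m k l (\<lambda>p. sg i (z p)) p = sg i (tot_bd m k l z p)"
  by (simp_all add: tot_bd_def sg_diff sg_add sg_sg add.commute)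

definition diag_cone :: "(nat \<Rightarrow> nat \<Rightarrow> 'v \<Rightarrow> 'v) \<Rightarrow> nat \<Rightarrow> nat \<Rightarrow> 'v \<Rightarrow> 'v" where
  "diag_cone U k l x = U (Suc k) (Suc l) (uh k (uv l x))"

lemma diag_cone_eq: "diag_cone U = (\<lambda>k l x. cone_h U k (Suc l) (uv l x))"
  by (intro ext) (simp add: diag_cone_def cone_h_def)

lemma natural_diag_cone: "natural a b c d U \<Longrightarrow> natural a b (Suc c) (Suc d) (diag_cone U)"
  unfolding diag_cone_eq by (intro natural_cone_v natural_cone_h)

lemma uhv_in: "x \<in> E (a + k) (b + l) \<Longrightarrow> uh k (uv l x) \<in> E (a + Suc k) (b + Suc l)"
  using uh_in[of "uv l x" "a + k" "b + Suc l" k] uv_in[of x "a + k" "b + l" l] by simp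

lemma dv_diag_cone:
  assumes U: "natural a b c d U" and x: "x \<in> E (a + k) (b + l)"
  shows "dv l (U (Suc k) (Suc l) (uh k (uv l x))) = cone_h U k l x"
    and "dh k (cone_h U k l x) = U k l x"
proof -
  have x': "uh k x \<in> E (a + Suc k) (b + l)" using uh_in[OF x, of k] by simp
  have "uh k (uv l x) = uv l (uh k x)" using uh_uv[OF x, of k l] by simp
  hence "dv l (uh k (uv l x)) = uh k x" using dv_uv[OF x', of l] by simp
  thus "dv l (U (Suc k) (Suc l) (uh k (uv l x))) = cone_h U k l x"
    using natural_dv[OF U, of "uh k (uv l x)" "Suc k" l l] uhv_in[OF x] by (simp add: cone_h_def)
  show "dh k (cone_h U k l x) = U k l x"
    using natural_dh[OF U, of "uh k x" k l k] dh_uh[OF x, of k] x' by (simp add: cone_h_def)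
qed

text \<open>Face 0 of the cone is the value itself, and the remaining faces form the boundary of a
  value of \<open>U\<close> on the next decalage. This is why \<open>cyc\<close> is assumed for all
  shifts.\<close>

lemma db_diag_cone:
  assumes U: "natural a b m m U" and m: "0 < m" and x: "x \<in> E (a + k) (b + l)"
    and cyc: "\<And>k l x. x \<in> E (a + k) (b + l) \<Longrightarrow> db m k l (U k l x) = 0"
  shows "db (Suc m) k l (diag_cone U k l x) = U k l x"
  using dv_diag_cone[OF U x] m cyc[OF uhv_in[OF x]] by (simp add: db_Suc diag_cone_def)

text \<open>The second case contracts the first factor to its vertex 0 before coning off the second one.\<close>

definition tot_cone :: "(nat \<Rightarrow> nat \<Rightarrow> nat \<Rightarrow> 'v \<Rightarrow> 'v) \<Rightarrow> nat \<Rightarrow> nat \<Rightarrow> nat \<Rightarrow> 'v \<Rightarrow> 'v" where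
  "tot_cone U p k l x = (case p of Suc p' \<Rightarrow> cone_h (U p') k l x | 0 \<Rightarrow> dh (Suc k) (diag_cone (U 0) k l x))"

lemma natural_tot_cone:
  assumes U: "\<And>p. p \<le> m \<Longrightarrow> natural a b p (m - p) (U p)" and p: "p \<le> Suc m"
  shows "natural a b p (Suc m - p) (tot_cone U p)"
proof (cases p)
  case 0
  have "tot_cone U 0 = (\<lambda>k l x. dh (1 + k) (diag_cone (U 0) k l x))" by (intro ext) (simp add: tot_cone_def)
  thus ?thesis using natural_comp[OF natural_diag_cone[OF U[of 0]] natural_dh_op[of 1 0]] 0 by simp
next
  case (Suc p')
  have "tot_cone U p = cone_h (U p')" by (intro ext) (simp add: tot_cone_def Suc)
  thus ?thesis using natural_cone_h[OF U[of p']] p Suc by simp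
qed

text \<open>For \<open>p > 0\<close>, what the horizontal boundary of the cone leaves over is
  cancelled by the vertical boundary of component \<open>p - 1\<close>, since \<open>U\<close> is a
  cycle. For \<open>p = 0\<close> the second end \<open>dh (Suc k) (cone_h (U 0) k l x)\<close> of
  the horizontal cone is left over; the vertical boundary of the component 0 of
  \<open>tot_cone\<close> cancels it. In total degree 0 the cycle condition is empty and
  \<open>base\<close> takes its place: the augmentation of the value vanishes.\<close>

lemma tot_bd_tot_cone:
  assumes U: "\<And>p. p \<le> m \<Longrightarrow> natural a b p (m - p) (U p)" and p: "p \<le> m" and x: "x \<in> E (a + k) (b + l)"
    and cyc: "\<And>p k l x. p < m \<Longrightarrow> x \<in> E (a + k) (b + l) \<Longrightarrow> tot_bd m k l (\<lambda>p. U p k l x) p = 0"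
    and base: "\<And>k l x. m = 0 \<Longrightarrow> x \<in> E (a + Suc k) (b + Suc l) \<Longrightarrow>
      dv (Suc l) (dh (Suc k) (U 0 (Suc k) (Suc l) x)) = 0"
  shows "tot_bd (Suc m) k l (\<lambda>p. tot_cone U p k l x) p = U p k l x"
proof (cases p)
  case (Suc p')
  have y: "uh k x \<in> E (a + Suc k) (b + l)" using uh_in[OF x, of k] by simp
  have "hb (Suc p') (Suc k) (U (Suc p') (Suc k) l (uh k x)) = - sg p' (vb (m - p') l (U p' (Suc k) l (uh k x)))"
    using cyc[OF _ y, of p'] p Suc by (simp add: tot_bd_def eq_neg_iff_add_eq_0)
  thus ?thesis
    using dv_diag_cone(2)[OF U[OF p] x] Suc by (simp add: tot_bd_def tot_cone_def cone_h_def shifted_alt_Suc)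
next
  case 0
  let ?w = "U 0 (Suc k) (Suc l) (uh k (uv l x))"
  note y = uhv_in[OF x]
  have w: "?w \<in> E (Suc k) (Suc (m + l))" using natural_in[OF U[of 0] y] by simp
  have 1: "dv l (dh (Suc k) ?w) = dh (Suc k) (cone_h (U 0) k l x)"
    using dv_diag_cone(1)[OF U[of 0] x] dh_dv[OF w, of "Suc k" l] by simp
  have 2: "vb (Suc m) l (dh (Suc k) ?w) = dh (Suc k) (cone_h (U 0) k l x)"
  proof (cases "m = 0")
    case True
    thus ?thesis using base[OF True y] 1 by (simp add: shifted_alt_1)
  next
    case False
    let ?v = "U 1 (Suc k) (Suc l) (uh k (uv l x))"
    have v: "?v \<in> E (Suc (Suc k)) (m - 1 + Suc l)"
      using natural_in[OF U[of 1] y] False by simp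
    have "vb m (Suc l) ?w = dh (Suc (Suc k)) ?v - dh (Suc k) ?v"
      using cyc[OF _ y, of 0] False by (simp add: tot_bd_def shifted_alt_1 algebra_simps eq_neg_iff_add_eq_0)
    \<comment> \<open>Boundaries have augmentation 0: a simplicial identity makes the two faces of
      \<open>?v\<close> equal under \<open>dh (Suc k)\<close>.\<close>
    hence "dh (Suc k) (vb m (Suc l) ?w) = 0"
      using dh_dh[OF v, of "Suc k" "Suc k"] by simp
    moreover have "dh (Suc k) (vb m (Suc l) ?w) = vb m (Suc l) (dh (Suc k) ?w)"
      using vb_dh[of ?w k m "Suc l" "Suc k"] w by simp
    ultimately show ?thesis using 1 False by (simp add: shifted_alt_Suc)
  qed
  show ?thesis using 2 dv_diag_cone(2)[OF U[of 0] x] 0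
    by (simp add: tot_bd_def tot_cone_def shifted_alt_1) (simp add: diag_cone_def cone_h_def)
qed

text \<open>Acyclic models: each component is the cone over what has to become its boundary. The same
  recursion produces the homotopies below.\<close>

primrec psi :: "nat \<Rightarrow> nat \<Rightarrow> nat \<Rightarrow> nat \<Rightarrow> 'v \<Rightarrow> 'v" where
  "psi 0 = (\<lambda>p k l x. if p = 0 then x else 0)"
| "psi (Suc n) = tot_cone (\<lambda>p k l x. psi n p k l (db (Suc n) k l x))"

lemma natural_psi: "p \<le> n \<Longrightarrow> natural n n p (n - p) (psi n p)"
proof (induction n arbitrary: p)
  case 0
  thus ?case using natural_id by simp
next
  case (Suc n)
  show ?case unfolding psi.simps
    by (rule natural_tot_cone[OF _ Suc.prems], rule natural_comp[OF _ Suc.IH]) (use natural_db[of "Suc n"] in auto)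
qed

text \<open>An instance of \<open>tot_bd_tot_cone\<close> for the composite of \<open>psi n\<close>
  with the diagonal boundary, which is a cycle by the induction hypothesis and
  \<open>db_db\<close>.\<close>

lemma tot_bd_psi:
  assumes "p \<le> n" "x \<in> E (Suc n + k) (Suc n + l)"
  shows "tot_bd (Suc n) k l (\<lambda>p. psi (Suc n) p k l x) p = psi n p k l (db (Suc n) k l x)"
  using assms
proof (induction n arbitrary: p k l x)
  case 0
  show ?case unfolding psi.simps(2)[of 0]
  proof (rule tot_bd_tot_cone[OF _ 0])
    \<comment> \<open>The assumption \<open>base\<close>: the two ends of an edge of the diagonal
      have the same augmentation.\<close>
    fix k l x assume "x \<in> E (Suc 0 + Suc k) (Suc 0 + Suc l)"
    hence x: "x \<in> E (Suc (Suc k)) (Suc (Suc l))" by simp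
    hence 1: "dv (Suc l) (dh (Suc k) x) = dh (Suc k) (dv (Suc l) x)"
      "dv (Suc l) (dh (Suc (Suc k)) x) = dh (Suc (Suc k)) (dv (Suc l) x)"
      using dh_dv[OF x, of "Suc k" "Suc l"] dh_dv[OF x, of "Suc (Suc k)" "Suc l"] by simp_all
    have 2: "dh (Suc k) (dh (Suc k) y) = dh (Suc k) (dh (Suc (Suc k)) y)" if "y \<in> E (Suc (Suc k)) n" for y n
      using dh_dh[OF that, of "Suc k" "Suc k"] by simp
    have 3: "dv (Suc l) (dv (Suc l) y) = dv (Suc l) (dv (Suc (Suc l)) y)" if "y \<in> E n (Suc (Suc l))" for y n
      using dv_dv[OF that, of "Suc l" "Suc l"] by simp
    have y: "dv j x \<in> E (Suc (Suc k)) (Suc l)" "dh j (dv j' x) \<in> E (Suc k) (Suc l)"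
      if "j \<le> Suc (Suc l)" "j \<le> Suc (Suc k)" "j' \<le> Suc (Suc l)" for j j'
      using dv_in[OF x] dh_in[OF dv_in[OF x]] that by simp_all
    have c: "dv (Suc l) (dh (Suc k) (dh i (dv j x))) = dh (Suc k) (dh i (dv (Suc l) (dv j x)))"
      if "i \<le> Suc (Suc k)" "j \<le> Suc (Suc l)" for i j
      using dh_dv[OF dh_in[OF dv_in[OF x that(2)] that(1)], of "Suc k" "Suc l"]
        dh_dv[OF dv_in[OF x that(2)] that(1), of "Suc l"] by simp
    show "dv (Suc l) (dh (Suc k) (psi 0 0 (Suc k) (Suc l) (db (Suc 0) (Suc k) (Suc l) x))) = 0"
      using 2[of "dv (Suc l) (dv (Suc (Suc l)) x)" l] dv_in[OF dv_in[OF x], of "Suc (Suc l)" "Suc l"] 3[OF x]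
      by (simp add: db_1 c)
  next
    show "natural (Suc 0) (Suc 0) p (0 - p) (\<lambda>k l x. psi 0 p k l (db (Suc 0) k l x))" if "p \<le> 0" for p
      using natural_db[of "Suc 0"] that by simp
  qed simp_all
next
  case (Suc n)
  show ?case unfolding psi.simps(2)[of "Suc n"]
  proof (rule tot_bd_tot_cone[OF _ Suc.prems])
    show "natural (Suc (Suc n)) (Suc (Suc n)) p (Suc n - p) (\<lambda>k l x. psi (Suc n) p k l (db (Suc (Suc n)) k l x))"
      if "p \<le> Suc n" for p
      using natural_comp[OF _ natural_psi[OF that]] natural_db[of "Suc (Suc n)"] by simp
  next
    fix p k l x assume p: "p < Suc n" and x: "x \<in> E (Suc (Suc n) + k) (Suc (Suc n) + l)"
    have "db (Suc (Suc n)) k l x \<in> E (Suc n + k) (Suc n + l)"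
      using natural_in[OF natural_db x] by simp
    from Suc.IH[OF _ this, of p] p db_db[OF x]
    show "tot_bd (Suc n) k l (\<lambda>p. psi (Suc n) p k l (db (Suc (Suc n)) k l x)) p = 0"
      using natural_simps(1)[OF natural_psi, of p n] by simp
  qed simp
qed

section \<open>The homotopies on the diagonal and on the total complex\<close>

lemma db_sum_shf:
  assumes z: "\<And>p. p \<le> Suc n \<Longrightarrow> z p \<in> E (p + k) (Suc n - p + l)"
  shows "db (Suc n) k l (\<Sum>p\<le>Suc n. shf p (Suc n - p) k l (z p)) = (\<Sum>p\<le>n. shf p (n - p) k l (tot_bd (Suc n) k l z p))"
proof -
  have "db (Suc n) k l (\<Sum>p\<le>Suc n. shf p (Suc n - p) k l (z p)) =
      (\<Sum>p\<le>Suc n. db (Suc n) k l (shf p (Suc n - p) k l (z p)))"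
    by (rule additive.sum[OF additive_db])
  also have "\<dots> = (\<Sum>p\<le>Suc n. (if p = 0 then 0 else shf (p - 1) (Suc n - p) k l (hb p k (z p))) +
      (if p = Suc n then 0 else sg p (shf p (n - p) k l (vb (Suc n - p) l (z p)))))"
  proof (rule sum.cong[OF refl])
    fix p assume p: "p \<in> {..Suc n}"
    thus "db (Suc n) k l (shf p (Suc n - p) k l (z p)) =
       (if p = 0 then 0 else shf (p - 1) (Suc n - p) k l (hb p k (z p))) +
      (if p = Suc n then 0 else sg p (shf p (n - p) k l (vb (Suc n - p) l (z p))))"
      using db_shf[OF z, of p] by (auto simp: Suc_diff_le)
  qed
  also have "\<dots> = (\<Sum>p\<le>Suc n. (if p = 0 then 0 else shf (p - 1) (Suc n - p) k l (hb p k (z p)))) +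
      (\<Sum>p\<le>Suc n. (if p = Suc n then 0 else sg p (shf p (n - p) k l (vb (Suc n - p) l (z p)))))"
    by (rule sum.distrib)
  also have "(\<Sum>p\<le>Suc n. (if p = 0 then 0 else shf (p - 1) (Suc n - p) k l (hb p k (z p)))) =
      (\<Sum>p\<le>n. shf p (n - p) k l (hb (Suc p) k (z (Suc p))))"
    by (subst sum.atMost_Suc_shift) simp
  also have "(\<Sum>p\<le>Suc n. (if p = Suc n then 0 else sg p (shf p (n - p) k l (vb (Suc n - p) l (z p))))) =
      (\<Sum>p\<le>n. sg p (shf p (n - p) k l (vb (Suc n - p) l (z p))))"
    by (auto intro!: sum.cong)
  finally show ?thesis by (simp add: tot_bd_def shf_simps sum.distrib)
qed

primrec htpy_diag :: "nat \<Rightarrow> nat \<Rightarrow> nat \<Rightarrow> 'v \<Rightarrow> 'v" where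
  "htpy_diag 0 = (\<lambda>k l x. 0)"
| "htpy_diag (Suc n) = diag_cone (\<lambda>k l x. (\<Sum>p\<le>Suc n. shf p (Suc n - p) k l (psi (Suc n) p k l x)) - x
     - htpy_diag n k l (db (Suc n) k l x))"

lemma natural_shf_psi: "natural n n n n (\<lambda>k l x. \<Sum>p\<le>n. shf p (n - p) k l (psi n p k l x))"
proof (rule natural_sum)
  fix p assume "p \<in> {..n}"
  thus "natural n n n n (\<lambda>k l x. shf p (n - p) k l (psi n p k l x))"
    using natural_comp[OF natural_psi, of p n n n "shf p (n - p)"] natural_shf[of p "n - p"] by simp
qed

lemma natural_htpy_diag: "natural n n (Suc n) (Suc n) (htpy_diag n)"
proof (induction n)
  case 0
  show ?case using natural_zero by simp
next
  case (Suc n)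
  show ?case unfolding htpy_diag.simps
    by (intro natural_diag_cone natural_diff natural_shf_psi natural_id natural_comp[OF _ Suc.IH])
      (use natural_db[of "Suc n"] in simp)
qed

text \<open>The right-hand side is a cycle, because \<open>psi\<close> and the shuffle map are chain
  maps and the boundary of the preceding homotopy is known by induction; its cone is the next
  homotopy. In degree 0 shuffling after \<open>psi\<close> is already the identity, so the recursion
  starts with 0.\<close>

theorem db_htpy_diag:
  assumes "x \<in> E (n + k) (n + l)"
  shows "db (Suc n) k l (htpy_diag n k l x) = (\<Sum>p\<le>n. shf p (n - p) k l (psi n p k l x)) - x
     - (if n = 0 then 0 else htpy_diag (n - 1) k l (db n k l x))"
  using assms
proof (induction n arbitrary: k l x)
  case 0
  thus ?case by simp
next
  case (Suc n)
  have "db (Suc (Suc n)) k l (htpy_diag (Suc n) k l x) = (\<Sum>p\<le>Suc n. shf p (Suc n - p) k l (psi (Suc n) p k l x)) - x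
     - htpy_diag n k l (db (Suc n) k l x)"
    unfolding htpy_diag.simps(2)
  proof (rule db_diag_cone[OF _ _ Suc.prems])
    show "natural (Suc n) (Suc n) (Suc n) (Suc n) (\<lambda>k l x. (\<Sum>p\<le>Suc n. shf p (Suc n - p) k l (psi (Suc n) p k l x)) - x
     - htpy_diag n k l (db (Suc n) k l x))"
      by (intro natural_diff natural_shf_psi natural_id natural_comp[OF _ natural_htpy_diag])
        (use natural_db[of "Suc n"] in simp)
    fix k l x assume x: "x \<in> E (Suc n + k) (Suc n + l)"
    have dx: "db (Suc n) k l x \<in> E (n + k) (n + l)" using natural_in[OF natural_db x] by simp
    have h: "htpy_diag (n - 1) k l (db n k l (db (Suc n) k l x)) = 0"
      using db_db[OF x] natural_simps(1)[OF natural_htpy_diag] by simp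
    have "db (Suc n) k l (\<Sum>p\<le>Suc n. shf p (Suc n - p) k l (psi (Suc n) p k l x)) =
        (\<Sum>p\<le>n. shf p (n - p) k l (tot_bd (Suc n) k l (\<lambda>p. psi (Suc n) p k l x) p))"
      by (rule db_sum_shf) (rule natural_in[OF natural_psi x])
    also have "\<dots> = (\<Sum>p\<le>n. shf p (n - p) k l (psi n p k l (db (Suc n) k l x)))"
      using tot_bd_psi[OF _ x] by (intro sum.cong) auto
    finally show "db (Suc n) k l ((\<Sum>p\<le>Suc n. shf p (Suc n - p) k l (psi (Suc n) p k l x)) - x
     - htpy_diag n k l (db (Suc n) k l x)) = 0"
      using Suc.IH[OF dx] h by (simp del: sum.atMost_Suc)
  qed simp
  thus ?case by simp
qed

text \<open>\<open>htpy_tot n a p\<close> leads from bidegree \<open>(a, n - a)\<close> to bidegree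
  \<open>(p, Suc n - p)\<close>: a homotopy on the total complex is a matrix of such maps. The last
  two terms apply the preceding homotopy to the horizontal and to the vertical boundary of
  \<open>x\<close>.\<close>

primrec htpy_tot :: "nat \<Rightarrow> nat \<Rightarrow> nat \<Rightarrow> nat \<Rightarrow> nat \<Rightarrow> 'v \<Rightarrow> 'v" where
  "htpy_tot 0 = (\<lambda>a p k l x. 0)"
| "htpy_tot (Suc n) = (\<lambda>a. tot_cone (\<lambda>p k l x. psi (Suc n) p k l (shf a (Suc n - a) k l x) - (if p = a then x else 0)
     - (if a = 0 then 0 else htpy_tot n (a - 1) p k l (hb a k x))
     - (if a = Suc n then 0 else sg a (htpy_tot n a p k l (vb (Suc n - a) l x)))))"

lemma natural_htpy_tot_aux:
  assumes IH: "\<And>a p. a \<le> n \<Longrightarrow> p \<le> Suc n \<Longrightarrow> natural a (n - a) p (Suc n - p) (htpy_tot n a p)"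
    and a: "a \<le> Suc n" and p: "p \<le> Suc n"
  shows "natural a (Suc n - a) p (Suc n - p) (\<lambda>k l x. psi (Suc n) p k l (shf a (Suc n - a) k l x) - (if p = a then x else 0)
     - (if a = 0 then 0 else htpy_tot n (a - 1) p k l (hb a k x))
     - (if a = Suc n then 0 else sg a (htpy_tot n a p k l (vb (Suc n - a) l x))))"
proof (intro natural_diff)
  show "natural a (Suc n - a) p (Suc n - p) (\<lambda>k l x. psi (Suc n) p k l (shf a (Suc n - a) k l x))"
    by (rule natural_comp[OF _ natural_psi[OF p]]) (use natural_shf[of a "Suc n - a"] a in simp)
  show "natural a (Suc n - a) p (Suc n - p) (\<lambda>k l x. if p = a then x else 0)"
    using natural_id natural_zero by (cases "p = a") auto
  show "natural a (Suc n - a) p (Suc n - p) (\<lambda>k l x. if a = 0 then 0 else htpy_tot n (a - 1) p k l (hb a k x))"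
  proof (cases a)
    case (Suc a')
    have "natural a (Suc n - a) a' (n - a') (\<lambda>k l. hb a k)"
      using natural_hb[of a "n - a'"] Suc by simp
    from natural_comp[OF this IH[of a' p]] show ?thesis using Suc a p by simp
  qed (simp add: natural_zero)
  show "natural a (Suc n - a) p (Suc n - p) (\<lambda>k l x. if a = Suc n then 0 else sg a (htpy_tot n a p k l (vb (Suc n - a) l x)))"
  proof (cases "a = Suc n")
    case False
    thus ?thesis using natural_sg[OF natural_comp[OF natural_vb[of a "Suc n - a"]], of p "Suc n - p" "htpy_tot n a p"] IH[of a p] a p
      by (simp add: Suc_diff_le)
  qed (simp add: natural_zero)
qed

lemma natural_htpy_tot: "a \<le> n \<Longrightarrow> p \<le> Suc n \<Longrightarrow> natural a (n - a) p (Suc n - p) (htpy_tot n a p)"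
proof (induction n arbitrary: a p)
  case 0
  show ?case using natural_zero by simp
next
  case (Suc n)
  show ?case unfolding htpy_tot.simps
    by (rule natural_tot_cone[OF _ Suc.prems(2)], rule natural_htpy_tot_aux[OF Suc.IH Suc.prems(1)])
qed

text \<open>The induction used for the diagonal, in components. The facts 1 to 5 compute the total
  boundary of each term of the recursion. Repeated boundaries in one direction vanish, and the mixed
  terms of 4 and 5 carry the signs of \<open>a - 1\<close> and \<open>a\<close>, so that they cancel
  by 6.\<close>

theorem tot_bd_htpy_tot:
  assumes "a \<le> n" "p \<le> n" "x \<in> E (a + k) (n - a + l)"
  shows "tot_bd (Suc n) k l (\<lambda>p. htpy_tot n a p k l x) p = psi n p k l (shf a (n - a) k l x) - (if p = a then x else 0)
     - (if a = 0 then 0 else htpy_tot (n - 1) (a - 1) p k l (hb a k x))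
     - (if a = n then 0 else sg a (htpy_tot (n - 1) a p k l (vb (n - a) l x)))"
  using assms
proof (induction n arbitrary: a p k l x)
  case 0
  thus ?case by (simp add: tot_bd_def)
next
  case (Suc n)
  let ?U = "\<lambda>p k l x. psi (Suc n) p k l (shf a (Suc n - a) k l x) - (if p = a then x else 0)
     - (if a = 0 then 0 else htpy_tot n (a - 1) p k l (hb a k x))
     - (if a = Suc n then 0 else sg a (htpy_tot n a p k l (vb (Suc n - a) l x)))"
  have "tot_bd (Suc (Suc n)) k l (\<lambda>p. tot_cone ?U p k l x) p = ?U p k l x"
  proof (rule tot_bd_tot_cone[OF _ Suc.prems(2,3)])
    show "natural a (Suc n - a) p (Suc n - p) (?U p)" if "p \<le> Suc n" for p
      by (rule natural_htpy_tot_aux[OF natural_htpy_tot Suc.prems(1) that])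
  next
    fix p k l x assume p: "p < Suc n" and x: "x \<in> E (a + k) (Suc n - a + l)"
    let ?q = "Suc n - a"
    have y: "shf a ?q k l x \<in> E (Suc n + k) (Suc n + l)"
      using natural_in[OF natural_shf x] Suc.prems(1) by simp
    have 1: "tot_bd (Suc n) k l (\<lambda>p. psi (Suc n) p k l (shf a ?q k l x)) p = psi n p k l (db (Suc n) k l (shf a ?q k l x))"
      using tot_bd_psi[OF _ y] p by simp
    have 2: "db (Suc n) k l (shf a ?q k l x) = (if a = 0 then 0 else shf (a - 1) ?q k l (hb a k x)) +
        (if a = Suc n then 0 else sg a (shf a (n - a) k l (vb ?q l x)))"
      using db_shf[OF x] Suc.prems(1) by (auto simp: Suc_diff_le)
    have 3: "tot_bd (Suc n) k l (\<lambda>p. if p = a then x else 0) p =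
        (if Suc p = a then hb a k x else 0) + (if p = a then sg a (vb ?q l x) else 0)"
      by (simp add: tot_bd_def)
    have 4: "tot_bd (Suc n) k l (\<lambda>p. if a = 0 then 0 else htpy_tot n (a - 1) p k l (hb a k x)) p =
       (if a = 0 then 0 else psi n p k l (shf (a - 1) ?q k l (hb a k x)) - (if Suc p = a then hb a k x else 0)
        - (if a = Suc n then 0 else sg (a - 1) (htpy_tot (n - 1) (a - 1) p k l (vb ?q l (hb a k x)))))"
    proof (cases a)
      case (Suc a')
      have hx: "hb a k x \<in> E (a' + k) (n - a' + l)" using natural_in[OF natural_hb x] Suc by simp
      have "htpy_tot (n - 1) (a' - 1) p k l (hb a' k (hb a k x)) = 0" if "a' \<noteq> 0"
        using hb_hb[of x a' k] x natural_simps(1)[OF natural_htpy_tot, of "a' - 1" "n - 1" p] Suc p Suc.prems(1) that by simp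
      with Suc.IH[OF _ _ hx, of p] Suc Suc.prems(1) p show ?thesis by auto
    qed (simp add: tot_bd_def)
    have 5: "tot_bd (Suc n) k l (\<lambda>p. if a = Suc n then 0 else sg a (htpy_tot n a p k l (vb ?q l x))) p =
       (if a = Suc n then 0 else sg a (psi n p k l (shf a (n - a) k l (vb ?q l x)) - (if p = a then vb ?q l x else 0)
        - (if a = 0 then 0 else htpy_tot (n - 1) (a - 1) p k l (hb a k (vb ?q l x)))))"
    proof (cases "a = Suc n")
      case False
      hence a: "a \<le> n" using Suc.prems(1) by simp
      have vx: "vb ?q l x \<in> E (a + k) (n - a + l)" using natural_in[OF natural_vb x] a by simp
      have "htpy_tot (n - 1) a p k l (vb (n - a) l (vb ?q l x)) = 0" if "a \<noteq> n"
        using vb_vb[of x _ "n - a" l] x natural_simps(1)[OF natural_htpy_tot, of a "n - 1" p] a p that by (simp add: Suc_diff_le)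
      with Suc.IH[OF a _ vx, of p] a p show ?thesis by (cases "a = n"; cases "a = 0") (simp_all add: tot_bd_sg)
    qed (simp add: tot_bd_def)
    have 6: "hb a k (vb ?q l x) = vb ?q l (hb a k x)" by (rule hb_vb[OF x])
    have P: "psi n p k l (u + v) = psi n p k l u + psi n p k l v" "psi n p k l (sg i u) = sg i (psi n p k l u)"
      "psi n p k l 0 = 0" "psi n p k l (- u) = - psi n p k l u" for u v i
      using natural_simps[OF natural_psi, of p n] p by simp_all
    show "tot_bd (Suc n) k l (\<lambda>p. ?U p k l x) p = 0"
      unfolding tot_bd_diff 1 2 3 4 5 6
      by (cases a) (auto simp: P sg_diff)
  qed simp
  thus ?case by simp
qed

end

section \<open>Linear maps on free vector spaces and their tensor products\<close>

text \<open>Parities are kept as sums and products, so that ring identities apply to the exponents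
  of signs.\<close>

declare add_bit_eq_xor [simp del] mult_bit_eq_and [simp del]

abbreviation lin :: "(('x \<Rightarrow>\<^sub>0 'k::field) \<Rightarrow> ('y \<Rightarrow>\<^sub>0 'k)) \<Rightarrow> bool" where
  "lin \<equiv> Vector_Spaces.linear fscale fscale"

lemma linI:
  assumes "\<And>x y. f (x + y) = f x + f y" "\<And>c x. f (fscale c x) = fscale c (f x)"
  shows "lin f"
  using assms by (simp add: Vector_Spaces.linear_iff fvs.vector_space_axioms)

lemma lin_add: "lin f \<Longrightarrow> f (x + y) = f x + f y"
  and lin_scale: "lin f \<Longrightarrow> f (fscale c x) = fscale c (f x)"
  by (simp_all add: Vector_Spaces.linear_iff)

lemma additive_lin: "lin f \<Longrightarrow> additive f"
  by (simp add: additive_def lin_add)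

lemmas lin_0 = additive.zero[OF additive_lin]
  and lin_minus = additive.minus[OF additive_lin]
  and lin_diff = additive.diff[OF additive_lin]
  and lin_sum = additive.sum[OF additive_lin]

lemmas lin_simps = lin_0 lin_add lin_scale lin_minus lin_diff

lemma lin_compose: "lin f \<Longrightarrow> lin g \<Longrightarrow> lin (\<lambda>x. g (f x))"
  and lin_zero: "lin (\<lambda>x. 0)"
  and lin_id: "lin (\<lambda>x. x)"
  and lin_plus: "lin f \<Longrightarrow> lin g' \<Longrightarrow> lin (\<lambda>x. f x + g' x)"
  and lin_sub: "lin f \<Longrightarrow> lin g' \<Longrightarrow> lin (\<lambda>x. f x - g' x)"
  and lin_fscale: "lin f \<Longrightarrow> lin (\<lambda>x. fscale c (f x))"
  by (rule linI; simp add: lin_simps algebra_simps fvs.scale_right_distrib fvs.scale_right_diff_distrib)+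

lemma lin_sum_fun: "(\<And>i. i \<in> I \<Longrightarrow> lin (f i)) \<Longrightarrow> lin (\<lambda>x. \<Sum>i\<in>I. f i x)"
  by (induction I rule: infinite_finite_induct) (auto intro: lin_zero lin_plus)

lemma fscale_minus_1: "fscale (- 1) x = - x"
  by (rule poly_mapping_eqI) simp

lemma sg_fscale: "sg n x = fscale ((- 1) ^ n) x"
  by (simp add: sg_def fscale_minus_1)

lemma lin_ext_superset:
  assumes "finite S" "Poly_Mapping.keys x \<subseteq> S"
  shows "lin_ext h x = (\<Sum>t\<in>S. fscale (Poly_Mapping.lookup x t) (h t))"
  unfolding lin_ext_def using assms by (intro sum.mono_neutral_left) (auto simp: in_keys_iff)

lemma lin_lin_ext_op [simp]:
  fixes h :: "'x \<Rightarrow> ('y \<Rightarrow>\<^sub>0 'k::field)"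
  shows "lin (lin_ext h)"
proof (rule linI)
  fix x y :: "'x \<Rightarrow>\<^sub>0 'k" and c :: 'k
  let ?S = "Poly_Mapping.keys x \<union> Poly_Mapping.keys y"
  have "Poly_Mapping.keys (x + y) \<subseteq> ?S" by (rule keys_add)
  thus "lin_ext h (x + y) = lin_ext h x + lin_ext h y"
    by (simp add: lin_ext_superset[of ?S] lookup_add fvs.scale_left_distrib sum.distrib)
  have "Poly_Mapping.keys (fscale c x) \<subseteq> Poly_Mapping.keys x" by (auto simp: in_keys_iff)
  thus "lin_ext h (fscale c x) = fscale c (lin_ext h x)"
    by (simp add: lin_ext_superset[of "Poly_Mapping.keys x"] fvs.scale_sum_right)
qed

lemmas lin_ext_simps [simp] = lin_simps[OF lin_lin_ext_op]

lemma lin_ext_gen [simp]: "lin_ext h (gen t) = h t"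
  by (simp add: lin_ext_def)

lemma lin_lin_ext: "lin f \<Longrightarrow> f (lin_ext h x) = lin_ext (\<lambda>t. f (h t)) x"
  by (simp add: lin_ext_def lin_sum lin_scale)

lemma lin_ext_add_fun: "lin_ext (\<lambda>t. h t + g t) x = lin_ext h x + lin_ext g x"
  and lin_ext_scale_fun: "lin_ext (\<lambda>t. fscale c (h t)) x = fscale c (lin_ext h x)"
  by (simp_all add: lin_ext_def fvs.scale_right_distrib sum.distrib fvs.scale_sum_right mult.commute)

lemma lin_ext_swap: "lin_ext (\<lambda>s. lin_ext (\<lambda>t. h s t) y) x = lin_ext (\<lambda>t. lin_ext (\<lambda>s. h s t) x) y"
  by (simp add: lin_ext_def fvs.scale_sum_right mult.commute) (rule sum.swap)

lemma lin_subspace_eq: "lin f \<Longrightarrow> lin g \<Longrightarrow> fvs.subspace {x. f x = g x}"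
  by (simp add: fvs.subspace_def lin_simps)

lemma lin_subspace_vimage: "lin f \<Longrightarrow> fvs.subspace V \<Longrightarrow> fvs.subspace {x. f x \<in> V}"
  by (simp add: fvs.subspace_def lin_simps)

lemma lin_eq_on_span:
  assumes "lin f" "lin g" "\<And>x. x \<in> S \<Longrightarrow> f x = g x" "x \<in> fvs.span S"
  shows "f x = g x"
  using fvs.span_minimal[OF _ lin_subspace_eq[OF assms(1,2)], of S] assms(3,4) by blast

lemma lin_span_in:
  assumes "lin f" "fvs.subspace V" "\<And>x. x \<in> S \<Longrightarrow> f x \<in> V" "x \<in> fvs.span S"
  shows "f x \<in> V"
  using fvs.span_minimal[OF _ lin_subspace_vimage[OF assms(1,2)], of S] assms(3,4) by blast

lemma lin_0_on_span: "lin f \<Longrightarrow> (\<And>x. x \<in> S \<Longrightarrow> f x = 0) \<Longrightarrow> x \<in> fvs.span S \<Longrightarrow> f x = 0"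
  using lin_eq_on_span[OF _ lin_zero] .

lemma lin_ext_cong_span:
  assumes "\<And>t. P t \<Longrightarrow> h t = h' t" "x \<in> fvs.span {gen t | t. P t}"
  shows "lin_ext h x = lin_ext h' x"
  by (rule lin_eq_on_span[OF _ _ _ assms(2)]) (auto simp: assms(1))

lemma lin_image_span: "lin f \<Longrightarrow> f ` fvs.span S = fvs.span (f ` S)"
  using module_hom.span_image[of fscale fscale f S] unfolding module_hom_iff_linear by simp

lemma subspace_lin_image: "lin f \<Longrightarrow> fvs.subspace V \<Longrightarrow> fvs.subspace (f ` V)"
  using module_hom.subspace_image[of fscale fscale f V] unfolding module_hom_iff_linear by simp

lemma quo_diff_in: "fvs.subspace R \<Longrightarrow> quo R x - x \<in> R"
  using quo_eq_iff[of R "quo R x" x] quo_idem by blast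

text \<open>\<open>quo R x\<close> differs from \<open>x\<close> by an element of \<open>R\<close>.
  This is what allows a formula to be evaluated on the chosen representative of a class.\<close>

lemma lin_quo:
  assumes "lin f" "fvs.subspace R" "\<And>r. r \<in> R \<Longrightarrow> f r = 0"
  shows "f (quo R x) = f x"
  using assms(3)[OF quo_diff_in[OF assms(2)], of x] assms(1) by (simp add: lin_diff)

text \<open>The degrees are arguments of \<open>h\<close>, since the maps in question depend on them
  through signs and target degrees. Bilinearity is demanded within each bidegree, just as in
  \<open>tensor_rels\<close>.\<close>

definition bilin :: "('k::field \<Rightarrow> 'v::ab_group_add \<Rightarrow> 'v) \<Rightarrow> ('k \<Rightarrow> 'w::ab_group_add \<Rightarrow> 'w) \<Rightarrow>
    ('i \<Rightarrow> 'v set) \<Rightarrow> ('i \<Rightarrow> 'w set) \<Rightarrow> ('i \<Rightarrow> 'v \<Rightarrow> 'i \<Rightarrow> 'w \<Rightarrow> ('y \<Rightarrow>\<^sub>0 'k)) \<Rightarrow> bool" where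
  "bilin s1 s2 V W h \<longleftrightarrow> (\<forall>i j. \<forall>v\<in>V i. \<forall>w\<in>W j.
     (\<forall>v'\<in>V i. h i (v + v') j w = h i v j w + h i v' j w) \<and>
     (\<forall>w'\<in>W j. h i v j (w + w') = h i v j w + h i v j w') \<and>
     (\<forall>c. h i (s1 c v) j w = fscale c (h i v j w)) \<and>
     (\<forall>c. h i v j (s2 c w) = fscale c (h i v j w)))"

definition tensor_ext :: "('i \<Rightarrow> 'v \<Rightarrow> 'i \<Rightarrow> 'w \<Rightarrow> ('y \<Rightarrow>\<^sub>0 'k::field)) \<Rightarrow> (('i, 'v, 'w) tgen \<Rightarrow>\<^sub>0 'k) \<Rightarrow> ('y \<Rightarrow>\<^sub>0 'k)" where
  "tensor_ext h = lin_ext (\<lambda>((i, v), (j, w)). h i v j w)"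

lemma lin_tensor_ext [simp]: "lin (tensor_ext h)"
  by (simp add: tensor_ext_def)

lemma tensor_ext_gen [simp]: "tensor_ext h (gen ((i, v), (j, w))) = h i v j w"
  by (simp add: tensor_ext_def)

lemmas tensor_ext_simps [simp] = lin_simps[OF lin_tensor_ext]

lemma subspace_tensor_rels [simp]: "fvs.subspace (tensor_rels s1 s2 V W)"
  by (simp add: tensor_rels_def)

lemma tensor_ext_rels:
  assumes "bilin s1 s2 V W h" "x \<in> tensor_rels s1 s2 V W"
  shows "tensor_ext h x = 0"
  using assms(2) unfolding tensor_rels_def
  by (rule lin_0_on_span[OF lin_tensor_ext, rotated]) (use assms(1) in \<open>auto simp: bilin_def\<close>)

lemma tensor_ext_quo:
  assumes "bilin s1 s2 V W h"
  shows "tensor_ext h (quo (tensor_rels s1 s2 V W) x) = tensor_ext h x"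
  by (rule lin_quo) (auto intro: tensor_ext_rels[OF assms])

text \<open>The universal property of the tensor product as a rule for computation.\<close>

lemma tensor_ext_tensor:
  assumes "bilin s1 s2 V W h"
  shows "tensor_ext h (tensor s1 s2 V W i v j w) = h i v j w"
  by (simp add: tensor_def tensor_ext_quo[OF assms])

lemma tensor_add_left: "v \<in> V i \<Longrightarrow> v' \<in> V i \<Longrightarrow> w \<in> W j \<Longrightarrow>
    tensor s1 s2 V W i (v + v') j w = tensor s1 s2 V W i v j w + tensor s1 s2 V W i v' j w"
  and tensor_add_right: "v \<in> V i \<Longrightarrow> w \<in> W j \<Longrightarrow> w' \<in> W j \<Longrightarrow>
    tensor s1 s2 V W i v j (w + w') = tensor s1 s2 V W i v j w + tensor s1 s2 V W i v j w'"
  and tensor_scale_left: "v \<in> V i \<Longrightarrow> w \<in> W j \<Longrightarrow>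
    tensor s1 s2 V W i (s1 c v) j w = fscale c (tensor s1 s2 V W i v j w)"
  and tensor_scale_right: "v \<in> V i \<Longrightarrow> w \<in> W j \<Longrightarrow>
    tensor s1 s2 V W i v j (s2 c w) = fscale c (tensor s1 s2 V W i v j w)"
proof -
  let ?R = "tensor_rels s1 s2 V W"
  have l: "lin (quo ?R)" by (rule quo_linear) simp
  show "tensor s1 s2 V W i (v + v') j w = tensor s1 s2 V W i v j w + tensor s1 s2 V W i v' j w"
    if "v \<in> V i" "v' \<in> V i" "w \<in> W j"
  proof -
    have "gen ((i, v + v'), (j, w)) - gen ((i, v), (j, w)) - gen ((i, v'), (j, w)) \<in> ?R"
      unfolding tensor_rels_def using that by (intro fvs.span_base) blast
    thus ?thesis using quo_eq_iff[of ?R "gen ((i, v + v'), (j, w))" "gen ((i, v), (j, w)) + gen ((i, v'), (j, w))"]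
      by (simp add: tensor_def lin_add[OF l] diff_diff_eq)
  qed
  show "tensor s1 s2 V W i v j (w + w') = tensor s1 s2 V W i v j w + tensor s1 s2 V W i v j w'"
    if "v \<in> V i" "w \<in> W j" "w' \<in> W j"
  proof -
    have "gen ((i, v), (j, w + w')) - gen ((i, v), (j, w)) - gen ((i, v), (j, w')) \<in> ?R"
      unfolding tensor_rels_def using that by (intro fvs.span_base) blast
    thus ?thesis using quo_eq_iff[of ?R "gen ((i, v), (j, w + w'))" "gen ((i, v), (j, w)) + gen ((i, v), (j, w'))"]
      by (simp add: tensor_def lin_add[OF l] diff_diff_eq)
  qed
  show "tensor s1 s2 V W i (s1 c v) j w = fscale c (tensor s1 s2 V W i v j w)" if "v \<in> V i" "w \<in> W j"
  proof -
    have "gen ((i, s1 c v), (j, w)) - fscale c (gen ((i, v), (j, w))) \<in> ?R"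
      unfolding tensor_rels_def using that by (intro fvs.span_base) blast
    thus ?thesis using quo_eq_iff[of ?R "gen ((i, s1 c v), (j, w))" "fscale c (gen ((i, v), (j, w)))"]
      by (simp add: tensor_def lin_scale[OF l])
  qed
  show "tensor s1 s2 V W i v j (s2 c w) = fscale c (tensor s1 s2 V W i v j w)" if "v \<in> V i" "w \<in> W j"
  proof -
    have "gen ((i, v), (j, s2 c w)) - fscale c (gen ((i, v), (j, w))) \<in> ?R"
      unfolding tensor_rels_def using that by (intro fvs.span_base) blast
    thus ?thesis using quo_eq_iff[of ?R "gen ((i, v), (j, s2 c w))" "fscale c (gen ((i, v), (j, w)))"]
      by (simp add: tensor_def lin_scale[OF l])
  qed
qed

lemma quo_lin_tensor: "lin (quo (tensor_rels s1 s2 V W))"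
  by (rule quo_linear) simp

lemma tensor_deg_eq: "tensor_deg s1 s2 V W n =
    fvs.span {tensor s1 s2 V W i v j w | i v j w. v \<in> V i \<and> w \<in> W j \<and> i + j = n}"
proof -
  have "quo (tensor_rels s1 s2 V W) ` {gen ((i, v), (j, w)) | i j v w. v \<in> V i \<and> w \<in> W j \<and> i + j = n} =
      {tensor s1 s2 V W i v j w | i v j w. v \<in> V i \<and> w \<in> W j \<and> i + j = n}"
    unfolding tensor_def by blast
  thus ?thesis unfolding tensor_deg_def lin_image_span[OF quo_lin_tensor] by simp
qed

lemma subspace_tensor_deg [simp]: "fvs.subspace (tensor_deg s1 s2 V W n)"
  by (simp add: tensor_deg_eq)

lemma tensor_in_deg: "v \<in> V i \<Longrightarrow> w \<in> W j \<Longrightarrow> i + j = n \<Longrightarrow> tensor s1 s2 V W i v j w \<in> tensor_deg s1 s2 V W n"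
  unfolding tensor_deg_eq by (rule fvs.span_base) blast

lemma lin_eq_on_tensor_deg:
  assumes "lin f" "lin g" "x \<in> tensor_deg s1 s2 V W n"
    and "\<And>i v j w. v \<in> V i \<Longrightarrow> w \<in> W j \<Longrightarrow> i + j = n \<Longrightarrow>
      f (tensor s1 s2 V W i v j w) = g (tensor s1 s2 V W i v j w)"
  shows "f x = g x"
  using assms(3) unfolding tensor_deg_eq
  by (rule lin_eq_on_span[OF assms(1,2), rotated]) (use assms(4) in auto)

lemma lin_tensor_deg_in:
  assumes "lin f" "fvs.subspace U" "x \<in> tensor_deg s1 s2 V W n"
    and "\<And>i v j w. v \<in> V i \<Longrightarrow> w \<in> W j \<Longrightarrow> i + j = n \<Longrightarrow> f (tensor s1 s2 V W i v j w) \<in> U"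
  shows "f x \<in> U"
  using assms(3) unfolding tensor_deg_eq
  by (rule lin_span_in[OF assms(1,2), rotated]) (use assms(4) in auto)

lemma psign_0 [simp]: "psign 0 = 1"
  and psign_add: "psign (x + y) = psign x * psign y"
  and psign_self [simp]: "psign x * psign x = 1"
  by (cases x; cases y; simp add: psign_def)+

section \<open>Hochschild chains as a simplicial vector space\<close>

lemma lin_alt:
  assumes "\<And>i. lin (d i)"
  shows "lin (alt_sum n d)"
proof (cases "n = 0")
  case True
  thus ?thesis using lin_zero by (simp add: alt_sum_def[abs_def])
next
  case False
  have "lin (\<lambda>x. \<Sum>i\<in>{..n}. fscale ((- 1) ^ i) (d i x))"
    by (intro lin_sum_fun lin_fscale assms)
  thus ?thesis using False by (simp add: alt_sum_def[abs_def] sg_fscale)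
qed

text \<open>The axioms without identities and associativity; they suffice for the boundary to be well defined.\<close>

locale graded_category =
  fixes A :: "('k::field, 'o, 'm::ab_group_add) supercat"
  assumes vector_space_scl: "vector_space (scl A)"
    and subspace_homd: "\<lbrakk>X \<in> Ob A; Y \<in> Ob A\<rbrakk> \<Longrightarrow> module.subspace (scl A) (homd A X Y i)"
    and cmp_homd: "\<lbrakk>X \<in> Ob A; Y \<in> Ob A; Z \<in> Ob A; f \<in> homd A X Y i; g \<in> homd A Y Z j\<rbrakk>
          \<Longrightarrow> cmp A X Y Z f g \<in> homd A X Z (i + j)"
    and cmp_add_left: "\<lbrakk>X \<in> Ob A; Y \<in> Ob A; Z \<in> Ob A; f \<in> homd A X Y i; f' \<in> homd A X Y i; g \<in> homd A Y Z j\<rbrakk>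
          \<Longrightarrow> cmp A X Y Z (f + f') g = cmp A X Y Z f g + cmp A X Y Z f' g"
    and cmp_add_right: "\<lbrakk>X \<in> Ob A; Y \<in> Ob A; Z \<in> Ob A; f \<in> homd A X Y i; g \<in> homd A Y Z j; g' \<in> homd A Y Z j\<rbrakk>
          \<Longrightarrow> cmp A X Y Z f (g + g') = cmp A X Y Z f g + cmp A X Y Z f g'"
    and cmp_scl_left: "\<lbrakk>X \<in> Ob A; Y \<in> Ob A; Z \<in> Ob A; f \<in> homd A X Y i; g \<in> homd A Y Z j\<rbrakk>
          \<Longrightarrow> cmp A X Y Z (scl A c f) g = scl A c (cmp A X Y Z f g)"
    and cmp_scl_right: "\<lbrakk>X \<in> Ob A; Y \<in> Ob A; Z \<in> Ob A; f \<in> homd A X Y i; g \<in> homd A Y Z j\<rbrakk>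
          \<Longrightarrow> cmp A X Y Z f (scl A c g) = scl A c (cmp A X Y Z f g)"
begin

sublocale vs: vector_space "scl A" by (rule vector_space_scl)

lemma homd_add: "\<lbrakk>X \<in> Ob A; Y \<in> Ob A; f \<in> homd A X Y i; g \<in> homd A X Y i\<rbrakk> \<Longrightarrow> f + g \<in> homd A X Y i"
  and homd_scl: "\<lbrakk>X \<in> Ob A; Y \<in> Ob A; f \<in> homd A X Y i\<rbrakk> \<Longrightarrow> scl A c f \<in> homd A X Y i"
  using subspace_homd[of X Y i] by (auto simp: vs.subspace_add vs.subspace_scale)

end

context superadditive_category
begin

lemma homd_mor: "X \<in> Ob A \<Longrightarrow> Y \<in> Ob A \<Longrightarrow> f \<in> homd A X Y i \<Longrightarrow> f \<in> mor A X Y"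
proof -
  assume X: "X \<in> Ob A" "Y \<in> Ob A" and f: "f \<in> homd A X Y i"
  interpret vs: vector_space "scl A" by (rule vector_space_scl)
  have z: "0 \<in> homd A X Y j" for j by (rule vs.subspace_0[OF subspace_homd[OF X]])
  show ?thesis
  proof (cases "i = 0")
    case True thus ?thesis using f z[of 1] unfolding mor_def by (intro CollectI exI[of _ f] exI[of _ 0]) auto
  next
    case False thus ?thesis using f z[of 0] unfolding mor_def by (intro CollectI exI[of _ 0] exI[of _ f]) auto
  qed
qed

sublocale graded_category A
  by (rule graded_category.intro) (auto intro!: vector_space_scl subspace_homd cmp_homd cmp_add_left cmp_add_right cmp_scl_left cmp_scl_right intro: homd_mor)

end

section \<open>Cyclic tuples and multilinear maps on them\<close>

lemma bit_add_self [simp]: "x + x = (0::bit)"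
  by (cases x) auto

lemma src_less: "i < length ts \<Longrightarrow> src ts i = fst (ts ! i)"
  by (simp add: src_def)

lemma src_length [simp]: "src ts (length ts) = src ts 0"
  by (simp add: src_def)

abbreviation same_entry where
  "same_entry xs ys k \<equiv> src xs k = src ys k \<and> deg xs k = deg ys k \<and> arr xs k = arr ys k"

lemma entry_list_eqI:
  assumes "length xs = length ys"
    and "\<And>k. k < length xs \<Longrightarrow> same_entry xs ys k"
  shows "xs = ys"
  using assms by (intro nth_equalityI) (auto simp: src_less deg_def arr_def prod_eq_iff)

abbreviation slot where
  "slot A ts i \<equiv> homd A (src ts i) (src ts (Suc i)) (deg ts i)"

abbreviation slot_tensor where
  "slot_tensor A B s t i \<equiv>
     tensor (scl A) (scl B) (homd A (src s i) (src s (Suc i))) (homd B (src t i) (src t (Suc i)))"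

abbreviation upd :: "('o, 'm) entry list \<Rightarrow> nat \<Rightarrow> 'm \<Rightarrow> ('o, 'm) entry list" where
  "upd ts i a \<equiv> ts[i := (src ts i, deg ts i, a)]"

lemma src_upd [simp]: "i < length ts \<Longrightarrow> src (ts[i := (src ts i, e, a)]) k = src ts k"
  by (cases "ts = []") (auto simp: src_def nth_list_update)

lemma deg_upd [simp]: "i < length ts \<Longrightarrow> deg (upd ts i a) k = deg ts k"
  by (auto simp: deg_def nth_list_update)

lemma arr_upd: "i < length ts \<Longrightarrow> arr (upd ts i a) k = (if k = i then a else arr ts k)"
  by (auto simp: arr_def nth_list_update)

lemma upd_self: "i < length ts \<Longrightarrow> upd ts i (arr ts i) = ts"
  by (rule entry_list_eqI) (auto simp: arr_upd)

lemma cyc_tuple_nonempty: "cyc_tuple A ts \<Longrightarrow> 0 < length ts"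
  by (simp add: cyc_tuple_def)

lemma cyc_tuple_src: "cyc_tuple A ts \<Longrightarrow> src ts i \<in> Ob A"
  unfolding cyc_tuple_def src_def by (metis length_greater_0_conv mod_less_divisor mod_mod_trivial)

lemma cyc_tuple_arr: "cyc_tuple A ts \<Longrightarrow> i < length ts \<Longrightarrow>
    arr ts i \<in> slot A ts i"
  by (simp add: cyc_tuple_def)

lemma cyc_tupleI:
  assumes "0 < length ts" "\<And>i. i < length ts \<Longrightarrow> src ts i \<in> Ob A"
    and "\<And>i. i < length ts \<Longrightarrow> arr ts i \<in> slot A ts i"
  shows "cyc_tuple A ts"
  using assms by (simp add: cyc_tuple_def)

lemma cyc_tuple_upd:
  "cyc_tuple A ts \<Longrightarrow> i < length ts \<Longrightarrow> f \<in> slot A ts i \<Longrightarrow> cyc_tuple A (upd ts i f)"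
  by (rule cyc_tupleI) (auto simp: arr_upd cyc_tuple_src cyc_tuple_arr)

lemma subspace_chain_rels [simp]: "fvs.subspace (chain_rels A)"
  by (simp add: chain_rels_def)

lemma lin_quo_chain_rels: "lin (quo (chain_rels A))"
  by (rule quo_linear) simp

definition cl :: "('k::field, 'o, 'm::ab_group_add) supercat \<Rightarrow> ('o, 'm) entry list \<Rightarrow> (('o, 'm) entry list \<Rightarrow>\<^sub>0 'k)" where
  "cl A ts = quo (chain_rels A) (gen ts)"

lemma cl_upd_add:
  assumes "cyc_tuple A ts" "i < length ts"
    and "f \<in> slot A ts i" "g \<in> slot A ts i"
  shows "cl A (upd ts i (f + g)) = cl A (upd ts i f) + cl A (upd ts i g)"
proof -
  have "gen (upd ts i (f + g)) - gen (upd ts i f) - gen (upd ts i g) \<in> chain_rels A"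
    unfolding chain_rels_def using assms
    by (intro fvs.span_base UnI1 CollectI exI[of _ ts] exI[of _ i] exI[of _ f] exI[of _ g]) auto
  thus ?thesis using quo_eq_iff[of "chain_rels A" "gen (upd ts i (f + g))" "gen (upd ts i f) + gen (upd ts i g)"]
    by (simp add: cl_def lin_add[OF lin_quo_chain_rels] diff_diff_eq)
qed

lemma cl_upd_scl:
  assumes "cyc_tuple A ts" "i < length ts" "f \<in> slot A ts i"
  shows "cl A (upd ts i (scl A c f)) = fscale c (cl A (upd ts i f))"
proof -
  have "gen (upd ts i (scl A c f)) - fscale c (gen (upd ts i f)) \<in> chain_rels A"
    unfolding chain_rels_def using assms
    by (intro fvs.span_base UnI2 CollectI exI[of _ ts] exI[of _ i] exI[of _ c] exI[of _ f]) auto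
  thus ?thesis using quo_eq_iff[of "chain_rels A" "gen (upd ts i (scl A c f))" "fscale c (gen (upd ts i f))"]
    by (simp add: cl_def lin_scale[OF lin_quo_chain_rels])
qed

lemma hoch_chains_eq: "hoch_chains A n = fvs.span {cl A ts | ts. cyc_tuple A ts \<and> length ts = Suc n}"
proof -
  have "quo (chain_rels A) ` {gen ts | ts. cyc_tuple A ts \<and> length ts = n + 1} =
      {cl A ts | ts. cyc_tuple A ts \<and> length ts = Suc n}"
    unfolding cl_def by auto
  thus ?thesis unfolding hoch_chains_def lin_image_span[OF lin_quo_chain_rels] by simp
qed

lemma subspace_hoch_chains [simp]: "fvs.subspace (hoch_chains A n)"
  by (simp add: hoch_chains_eq)

lemma cl_in_hoch_chains: "cyc_tuple A ts \<Longrightarrow> length ts = Suc n \<Longrightarrow> cl A ts \<in> hoch_chains A n"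
  unfolding hoch_chains_eq by (rule fvs.span_base) blast

lemma lin_eq_on_hoch_chains:
  assumes "lin f" "lin g" "x \<in> hoch_chains A n"
    and "\<And>ts. cyc_tuple A ts \<Longrightarrow> length ts = Suc n \<Longrightarrow> f (cl A ts) = g (cl A ts)"
  shows "f x = g x"
  using assms(3) unfolding hoch_chains_eq
  by (rule lin_eq_on_span[OF assms(1,2), rotated]) (use assms(4) in auto)

lemma lin_hoch_chains_in:
  assumes "lin f" "fvs.subspace U" "x \<in> hoch_chains A n"
    and "\<And>ts. cyc_tuple A ts \<Longrightarrow> length ts = Suc n \<Longrightarrow> f (cl A ts) \<in> U"
  shows "f x \<in> U"
  using assms(3) unfolding hoch_chains_eq
  by (rule lin_span_in[OF assms(1,2), rotated]) (use assms(4) in auto)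

text \<open>The counterpart of \<open>bilin\<close> for tuples. \<open>upd\<close> leaves all
  objects and degrees as they are, so only the morphism in one slot varies.\<close>

definition multilin :: "('k::field, 'o, 'm::ab_group_add) supercat \<Rightarrow> (('o, 'm) entry list \<Rightarrow> ('y \<Rightarrow>\<^sub>0 'k)) \<Rightarrow> bool" where
  "multilin A \<phi> \<longleftrightarrow> (\<forall>ts i. cyc_tuple A ts \<longrightarrow> i < length ts \<longrightarrow>
     (\<forall>f\<in>slot A ts i.
        (\<forall>g\<in>slot A ts i. \<phi> (upd ts i (f + g)) = \<phi> (upd ts i f) + \<phi> (upd ts i g)) \<and>
        (\<forall>c. \<phi> (upd ts i (scl A c f)) = fscale c (\<phi> (upd ts i f)))))"

lemma multilinI:
  assumes "\<And>ts i f g. \<lbrakk>cyc_tuple A ts; i < length ts; f \<in> slot A ts i;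
      g \<in> slot A ts i\<rbrakk> \<Longrightarrow> \<phi> (upd ts i (f + g)) = \<phi> (upd ts i f) + \<phi> (upd ts i g)"
    and "\<And>ts i c f. \<lbrakk>cyc_tuple A ts; i < length ts; f \<in> slot A ts i\<rbrakk>
      \<Longrightarrow> \<phi> (upd ts i (scl A c f)) = fscale c (\<phi> (upd ts i f))"
  shows "multilin A \<phi>"
  unfolding multilin_def using assms by blast

lemma multilin_add: "\<lbrakk>multilin A \<phi>; cyc_tuple A ts; i < length ts; f \<in> slot A ts i;
      g \<in> slot A ts i\<rbrakk> \<Longrightarrow> \<phi> (upd ts i (f + g)) = \<phi> (upd ts i f) + \<phi> (upd ts i g)"
  and multilin_scl: "\<lbrakk>multilin A \<phi>; cyc_tuple A ts; i < length ts; f \<in> slot A ts i\<rbrakk>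
      \<Longrightarrow> \<phi> (upd ts i (scl A c f)) = fscale c (\<phi> (upd ts i f))"
  unfolding multilin_def by blast+

lemma multilin_cl: "multilin A (cl A)"
  by (rule multilinI) (simp_all add: cl_upd_add cl_upd_scl)

lemma lin_ext_chain_rels:
  assumes "multilin A \<phi>" "r \<in> chain_rels A"
  shows "lin_ext \<phi> r = 0"
  using assms(2) unfolding chain_rels_def
  by (rule lin_0_on_span[OF lin_lin_ext_op, rotated])
    (auto simp: multilin_add[OF assms(1)] multilin_scl[OF assms(1)])

lemma lin_ext_quo:
  assumes "multilin A \<phi>"
  shows "lin_ext \<phi> (quo (chain_rels A) x) = lin_ext \<phi> x"
  by (rule lin_quo) (auto intro: lin_ext_chain_rels[OF assms])

lemma lin_ext_cl:
  assumes "multilin A \<phi>"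
  shows "lin_ext \<phi> (cl A s) = \<phi> s"
  by (simp add: cl_def lin_ext_quo[OF assms])

section \<open>Faces, rotations and degeneracies of tuples\<close>

definition tdeg :: "('o, 'm) entry list \<Rightarrow> bit" where
  "tdeg ts = sum_list (map (fst \<circ> snd) ts)"

definition rot :: "'a list \<Rightarrow> 'a list" where
  "rot ts = last ts # butlast ts"

text \<open>The new entry gets position \<open>i + 1\<close>, and its object is the target of entry
  \<open>i\<close>; behind the last entry this is \<open>src ts 0\<close>, because
  \<open>src\<close> reads indices cyclically.\<close>

definition degen where
  "degen A i ts = take (Suc i) ts @ (src ts (Suc i), 0, ident A (src ts (Suc i))) # drop (Suc i) ts"

lemma length_face [simp]: "Suc i < length ts \<Longrightarrow> length (face A i ts) = length ts - 1"
  by (simp add: face_def)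

lemma nth_face: "Suc i < length ts \<Longrightarrow> k < length ts - 1 \<Longrightarrow> face A i ts ! k = (if k < i then ts ! k else if k = i then
    (src ts i, deg ts i + deg ts (i + 1), cmp A (src ts i) (src ts (i + 1)) (src ts (i + 2)) (arr ts i) (arr ts (i + 1)))
    else ts ! Suc k)"
  by (auto simp: face_def nth_append nth_Cons' min_def)

text \<open>The bound on \<open>k\<close> admits the position one past the end of the face, where
  both sides wrap around to the source of entry 0. The target of the last entry is read off
  there.\<close>

lemma src_face: "Suc i < length ts \<Longrightarrow> k < length ts \<Longrightarrow>
    src (face A i ts) k = (if k \<le> i then src ts k else src ts (Suc k))"
proof (cases "k = length ts - 1")
  case True
  assume "Suc i < length ts" "k < length ts"
  moreover have "Suc (length ts - 1) = length ts" using \<open>Suc i < length ts\<close> by simp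
  moreover have "src ts 0 = fst (ts ! 0)" using \<open>Suc i < length ts\<close> by (intro src_less) linarith
  ultimately show ?thesis using True src_length[of "face A i ts"] src_length[of ts]
    by (auto simp: src_less nth_face)
qed (simp add: src_less nth_face)

lemma deg_face: "Suc i < length ts \<Longrightarrow> k < length ts - 1 \<Longrightarrow> deg (face A i ts) k =
    (if k < i then deg ts k else if k = i then deg ts i + deg ts (Suc i) else deg ts (Suc k))"
  by (simp add: deg_def nth_face)

lemma arr_face: "Suc i < length ts \<Longrightarrow> k < length ts - 1 \<Longrightarrow> arr (face A i ts) k =
    (if k < i then arr ts k else if k = i then
      cmp A (src ts i) (src ts (Suc i)) (src ts (Suc (Suc i))) (arr ts i) (arr ts (Suc i)) else arr ts (Suc k))"
  by (simp add: arr_def nth_face)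

lemma length_rot [simp]: "0 < length ts \<Longrightarrow> length (rot ts) = length ts"
  by (simp add: rot_def)

lemma length_rot' [simp]: "Suc 0 < length ts \<Longrightarrow> length (rot ts) = length ts"
  by (rule length_rot) linarith

lemma Suc_0_less_length_not_Nil [simp]: "Suc 0 < length ts \<Longrightarrow> ts \<noteq> []"
  by auto

lemma nth_rot: "k < length ts \<Longrightarrow> rot ts ! k = (if k = 0 then ts ! (length ts - 1) else ts ! (k - 1))"
  by (cases "ts = []") (auto simp: rot_def nth_Cons' nth_butlast last_conv_nth)

lemma src_rot: "k \<le> length ts \<Longrightarrow> 0 < length ts \<Longrightarrow> src (rot ts) k = (if k = 0 then src ts (length ts - 1) else src ts (k - 1))"
  using src_length[of "rot ts"]
  by (cases "k = length ts") (simp_all add: src_less nth_rot)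

lemma deg_rot: "k < length ts \<Longrightarrow> deg (rot ts) k = (if k = 0 then deg ts (length ts - 1) else deg ts (k - 1))"
  and arr_rot: "k < length ts \<Longrightarrow> arr (rot ts) k = (if k = 0 then arr ts (length ts - 1) else arr ts (k - 1))"
  by (auto simp: deg_def arr_def nth_rot)

lemma length_degen [simp]: "i < length ts \<Longrightarrow> length (degen A i ts) = Suc (length ts)"
  by (simp add: degen_def)

lemma nth_degen: "i < length ts \<Longrightarrow> k < Suc (length ts) \<Longrightarrow> degen A i ts ! k =
    (if k \<le> i then ts ! k else if k = Suc i then (src ts (Suc i), 0, ident A (src ts (Suc i))) else ts ! (k - 1))"
proof -
  assume *: "i < length ts" "k < Suc (length ts)"
  have "k = Suc (Suc i) + (k - Suc (Suc i))" if "\<not> k \<le> i" "k \<noteq> Suc i" using that by simp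
  then consider "k \<le> i" | "k = Suc i" | j where "k = Suc (Suc (i + j))" by (metis add_Suc)
  thus ?thesis using * by cases (auto simp: degen_def nth_append min_def)
qed

lemma src_degen: "i < length ts \<Longrightarrow> k \<le> Suc (length ts) \<Longrightarrow> src (degen A i ts) k =
    (if k \<le> Suc i then src ts k else src ts (k - 1))"
proof (cases "k = Suc (length ts)")
  case True
  assume "i < length ts"
  moreover from this have "src ts 0 = fst (ts ! 0)" by (intro src_less) linarith
  ultimately show ?thesis using True src_length[of "degen A i ts"]
    by (auto simp: src_less nth_degen)
next
  case False
  assume "i < length ts" "k \<le> Suc (length ts)"
  thus ?thesis using False by (cases "k = Suc i"; cases "k \<le> i") (auto simp: src_less nth_degen)
qed

lemma deg_degen: "i < length ts \<Longrightarrow> k < Suc (length ts) \<Longrightarrow> deg (degen A i ts) k =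
    (if k \<le> i then deg ts k else if k = Suc i then 0 else deg ts (k - 1))"
  and arr_degen: "i < length ts \<Longrightarrow> k < Suc (length ts) \<Longrightarrow> arr (degen A i ts) k =
    (if k \<le> i then arr ts k else if k = Suc i then ident A (src ts (Suc i)) else arr ts (k - 1))"
  by (auto simp: deg_def arr_def nth_degen)

lemma tdeg_face: "Suc i < length ts \<Longrightarrow> tdeg (face A i ts) = tdeg ts"
proof -
  assume i: "Suc i < length ts"
  have "ts = take i ts @ ts ! i # ts ! Suc i # drop (i + 2) ts"
    using i by (metis Cons_nth_drop_Suc Suc_lessD add_2_eq_Suc' append_take_drop_id)
  hence "tdeg ts = tdeg (take i ts @ ts ! i # ts ! Suc i # drop (i + 2) ts)" by simp
  thus ?thesis by (simp add: tdeg_def face_def deg_def algebra_simps)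
qed

lemma tdeg_rot: "0 < length ts \<Longrightarrow> tdeg (rot ts) = tdeg ts"
proof -
  assume "0 < length ts"
  hence "tdeg ts = tdeg (butlast ts @ [last ts])" by simp
  thus ?thesis by (simp add: tdeg_def rot_def algebra_simps)
qed

lemma tdeg_degen: "i < length ts \<Longrightarrow> tdeg (degen A i ts) = tdeg ts"
proof -
  have "tdeg ts = tdeg (take (Suc i) ts @ drop (Suc i) ts)" by simp
  thus ?thesis unfolding tdeg_def degen_def map_append sum_list_append by simp
qed

lemma tdeg_upd: "i < length ts \<Longrightarrow> tdeg (upd ts i f) = tdeg ts"
  unfolding tdeg_def by (intro arg_cong[of _ _ sum_list] nth_equalityI) (auto simp: nth_list_update deg_def)

lemma sum_deg_butlast: "0 < length ts \<Longrightarrow> (\<Sum>i<length ts - 1. deg ts i) = tdeg ts + deg ts (length ts - 1)"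
proof -
  assume "0 < length ts"
  then obtain n where n: "length ts = Suc n" by (cases "length ts") auto
  have "tdeg ts = (\<Sum>i<Suc n. deg ts i)"
    unfolding tdeg_def sum_list_sum_nth using n by (auto simp: deg_def atLeast0LessThan intro!: sum.cong)
  thus ?thesis using n by (simp add: add.assoc)
qed

text \<open>Modulo 2 the second factor is the sum of the degrees of all entries but the last, so
  this is the parity sign of the last face. It is phrased with \<open>tdeg\<close>, which faces,
  rotations and degeneracies preserve.\<close>

definition lsign :: "('o, 'm) entry list \<Rightarrow> 'k::field" where
  "lsign ts = psign (deg ts (length ts - 1) * (tdeg ts + deg ts (length ts - 1)))"

lemma face_upd:
  assumes "Suc i < length ts" "j < length ts"
  shows "face A i (upd ts j f) = upd (face A i ts) (if j \<le> i then j else j - 1)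
    (if j = i then cmp A (src ts i) (src ts (Suc i)) (src ts (Suc (Suc i))) f (arr ts (Suc i))
     else if j = Suc i then cmp A (src ts i) (src ts (Suc i)) (src ts (Suc (Suc i))) (arr ts i) f else f)"
proof (rule nth_equalityI)
  fix k assume "k < length (face A i (upd ts j f))"
  hence k: "k < length ts - 1" using assms by simp
  have u: "upd ts j f ! l = (if l = j then (src ts j, deg ts j, f) else ts ! l)" for l
    using assms by (simp add: nth_list_update)
  consider "j < i" | "j = i" | "j = Suc i" | "Suc i < j" by linarith
  thus "face A i (upd ts j f) ! k = upd (face A i ts) (if j \<le> i then j else j - 1)
    (if j = i then cmp A (src ts i) (src ts (Suc i)) (src ts (Suc (Suc i))) f (arr ts (Suc i))
     else if j = Suc i then cmp A (src ts i) (src ts (Suc i)) (src ts (Suc (Suc i))) (arr ts i) f else f) ! k"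
  proof cases
    case 1
    thus ?thesis using k assms by (cases "k = j") (simp_all add: nth_face u arr_upd src_face deg_face nth_list_update)
  next
    case 2
    thus ?thesis using k assms by (cases "k = i") (simp_all add: nth_face u arr_upd src_face deg_face nth_list_update)
  next
    case 3
    thus ?thesis using k assms by (cases "k = i") (simp_all add: nth_face u arr_upd src_face deg_face nth_list_update)
  next
    case 4
    thus ?thesis using k assms by (cases "k = j - 1") (auto simp: nth_face u arr_upd src_face deg_face nth_list_update)
  qed
qed (use assms in simp)

lemma rot_upd:
  assumes "j < length ts"
  shows "rot (upd ts j f) = upd (rot ts) (if Suc j = length ts then 0 else Suc j) f"
proof -
  have l: "0 < length ts" using assms by linarith
  show ?thesis
  proof (rule nth_equalityI)
    fix k assume "k < length (rot (upd ts j f))"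
    hence k: "k < length ts" using l by simp
    have u: "upd ts j f ! i = (if i = j then (src ts j, deg ts j, f) else ts ! i)" for i
      using assms by (simp add: nth_list_update)
    show "rot (upd ts j f) ! k = upd (rot ts) (if Suc j = length ts then 0 else Suc j) f ! k"
    proof (cases "j = length ts - 1")
      case True
      thus ?thesis using k l by (cases "k = 0") (auto simp: nth_rot u src_rot deg_rot nth_list_update)
    next
      case False
      hence "Suc j \<noteq> length ts" by auto
      thus ?thesis using k l assms by (cases "k = 0") (auto simp: nth_rot u src_rot deg_rot nth_list_update)
    qed
  qed (use l in simp)
qed

lemma rot_shift:
  assumes "i < length ts" and "j = (if Suc i = length ts then 0 else Suc i)"
  shows "j < length (rot ts)" "src (rot ts) j = src ts i" "src (rot ts) (Suc j) = src ts (Suc i)" "deg (rot ts) j = deg ts i"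
proof -
  have l: "0 < length ts" using assms by linarith
  have "j < length (rot ts) \<and> src (rot ts) j = src ts i \<and> src (rot ts) (Suc j) = src ts (Suc i) \<and> deg (rot ts) j = deg ts i"
  proof (cases "i = length ts - 1")
    case True
    hence e: "Suc i = length ts" using l by simp
    have "src ts (Suc i) = src ts 0" by (simp add: e)
    moreover have "src (rot ts) (Suc 0) = src ts 0" using src_rot[of "Suc 0" ts] l by (simp add: Suc_leI)
    ultimately show ?thesis using True l assms(2) e by (simp add: src_rot deg_rot)
  next
    case False
    hence "Suc i < length ts" using assms by linarith
    thus ?thesis using assms l by (auto simp: src_rot deg_rot)
  qed
  thus "j < length (rot ts)" "src (rot ts) j = src ts i" "src (rot ts) (Suc j) = src ts (Suc i)" "deg (rot ts) j = deg ts i"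
    by simp_all
qed

lemma degen_upd:
  assumes "i < length ts" "j < length ts"
  shows "degen A i (upd ts j f) = upd (degen A i ts) (if j \<le> i then j else Suc j) f"
proof (rule nth_equalityI)
  fix k assume "k < length (degen A i (upd ts j f))"
  hence k: "k < Suc (length ts)" using assms by simp
  have u: "upd ts j f ! i = (if i = j then (src ts j, deg ts j, f) else ts ! i)" for i
    using assms by (simp add: nth_list_update)
  show "degen A i (upd ts j f) ! k = upd (degen A i ts) (if j \<le> i then j else Suc j) f ! k"
    using assms k by (cases "j \<le> i") (auto simp: nth_degen u src_degen deg_degen nth_list_update)
qed (use assms in simp)

lemma cyc_tuple_rot:
  assumes "cyc_tuple A ts"
  shows "cyc_tuple A (rot ts)"
proof (rule cyc_tupleI)
  note l = cyc_tuple_nonempty[OF assms]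
  fix i assume "i < length (rot ts)"
  hence i: "i < length ts" using l by simp
  show "src (rot ts) i \<in> Ob A" using i l by (simp add: src_rot cyc_tuple_src[OF assms])
  show "arr (rot ts) i \<in> slot A (rot ts) i"
    using cyc_tuple_arr[OF assms, of "if i = 0 then length ts - 1 else i - 1"] i l
    by (auto simp: src_rot deg_rot arr_rot split: if_splits)
qed (use cyc_tuple_nonempty[OF assms] in simp)

context graded_category
begin

lemma cyc_tuple_face:
  assumes "cyc_tuple A ts" "Suc i < length ts"
  shows "cyc_tuple A (face A i ts)"
proof (rule cyc_tupleI)
  fix k assume "k < length (face A i ts)"
  hence k: "k < length ts - 1" using assms by simp
  show "src (face A i ts) k \<in> Ob A" using k assms by (simp add: src_face cyc_tuple_src)
  show "arr (face A i ts) k \<in> slot A (face A i ts) k"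
    using k assms(2) cyc_tuple_arr[OF assms(1), of k] cyc_tuple_arr[OF assms(1), of "Suc k"]
    by (auto simp: src_face deg_face arr_face intro!: cmp_homd cyc_tuple_src[OF assms(1)])
qed (use assms(2) in simp)

lemma multilin_face:
  assumes \<phi>: "multilin A \<phi>" and ts: "cyc_tuple A ts" and i: "Suc i < length ts" and j: "j < length ts"
    and f: "f \<in> slot A ts j"
  shows "g \<in> slot A ts j \<Longrightarrow>
      \<phi> (face A i (upd ts j (f + g))) = \<phi> (face A i (upd ts j f)) + \<phi> (face A i (upd ts j g))" (is "_ \<Longrightarrow> ?add")
    and "\<phi> (face A i (upd ts j (scl A c f))) = fscale c (\<phi> (face A i (upd ts j f)))" (is "?scl")
proof -
  note F = cyc_tuple_face[OF ts i]
  note S = cyc_tuple_src[OF ts]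
  note a = cyc_tuple_arr[OF ts]
  let ?c = "cmp A (src ts i) (src ts (Suc i)) (src ts (Suc (Suc i)))"
  consider "j = i" | "j = Suc i" | "j < i" | "Suc i < j" by linarith
  note cs = this
  have *: "?scl \<and> (g \<in> slot A ts j \<longrightarrow> ?add)"
    using cs
  proof cases
    case 1
    have h: "h \<in> slot A ts j \<Longrightarrow>
       ?c h (arr ts (Suc i)) \<in> slot A (face A i ts) i" for h
      using 1 i a[of "Suc i"] by (simp add: src_face deg_face cmp_homd S)
    show ?thesis
      using multilin_add[OF \<phi> F _ h h, of f g] multilin_scl[OF \<phi> F _ h, of f c] f 1 i j a[of "Suc i"]
      by (auto simp: face_upd cmp_add_left[OF S S S] cmp_scl_left[OF S S S])
  next
    case 2
    have h: "h \<in> slot A ts j \<Longrightarrow>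
       ?c (arr ts i) h \<in> slot A (face A i ts) i" for h
      using 2 i a[of "i"] by (simp add: src_face deg_face cmp_homd S)
    show ?thesis
      using multilin_add[OF \<phi> F _ h h, of f g] multilin_scl[OF \<phi> F _ h, of f c] f 2 i j a[of "i"]
      by (auto simp: face_upd cmp_add_right[OF S S S] cmp_scl_right[OF S S S])
  next
    case 3
    show ?thesis
      using multilin_add[OF \<phi> F, of j f g] multilin_scl[OF \<phi> F, of j f c] f 3 i j
      by (auto simp: face_upd src_face deg_face)
  next
    case 4
    show ?thesis
      using multilin_add[OF \<phi> F, of "j - 1" f g] multilin_scl[OF \<phi> F, of "j - 1" f c] f 4 i j
      by (auto simp: face_upd src_face deg_face)
  qed
  show ?scl using * ..
  show ?add if "g \<in> slot A ts j" using * that by blast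
qed

end

text \<open>Taking the last face to be face 0 of the rotated tuple reduces its simplicial identities to
  those of the inner faces.\<close>

definition dface where
  "dface A i ts = (if Suc i < length ts then face A i ts else face A 0 (rot ts))"

definition dsign :: "nat \<Rightarrow> ('o, 'm) entry list \<Rightarrow> 'k::field" where
  "dsign i ts = (if Suc i < length ts then 1 else lsign ts)"

text \<open>A tuple of length 1 has no faces, and indices out of range give 0, so that
  \<open>dop A i\<close> is a linear map on all chains at once.\<close>

definition dtup where
  "dtup A i ts = (if Suc 0 < length ts \<and> i < length ts then fscale (dsign i ts) (cl A (dface A i ts)) else 0)"

definition dop where
  "dop A i = lin_ext (dtup A i)"

definition utup where
  "utup A i ts = (if i < length ts then cl A (degen A i ts) else 0)"

definition uop where
  "uop A i = lin_ext (utup A i)"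

lemma lin_dop [simp]: "lin (dop A i)" and lin_uop [simp]: "lin (uop A i)"
  by (simp_all add: dop_def uop_def)

lemmas dop_simps [simp] = lin_simps[OF lin_dop]
lemmas uop_simps [simp] = lin_simps[OF lin_uop]

lemma length_dface: "Suc 0 < length ts \<Longrightarrow> length (dface A i ts) = length ts - 1"
  by (simp add: dface_def)

lemma last_face_eq: "Suc 0 < length ts \<Longrightarrow> last_face A ts = face A 0 (rot ts)"
  by (rule nth_equalityI)
    (auto simp: last_face_def Let_def nth_face nth_Cons' src_rot deg_rot arr_rot nth_rot nth_tl nth_butlast numeral_2_eq_2)

context graded_category
begin

lemma cyc_tuple_dface: "cyc_tuple A ts \<Longrightarrow> Suc 0 < length ts \<Longrightarrow> cyc_tuple A (dface A i ts)"
  by (simp add: dface_def cyc_tuple_face cyc_tuple_rot)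

lemma multilin_dtup: "multilin A (dtup A i)"
proof -
  have *: "dtup A i (upd ts j (f + g)) = dtup A i (upd ts j f) + dtup A i (upd ts j g) \<and>
      dtup A i (upd ts j (scl A c f)) = fscale c (dtup A i (upd ts j f))"
    if ts: "cyc_tuple A ts" and j: "j < length ts"
      and f: "f \<in> slot A ts j" and g: "g \<in> slot A ts j"
    for ts j f g c
  proof -
    have s: "lsign (upd ts j h) = lsign ts" for h by (simp add: lsign_def tdeg_upd j)
    consider "\<not> (Suc 0 < length ts \<and> i < length ts)" | "Suc i < length ts" | "Suc 0 < length ts" "Suc i = length ts" by linarith
    thus ?thesis
    proof cases
      case 1
      hence "dtup A i (upd ts j h) = 0" for h by (auto simp: dtup_def)
      thus ?thesis by simp
    next
      case 2
      thus ?thesis using multilin_face[OF multilin_cl ts 2 j f] g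
        by (simp add: dtup_def dsign_def dface_def fvs.scale_right_distrib mult.commute)
    next
      case 3
      let ?j = "if Suc j = length ts then 0 else Suc j"
      have l: "0 < length ts" using j by linarith
      have h: "homd A (src (rot ts) ?j) (src (rot ts) (Suc ?j)) (deg (rot ts) ?j) = slot A ts j"
        using rot_shift[OF j refl] by simp
      have j': "?j < length (rot ts)" using rot_shift[OF j refl] by simp
      have "Suc 0 < length (rot ts)" using 3 l by simp
      from multilin_face(1)[OF multilin_cl cyc_tuple_rot[OF ts] this j', of f g] f g h
        multilin_face(2)[OF multilin_cl cyc_tuple_rot[OF ts] this j', of f c]
      show ?thesis using 3
        by (simp add: dtup_def dsign_def dface_def s rot_upd[OF j] fvs.scale_right_distrib mult.commute)
    qed
  qed
  show ?thesis by (rule multilinI) (use * in blast)+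
qed

lemma dop_cl: "dop A i (cl A ts) = dtup A i ts"
  by (simp add: dop_def lin_ext_cl[OF multilin_dtup])

lemma dop_in: "x \<in> hoch_chains A (Suc n) \<Longrightarrow> dop A i x \<in> hoch_chains A n"
  by (rule lin_hoch_chains_in[OF lin_dop, rotated])
    (auto simp: dop_cl dtup_def fvs.subspace_0 intro!: fvs.subspace_scale cl_in_hoch_chains cyc_tuple_dface
      simp: length_dface)

lemma quo_boundary_tuple:
  assumes "length ts = Suc n"
  shows "quo (chain_rels A) (boundary_tuple A ts) = alt_sum n (dop A) (cl A ts)"
proof (cases "n = 0")
  case True thus ?thesis using assms by (simp add: boundary_tuple_def lin_0[OF lin_quo_chain_rels])
next
  case False
  have l: "Suc 0 < length ts" using assms False by simp
  note q = lin_simps[OF lin_quo_chain_rels[of A]] lin_sum[OF lin_quo_chain_rels[of A]]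
  have "quo (chain_rels A) (boundary_tuple A ts) =
      (\<Sum>i<n. fscale ((- 1) ^ i) (cl A (face A i ts))) + fscale ((- 1) ^ n * lsign ts) (cl A (face A 0 (rot ts)))"
    using False l assms sum_deg_butlast[of ts]
    by (simp add: boundary_tuple_def Let_def q cl_def[symmetric] last_face_eq lsign_def)
  also have "\<dots> = (\<Sum>i<n. sg i (dop A i (cl A ts))) + sg n (dop A n (cl A ts))"
    using False assms by (simp add: sg_fscale dop_cl dtup_def dsign_def dface_def)
  also have "\<dots> = alt_sum n (dop A) (cl A ts)"
    using False by (simp add: alt_sum_def lessThan_Suc_atMost[symmetric])
  finally show ?thesis .
qed

lemma multilin_boundary: "multilin A (\<lambda>ts. quo (chain_rels A) (boundary_tuple A ts))"
proof -
  \<comment> \<open>Feeding constant operators to \<open>alt_sum\<close> exhibits the boundary as a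
    signed sum of the maps \<open>dtup\<close>, each of which is multilinear.\<close>
  have q: "quo (chain_rels A) (boundary_tuple A ts) = alt_sum (length ts - 1) (\<lambda>i _. dtup A i ts) 0" if "0 < length ts" for ts
    using quo_boundary_tuple[of ts "length ts - 1"] that by (simp add: alt_sum_def dop_cl)
  show ?thesis
  proof (rule multilinI)
    fix ts i f g assume ts: "cyc_tuple A ts" "i < length ts" "f \<in> slot A ts i"
    have l: "0 < length ts" using ts(2) by linarith
    show "quo (chain_rels A) (boundary_tuple A (upd ts i (f + g))) =
       quo (chain_rels A) (boundary_tuple A (upd ts i f)) + quo (chain_rels A) (boundary_tuple A (upd ts i g))"
      if "g \<in> slot A ts i"
      using multilin_add[OF multilin_dtup ts that] l by (simp add: q alt_sum_def sum.distrib sg_add)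
    show "quo (chain_rels A) (boundary_tuple A (upd ts i (scl A c f))) =
       fscale c (quo (chain_rels A) (boundary_tuple A (upd ts i f)))" for c
      using multilin_scl[OF multilin_dtup ts] l by (simp add: q alt_sum_def fvs.scale_sum_right sg_fscale mult.commute)
  qed
qed

lemma lin_boundary: "lin (boundary A)"
proof -
  have "boundary A = (\<lambda>x. quo (chain_rels A) (lin_ext (boundary_tuple A) x))" by (intro ext) (simp add: boundary_def)
  thus ?thesis using lin_compose[OF lin_lin_ext_op lin_quo_chain_rels] by metis
qed

lemma boundary_cl: "length ts = Suc n \<Longrightarrow> boundary A (cl A ts) = alt_sum n (dop A) (cl A ts)"
  by (simp add: boundary_def lin_lin_ext[OF lin_quo_chain_rels] lin_ext_cl[OF multilin_boundary] quo_boundary_tuple)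

lemma boundary_eq_alt: "x \<in> hoch_chains A n \<Longrightarrow> boundary A x = alt_sum n (dop A) x"
  by (rule lin_eq_on_hoch_chains[OF lin_boundary])
    (auto simp: boundary_cl intro!: lin_alt)

lemma boundary_in: "x \<in> hoch_chains A p \<Longrightarrow> boundary A x \<in> hoch_chains A (p - 1)"
  by (cases p) (auto simp: boundary_eq_alt alt_sum_def fvs.subspace_0 sg_fscale
      intro!: fvs.subspace_sum fvs.subspace_scale dop_in simp del: sum.atMost_Suc)

end


section \<open>Simplicial identities of the Hochschild complex\<close>

lemma rot_face:
  assumes "Suc (Suc i) < length ts"
  shows "rot (face A i ts) = face A (Suc i) (rot ts)"
proof (rule entry_list_eqI)
  have l: "0 < length ts" "Suc 0 < length ts" "0 < length (face A i ts)"
    "Suc (length ts - Suc (Suc 0)) = length ts - Suc 0" using assms by simp_all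
  show "length (rot (face A i ts)) = length (face A (Suc i) (rot ts))" using assms l by simp
  fix k assume "k < length (rot (face A i ts))"
  hence k: "k < length ts - 1" using assms l by simp
  show "same_entry (rot (face A i ts)) (face A (Suc i) (rot ts)) k"
    using k assms l by (cases "k = 0"; cases "k \<le> i"; cases "k = Suc i")
      (auto simp: src_rot src_face deg_rot deg_face arr_rot arr_face)
qed

lemma rot_degen:
  assumes "Suc i < length ts"
  shows "rot (degen A i ts) = degen A (Suc i) (rot ts)"
proof (rule entry_list_eqI)
  have l: "0 < length ts" "Suc 0 < length ts" "0 < length (degen A i ts)" using assms by simp_all
  show "length (rot (degen A i ts)) = length (degen A (Suc i) (rot ts))" using assms l by simp
  fix k assume "k < length (rot (degen A i ts))"
  hence k: "k < Suc (length ts)" using assms l by simp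
  show "same_entry (rot (degen A i ts)) (degen A (Suc i) (rot ts)) k"
    using k assms l by (cases "k = 0"; cases "k \<le> Suc i"; cases "k = Suc (Suc i)")
      (auto simp: src_rot src_degen deg_rot deg_degen arr_rot arr_degen)
qed

lemma face_degen_less:
  assumes "i \<le> j" "Suc j < length ts"
  shows "face A i (degen A (Suc j) ts) = degen A j (face A i ts)"
proof (rule entry_list_eqI)
  show "length (face A i (degen A (Suc j) ts)) = length (degen A j (face A i ts))" using assms by simp
  fix k assume "k < length (face A i (degen A (Suc j) ts))"
  hence k: "k < length ts" using assms by simp
  consider "k < i" | "k = i" | "i < k" "k \<le> j" | "k = Suc j" | "Suc j < k" using assms by linarith
  thus "same_entry (face A i (degen A (Suc j) ts)) (degen A j (face A i ts)) k"
    by cases (use k assms in \<open>auto simp: src_face src_degen deg_face deg_degen arr_face arr_degen\<close>)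
qed

lemma face_degen_greater:
  assumes "j < i" "Suc i < length ts"
  shows "face A (Suc i) (degen A j ts) = degen A j (face A i ts)"
proof (rule entry_list_eqI)
  show "length (face A (Suc i) (degen A j ts)) = length (degen A j (face A i ts))" using assms by simp
  fix k assume "k < length (face A (Suc i) (degen A j ts))"
  hence k: "k < length ts" using assms by simp
  consider "k \<le> j" | "k = Suc j" | "Suc j < k" "k \<le> i" | "k = Suc i" | "Suc i < k" using assms by linarith
  thus "same_entry (face A (Suc i) (degen A j ts)) (degen A j (face A i ts)) k"
    by cases (use k assms in \<open>auto simp: src_face src_degen deg_face deg_degen arr_face arr_degen\<close>)
qed

context superadditive_category
begin

lemma cyc_tuple_mor: "cyc_tuple A ts \<Longrightarrow> i < length ts \<Longrightarrow> arr ts i \<in> mor A (src ts i) (src ts (Suc i))"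
  by (rule homd_mor[OF _ _ cyc_tuple_arr]) (auto simp: cyc_tuple_src)

lemma face_face:
  assumes "cyc_tuple A ts" "i \<le> j" "Suc (Suc j) < length ts"
  shows "face A i (face A (Suc j) ts) = face A j (face A i ts)"
proof (rule entry_list_eqI)
  show "length (face A i (face A (Suc j) ts)) = length (face A j (face A i ts))" using assms by simp
  fix k assume "k < length (face A i (face A (Suc j) ts))"
  hence k: "k < length ts - 2" using assms by simp
  have as: "cmp A (src ts i) (src ts (Suc (Suc i))) (src ts (Suc (Suc (Suc i))))
      (cmp A (src ts i) (src ts (Suc i)) (src ts (Suc (Suc i))) (arr ts i) (arr ts (Suc i))) (arr ts (Suc (Suc i))) =
     cmp A (src ts i) (src ts (Suc i)) (src ts (Suc (Suc (Suc i)))) (arr ts i)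
      (cmp A (src ts (Suc i)) (src ts (Suc (Suc i))) (src ts (Suc (Suc (Suc i)))) (arr ts (Suc i)) (arr ts (Suc (Suc i))))"
    by (rule cmp_assoc) (use assms in \<open>auto simp: cyc_tuple_src cyc_tuple_mor\<close>)
  consider "k < i" | "k = i" "i = j" | "k = i" "i < j" | "i < k" "k < j" | "i < k" "k = j" | "j < k" using assms by linarith
  thus "same_entry (face A i (face A (Suc j) ts)) (face A j (face A i ts)) k"
    by cases (use k assms as in \<open>auto simp: src_face deg_face arr_face add.assoc\<close>)
qed

lemma cyc_tuple_degen:
  assumes "cyc_tuple A ts" "i < length ts"
  shows "cyc_tuple A (degen A i ts)"
proof (rule cyc_tupleI)
  fix k assume "k < length (degen A i ts)"
  hence k: "k < Suc (length ts)" using assms by simp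
  show "src (degen A i ts) k \<in> Ob A" using k assms by (simp add: src_degen cyc_tuple_src)
  show "arr (degen A i ts) k \<in> slot A (degen A i ts) k"
    using k assms(2) cyc_tuple_arr[OF assms(1), of k] cyc_tuple_arr[OF assms(1), of "k - 1"]
    by (cases "k \<le> i"; cases "k = Suc i") (auto simp: src_degen deg_degen arr_degen ident_even cyc_tuple_src[OF assms(1)])
qed (use assms(2) in simp)

lemma face_degen_same:
  assumes "cyc_tuple A ts" "i < length ts"
  shows "face A i (degen A i ts) = ts"
proof (rule entry_list_eqI)
  show "length (face A i (degen A i ts)) = length ts" using assms by simp
  fix k assume "k < length (face A i (degen A i ts))"
  hence k: "k < length ts" using assms by simp
  have c: "cmp A (src ts i) (src ts (Suc i)) (src ts (Suc i)) (arr ts i) (ident A (src ts (Suc i))) = arr ts i"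
    by (rule cmp_ident_right) (use assms in \<open>auto simp: cyc_tuple_src cyc_tuple_mor\<close>)
  show "same_entry (face A i (degen A i ts)) ts k"
    using k assms c by (auto simp: src_face src_degen deg_face deg_degen arr_face arr_degen)
qed

lemma face_degen_Suc:
  assumes "cyc_tuple A ts" "Suc i < length ts"
  shows "face A (Suc i) (degen A i ts) = ts"
proof (rule entry_list_eqI)
  show "length (face A (Suc i) (degen A i ts)) = length ts" using assms by simp
  fix k assume "k < length (face A (Suc i) (degen A i ts))"
  hence k: "k < length ts" using assms by simp
  have c: "cmp A (src ts (Suc i)) (src ts (Suc i)) (src ts (Suc (Suc i))) (ident A (src ts (Suc i))) (arr ts (Suc i)) = arr ts (Suc i)"
    by (rule cmp_ident_left) (use assms in \<open>auto simp: cyc_tuple_src cyc_tuple_mor\<close>)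
  show "same_entry (face A (Suc i) (degen A i ts)) ts k"
    using k assms c by (cases "k = Suc i") (auto simp: src_face src_degen deg_face deg_degen arr_face arr_degen)
qed

lemma face_rot_degen_last:
  assumes "cyc_tuple A ts" "Suc i = length ts"
  shows "face A 0 (rot (degen A i ts)) = ts"
proof (rule entry_list_eqI)
  have l: "Suc 0 < length (degen A i ts)" "0 < length (degen A i ts)" "Suc 0 < length (rot (degen A i ts))" "i < length ts"
    using assms(2)[symmetric] by simp_all
  show "length (face A 0 (rot (degen A i ts))) = length ts" using l by simp
  fix k assume "k < length (face A 0 (rot (degen A i ts)))"
  hence k: "k < length ts" using l by simp
  have s: "src ts (Suc i) = src ts 0" using assms(2) by simp
  have c: "cmp A (src ts 0) (src ts 0) (src ts (Suc 0)) (ident A (src ts 0)) (arr ts 0) = arr ts 0"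
    by (rule cmp_ident_left) (use assms l cyc_tuple_mor[OF assms(1), of 0] in \<open>auto simp: cyc_tuple_src\<close>)
  have le: "length (degen A i ts) = Suc (Suc i)" "length ts = Suc i" using l assms(2) by simp_all
  show "same_entry (face A 0 (rot (degen A i ts))) ts k"
    using k l c s le by (cases "k = 0") (auto simp: src_face deg_face arr_face src_rot deg_rot arr_rot src_degen deg_degen arr_degen)
qed

lemma multilin_utup: "multilin A (utup A i)"
proof (rule multilinI)
  fix ts j f g
  assume ts: "cyc_tuple A ts" "j < length ts" "f \<in> slot A ts j"
  let ?j = "if j \<le> i then j else Suc j"
  have h: "?j < length (degen A i ts)" "homd A (src (degen A i ts) ?j) (src (degen A i ts) (Suc ?j)) (deg (degen A i ts) ?j)
     = slot A ts j" if "i < length ts"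
    using that ts(2) by (auto simp: src_degen deg_degen)
  show "utup A i (upd ts j (f + g)) = utup A i (upd ts j f) + utup A i (upd ts j g)"
    if "g \<in> slot A ts j"
    using multilin_add[OF multilin_cl cyc_tuple_degen[OF ts(1)] h(1), of f g] h(2) ts that
    by (cases "i < length ts"; cases "j \<le> i") (simp_all add: utup_def degen_upd)
  show "utup A i (upd ts j (scl A c f)) = fscale c (utup A i (upd ts j f))" for c
    using multilin_scl[OF multilin_cl cyc_tuple_degen[OF ts(1)] h(1), of f c] h(2) ts
    by (cases "i < length ts"; cases "j \<le> i") (simp_all add: utup_def degen_upd)
qed

lemma uop_cl: "uop A i (cl A ts) = utup A i ts"
  by (simp add: uop_def lin_ext_cl[OF multilin_utup])

lemma uop_in: "x \<in> hoch_chains A n \<Longrightarrow> i \<le> n \<Longrightarrow> uop A i x \<in> hoch_chains A (Suc n)"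
  by (rule lin_hoch_chains_in[OF lin_uop, rotated])
    (auto simp: uop_cl utup_def intro!: cl_in_hoch_chains cyc_tuple_degen)

text \<open>None, one or both of the two faces can be last ones. A last face is face 0 after a
  rotation, and rotating turns an inner face \<open>i\<close> into face \<open>i + 1\<close>. Thus
  each case reduces to \<open>face_face\<close>, that is, to associativity, for the tuple rotated
  zero, one or two times.\<close>

lemma dop_dop:
  assumes "x \<in> hoch_chains A (Suc (Suc n))" "i \<le> j" "j \<le> Suc n"
  shows "dop A i (dop A (Suc j) x) = dop A j (dop A i x)"
proof (rule lin_eq_on_hoch_chains[OF _ _ assms(1)])
  fix ts assume ts: "cyc_tuple A ts" and l: "length ts = Suc (Suc (Suc n))"
  have n: "Suc 0 < length ts" "Suc j < length ts" "i < length ts" using l assms by simp_all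
  have D: "dop A a (dop A b (cl A ts)) = fscale (dsign b ts * dsign a (dface A b ts)) (cl A (dface A a (dface A b ts)))"
    if "a \<le> Suc n" "b < length ts" for a b
    using that l by (simp add: dop_cl dtup_def length_dface)
  have "dface A i (dface A (Suc j) ts) = dface A j (dface A i ts) \<and>
     dsign (Suc j) ts * dsign i (dface A (Suc j) ts) = (dsign i ts * dsign j (dface A i ts) :: 'k)"
  proof -
    consider "j \<le> n" | "j = Suc n" "i \<le> n" | "j = Suc n" "i = Suc n" using assms by linarith
    thus ?thesis
    proof cases
      case 1
      thus ?thesis using assms l face_face[OF ts assms(2)] by (simp add: dface_def dsign_def)
    next
      case 2
      have r: "length (rot ts) = length ts" using n by simp
      have "face A i (face A 0 (rot ts)) = face A 0 (rot (face A i ts))"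
        using face_face[OF cyc_tuple_rot[OF ts], of 0 i] rot_face[of i ts A] 2 l r by simp
      moreover have "lsign (face A i ts) = (lsign ts :: 'k)"
        using 2 l by (simp add: lsign_def tdeg_face deg_face)
      ultimately show ?thesis using 2 l r by (simp add: dface_def dsign_def)
    next
      case 3
      let ?r = "rot ts" let ?rr = "rot (rot ts)"
      have r: "length ?r = length ts" "length ?rr = length ts" using n by simp_all
      have f: "length (face A 0 ?r) = Suc (Suc n)" "length (face A (Suc n) ts) = Suc (Suc n)" using r l by simp_all
      have "rot (face A 0 ?r) = face A (Suc 0) ?rr" using rot_face[of 0 ?r] r l by simp
      \<comment> \<open>Composing the last two entries and moving the result to the front is the
        same as moving both to the front and composing them there.\<close>
      moreover have "rot (face A (Suc n) ts) = face A 0 ?rr"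
      proof (rule entry_list_eqI)
        show "length (rot (face A (Suc n) ts)) = length (face A 0 ?rr)" using f r l by simp
        fix k assume "k < length (rot (face A (Suc n) ts))"
        hence k: "k < Suc (Suc n)" using f by simp
        have s: "src ts (Suc (Suc (Suc n))) = src ts 0" using src_length[of ts] l by simp
        show "same_entry (rot (face A (Suc n) ts)) (face A 0 ?rr) k"
          using k f r l s n by (cases "k = 0"; cases "k = Suc 0")
            (auto simp: src_face deg_face arr_face src_rot deg_rot arr_rot)
      qed
      moreover have "face A 0 (face A (Suc 0) ?rr) = face A 0 (face A 0 ?rr)"
        using face_face[OF cyc_tuple_rot[OF cyc_tuple_rot[OF ts]], of 0 0] r l by simp
      \<comment> \<open>The last two entries go to the front one after the other or as one
        composite. Only their parities and that of the whole tuple enter the signs, which leaves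
        eight cases.\<close>
      moreover have "lsign ts * lsign (face A 0 ?r) = (lsign (face A (Suc n) ts) :: 'k)"
      proof -
        have "deg (face A 0 ?r) (Suc n) = deg ts (Suc n)" using l n r by (simp add: deg_face deg_rot)
        moreover have "deg (face A (Suc n) ts) (Suc n) = deg ts (Suc n) + deg ts (Suc (Suc n))" using l n by (simp add: deg_face)
        ultimately show ?thesis using l f r n
          by (cases "deg ts (Suc n)"; cases "deg ts (Suc (Suc n))"; cases "tdeg ts")
            (simp_all add: lsign_def tdeg_face tdeg_rot psign_def)
      qed
      ultimately show ?thesis using 3 l r f by (simp add: dface_def dsign_def)
    qed
  qed
  thus "dop A i (dop A (Suc j) (cl A ts)) = dop A j (dop A i (cl A ts))"
    using D[of i "Suc j"] D[of j i] assms l by simp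
qed (auto intro: lin_compose)

lemma dop_uop_less:
  assumes "x \<in> hoch_chains A (Suc n)" "i \<le> j" "j \<le> n"
  shows "dop A i (uop A (Suc j) x) = uop A j (dop A i x)"
  using assms
  by (intro lin_eq_on_hoch_chains[OF lin_compose[OF lin_uop lin_dop] lin_compose[OF lin_dop lin_uop] assms(1)])
    (simp add: uop_cl utup_def dop_cl dtup_def dface_def dsign_def length_dface face_degen_less)

lemma dop_uop_same:
  assumes "x \<in> hoch_chains A n" "i \<le> n"
  shows "dop A i (uop A i x) = x"
  using assms
  by (intro lin_eq_on_hoch_chains[OF lin_compose[OF lin_uop lin_dop] lin_id assms(1)])
    (simp add: uop_cl utup_def dop_cl dtup_def dface_def dsign_def face_degen_same)

text \<open>For \<open>i = n\<close> the face is the cyclic one; its sign is 1 because the identity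
  that it moves to the front is even.\<close>

lemma dop_uop_Suc:
  assumes "x \<in> hoch_chains A n" "i \<le> n"
  shows "dop A (Suc i) (uop A i x) = x"
proof (rule lin_eq_on_hoch_chains[OF lin_compose[OF lin_uop lin_dop] lin_id assms(1)])
  fix ts assume ts: "cyc_tuple A ts" and l: "length ts = Suc n"
  show "dop A (Suc i) (uop A i (cl A ts)) = cl A ts"
  proof (cases "i = n")
    case True
    have "lsign (degen A n ts) = (1 :: 'k)" using l by (simp add: lsign_def deg_degen)
    thus ?thesis using True l face_rot_degen_last[OF ts, of n]
      by (simp add: uop_cl utup_def dop_cl dtup_def dface_def dsign_def)
  next
    case False
    thus ?thesis using assms(2) l face_degen_Suc[OF ts, of i]
      by (simp add: uop_cl utup_def dop_cl dtup_def dface_def dsign_def)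
  qed
qed

lemma dop_uop_greater:
  assumes "x \<in> hoch_chains A (Suc n)" "j < i" "i \<le> Suc n"
  shows "dop A (Suc i) (uop A j x) = uop A j (dop A i x)"
proof (rule lin_eq_on_hoch_chains[OF lin_compose[OF lin_uop lin_dop] lin_compose[OF lin_dop lin_uop] assms(1)])
  fix ts assume ts: "cyc_tuple A ts" and l: "length ts = Suc (Suc n)"
  show "dop A (Suc i) (uop A j (cl A ts)) = uop A j (dop A i (cl A ts))"
  proof (cases "i = Suc n")
    case True
    have "lsign (degen A j ts) = (lsign ts :: 'k)"
      using l assms True by (simp add: lsign_def deg_degen tdeg_degen)
    moreover have "face A 0 (rot (degen A j ts)) = degen A j (face A 0 (rot ts))"
      using rot_degen[of j ts A] face_degen_less[of 0 j "rot ts" A] l assms True by simp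
    ultimately show ?thesis using True l assms
      by (simp add: uop_cl utup_def dop_cl dtup_def dface_def dsign_def)
  next
    case False
    thus ?thesis using assms l face_degen_greater[of j i ts A]
      by (simp add: uop_cl utup_def dop_cl dtup_def dface_def dsign_def)
  qed
qed

end

section \<open>The bisimplicial tensor product\<close>

text \<open>The condition \<open>c\<close> cuts off the degrees for which \<open>f\<close> is not
  known to take values in degree \<open>\<phi> i\<close>; there the formula is 0 and trivially
  bilinear.\<close>

lemma bilin_tensor_left:
  assumes "lin f" "\<And>i v. c i \<Longrightarrow> v \<in> V i \<Longrightarrow> f v \<in> V (\<phi> i)"
  shows "bilin fscale fscale V W (\<lambda>i v j w. if c i then tensor fscale fscale V W (\<phi> i) (f v) j w else 0)"
  using assms(2) by (auto simp: bilin_def lin_simps[OF assms(1)] tensor_add_left tensor_add_right tensor_scale_left tensor_scale_right)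

lemma bilin_tensor_right:
  assumes "lin f" "\<And>j w. c j \<Longrightarrow> w \<in> W j \<Longrightarrow> f w \<in> W (\<phi> j)"
  shows "bilin fscale fscale V W (\<lambda>i v j w. if c j then tensor fscale fscale V W i v (\<phi> j) (f w) else 0)"
  using assms(2) by (auto simp: bilin_def lin_simps[OF assms(1)] tensor_add_left tensor_add_right tensor_scale_left tensor_scale_right)

lemma bilin_plus: "bilin s1 s2 V W h \<Longrightarrow> bilin s1 s2 V W h' \<Longrightarrow> bilin s1 s2 V W (\<lambda>i v j w. h i v j w + h' i v j w)"
  by (simp add: bilin_def fvs.scale_right_distrib algebra_simps)

lemma bilin_scale: "bilin s1 s2 V W h \<Longrightarrow> bilin s1 s2 V W (\<lambda>i v j w. fscale (a i j) (h i v j w))"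
  by (simp add: bilin_def fvs.scale_right_distrib mult.commute)

abbreviation ten :: "('k::field, 'o, 'a::ab_group_add) supercat \<Rightarrow> ('k, 'p, 'b::ab_group_add) supercat \<Rightarrow>
    nat \<Rightarrow> (('o, 'a) entry list \<Rightarrow>\<^sub>0 'k) \<Rightarrow> nat \<Rightarrow> (('p, 'b) entry list \<Rightarrow>\<^sub>0 'k) \<Rightarrow> ('k, 'o, 'a, 'p, 'b) tensor_chain" where
  "ten A B \<equiv> tensor fscale fscale (hoch_chains A) (hoch_chains B)"

text \<open>A single summand of the tensor product of complexes; \<open>tensor_chains\<close> sees
  only the total degree.\<close>

definition bichains where
  "bichains A B m n = fvs.span {ten A B m v n w | v w. v \<in> hoch_chains A m \<and> w \<in> hoch_chains B n}"

definition tdh where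
  "tdh A B i = tensor_ext (\<lambda>m v n w. if 0 < m \<and> i \<le> m then ten A B (m - 1) (dop A i v) n w else 0)"

definition tdv where
  "tdv A B i = tensor_ext (\<lambda>m v n w. if 0 < n \<and> i \<le> n then ten A B m v (n - 1) (dop B i w) else 0)"

definition tuh where
  "tuh A B i = tensor_ext (\<lambda>m v n w. if i \<le> m then ten A B (Suc m) (uop A i v) n w else 0)"

definition tuv where
  "tuv A B i = tensor_ext (\<lambda>m v n w. if i \<le> n then ten A B m v (Suc n) (uop B i w) else 0)"

lemma lin_tdh [simp]: "lin (tdh A B i)" and lin_tdv [simp]: "lin (tdv A B i)"
  and lin_tuh [simp]: "lin (tuh A B i)" and lin_tuv [simp]: "lin (tuv A B i)"
  by (simp_all add: tdh_def tdv_def tuh_def tuv_def)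

lemma subspace_bichains [simp]: "fvs.subspace (bichains A B m n)"
  by (simp add: bichains_def)

lemma ten_in_bichains: "v \<in> hoch_chains A m \<Longrightarrow> w \<in> hoch_chains B n \<Longrightarrow> ten A B m v n w \<in> bichains A B m n"
  unfolding bichains_def by (rule fvs.span_base) blast

lemma lin_eq_on_bichains:
  assumes "lin f" "lin g" "x \<in> bichains A B m n"
    and "\<And>v w. v \<in> hoch_chains A m \<Longrightarrow> w \<in> hoch_chains B n \<Longrightarrow> f (ten A B m v n w) = g (ten A B m v n w)"
  shows "f x = g x"
  using assms(3) unfolding bichains_def
  by (rule lin_eq_on_span[OF assms(1,2), rotated]) (use assms(4) in auto)

lemma lin_bichains_in:
  assumes "lin f" "fvs.subspace U" "x \<in> bichains A B m n"
    and "\<And>v w. v \<in> hoch_chains A m \<Longrightarrow> w \<in> hoch_chains B n \<Longrightarrow> f (ten A B m v n w) \<in> U"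
  shows "f x \<in> U"
  using assms(3) unfolding bichains_def
  by (rule lin_span_in[OF assms(1,2), rotated]) (use assms(4) in auto)

lemma bichains_subset: "m + n = k \<Longrightarrow> bichains A B m n \<subseteq> tensor_chains A B k"
  unfolding bichains_def by (rule fvs.span_minimal) (auto intro!: tensor_in_deg)

locale superadditive_pair = A: superadditive_category A + B: superadditive_category B
  for A :: "('k::field, 'o, 'a::ab_group_add) supercat" and B :: "('k, 'p, 'b::ab_group_add) supercat"
begin

lemma tdh_ten: "0 < m \<Longrightarrow> i \<le> m \<Longrightarrow> tdh A B i (ten A B m v n w) = ten A B (m - 1) (dop A i v) n w"
proof -
  have "bilin fscale fscale (hoch_chains A) (hoch_chains B)
      (\<lambda>m v n w. if 0 < m \<and> i \<le> m then ten A B (m - 1) (dop A i v) n w else 0)"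
    by (rule bilin_tensor_left[where \<phi> = "\<lambda>m. m - 1"]) (use A.dop_in in \<open>auto simp: gr0_conv_Suc\<close>)
  thus "0 < m \<Longrightarrow> i \<le> m \<Longrightarrow> tdh A B i (ten A B m v n w) = ten A B (m - 1) (dop A i v) n w"
    by (simp add: tdh_def tensor_ext_tensor)
qed

lemma tdv_ten: "0 < n \<Longrightarrow> i \<le> n \<Longrightarrow> tdv A B i (ten A B m v n w) = ten A B m v (n - 1) (dop B i w)"
proof -
  have "bilin fscale fscale (hoch_chains A) (hoch_chains B)
      (\<lambda>m v n w. if 0 < n \<and> i \<le> n then ten A B m v (n - 1) (dop B i w) else 0)"
    by (rule bilin_tensor_right[where \<phi> = "\<lambda>m. m - 1"]) (use B.dop_in in \<open>auto simp: gr0_conv_Suc\<close>)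
  thus "0 < n \<Longrightarrow> i \<le> n \<Longrightarrow> tdv A B i (ten A B m v n w) = ten A B m v (n - 1) (dop B i w)"
    by (simp add: tdv_def tensor_ext_tensor)
qed

lemma tuh_ten: "i \<le> m \<Longrightarrow> tuh A B i (ten A B m v n w) = ten A B (Suc m) (uop A i v) n w"
proof -
  have "bilin fscale fscale (hoch_chains A) (hoch_chains B)
      (\<lambda>m v n w. if i \<le> m then ten A B (Suc m) (uop A i v) n w else 0)"
    by (rule bilin_tensor_left[where \<phi> = Suc]) (use A.uop_in in auto)
  thus "i \<le> m \<Longrightarrow> tuh A B i (ten A B m v n w) = ten A B (Suc m) (uop A i v) n w"
    by (simp add: tuh_def tensor_ext_tensor)
qed

lemma tuv_ten: "i \<le> n \<Longrightarrow> tuv A B i (ten A B m v n w) = ten A B m v (Suc n) (uop B i w)"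
proof -
  have "bilin fscale fscale (hoch_chains A) (hoch_chains B)
      (\<lambda>m v n w. if i \<le> n then ten A B m v (Suc n) (uop B i w) else 0)"
    by (rule bilin_tensor_right[where \<phi> = Suc]) (use B.uop_in in auto)
  thus "i \<le> n \<Longrightarrow> tuv A B i (ten A B m v n w) = ten A B m v (Suc n) (uop B i w)"
    by (simp add: tuv_def tensor_ext_tensor)
qed

lemmas top_ten = tdh_ten tdv_ten tuh_ten tuv_ten

text \<open>Each identity is an equation of linear maps and may be checked on tensors, where it
  concerns one factor alone or commutes operators on different factors.\<close>

sublocale bisimplicial "bichains A B" "tdh A B" "tdv A B" "tuh A B" "tuv A B"
proof (intro bisimplicial.intro simplicial_rows.intro bisimplicial_axioms.intro)
  fix m n i j :: nat and x y :: "('k, 'o, 'a, 'p, 'b) tensor_chain"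
  show "0 \<in> bichains A B m n" by (rule fvs.subspace_0) simp
  show "x + y \<in> bichains A B m n" if "x \<in> bichains A B m n" "y \<in> bichains A B m n"
    using that by (simp add: fvs.subspace_add)
  show "- x \<in> bichains A B m n" if "x \<in> bichains A B m n"
    using that by (simp add: fvs.subspace_neg)
  show "additive (tdh A B i)" "additive (tdv A B i)" "additive (tuh A B i)" "additive (tuv A B i)"
    by (simp_all add: additive_lin)
  show "tdh A B i x \<in> bichains A B m n" if "x \<in> bichains A B (Suc m) n" "i \<le> Suc m"
    by (rule lin_bichains_in[OF _ _ that(1)]) (use that in \<open>auto simp: top_ten intro!: ten_in_bichains A.dop_in\<close>)
  show "tdv A B i x \<in> bichains A B m n" if "x \<in> bichains A B m (Suc n)" "i \<le> Suc n"
    by (rule lin_bichains_in[OF _ _ that(1)]) (use that in \<open>auto simp: top_ten intro!: ten_in_bichains B.dop_in\<close>)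
  show "tuh A B i x \<in> bichains A B (Suc m) n" if "x \<in> bichains A B m n" "i \<le> m"
    by (rule lin_bichains_in[OF _ _ that(1)]) (use that in \<open>auto simp: top_ten intro!: ten_in_bichains A.uop_in\<close>)
  show "tuv A B i x \<in> bichains A B m (Suc n)" if "x \<in> bichains A B m n" "i \<le> n"
    by (rule lin_bichains_in[OF _ _ that(1)]) (use that in \<open>auto simp: top_ten intro!: ten_in_bichains B.uop_in\<close>)
  show "tdh A B i (tdh A B (Suc j) x) = tdh A B j (tdh A B i x)" if "x \<in> bichains A B (Suc (Suc m)) n" "i \<le> j" "j \<le> Suc m"
    by (rule lin_eq_on_bichains[OF _ _ that(1)]) (use that in \<open>auto simp: top_ten A.dop_dop intro: lin_compose\<close>)
  show "tdv A B i (tdv A B (Suc j) x) = tdv A B j (tdv A B i x)" if "x \<in> bichains A B m (Suc (Suc n))" "i \<le> j" "j \<le> Suc n"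
    by (rule lin_eq_on_bichains[OF _ _ that(1)]) (use that in \<open>auto simp: top_ten B.dop_dop intro: lin_compose\<close>)
  show "tdh A B i (tuh A B (Suc j) x) = tuh A B j (tdh A B i x)" if "x \<in> bichains A B (Suc m) n" "i \<le> j" "j \<le> m"
    by (rule lin_eq_on_bichains[OF _ _ that(1)]) (use that in \<open>auto simp: top_ten A.dop_uop_less intro: lin_compose\<close>)
  show "tdv A B i (tuv A B (Suc j) x) = tuv A B j (tdv A B i x)" if "x \<in> bichains A B m (Suc n)" "i \<le> j" "j \<le> n"
    by (rule lin_eq_on_bichains[OF _ _ that(1)]) (use that in \<open>auto simp: top_ten B.dop_uop_less intro: lin_compose\<close>)
  show "tdh A B i (tuh A B i x) = x" if "x \<in> bichains A B m n" "i \<le> m"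
    by (rule lin_eq_on_bichains[OF _ _ that(1)]) (use that in \<open>auto simp: top_ten A.dop_uop_same intro: lin_compose lin_id\<close>)
  show "tdv A B i (tuv A B i x) = x" if "x \<in> bichains A B m n" "i \<le> n"
    by (rule lin_eq_on_bichains[OF _ _ that(1)]) (use that in \<open>auto simp: top_ten B.dop_uop_same intro: lin_compose lin_id\<close>)
  show "tdh A B (Suc i) (tuh A B i x) = x" if "x \<in> bichains A B m n" "i \<le> m"
    by (rule lin_eq_on_bichains[OF _ _ that(1)]) (use that in \<open>auto simp: top_ten A.dop_uop_Suc intro: lin_compose lin_id\<close>)
  show "tdv A B (Suc i) (tuv A B i x) = x" if "x \<in> bichains A B m n" "i \<le> n"
    by (rule lin_eq_on_bichains[OF _ _ that(1)]) (use that in \<open>auto simp: top_ten B.dop_uop_Suc intro: lin_compose lin_id\<close>)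
  show "tdh A B (Suc i) (tuh A B j x) = tuh A B j (tdh A B i x)" if "x \<in> bichains A B (Suc m) n" "j < i" "i \<le> Suc m"
    by (rule lin_eq_on_bichains[OF _ _ that(1)]) (use that in \<open>auto simp: top_ten A.dop_uop_greater intro: lin_compose\<close>)
  show "tdv A B (Suc i) (tuv A B j x) = tuv A B j (tdv A B i x)" if "x \<in> bichains A B m (Suc n)" "j < i" "i \<le> Suc n"
    by (rule lin_eq_on_bichains[OF _ _ that(1)]) (use that in \<open>auto simp: top_ten B.dop_uop_greater intro: lin_compose\<close>)
  show "tdh A B i (tdv A B j x) = tdv A B j (tdh A B i x)" if "x \<in> bichains A B (Suc m) (Suc n)" "i \<le> Suc m" "j \<le> Suc n"
    by (rule lin_eq_on_bichains[OF _ _ that(1)]) (use that in \<open>auto simp: top_ten intro: lin_compose\<close>)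
  show "tdh A B i (tuv A B j x) = tuv A B j (tdh A B i x)" if "x \<in> bichains A B (Suc m) n" "i \<le> Suc m" "j \<le> n"
    by (rule lin_eq_on_bichains[OF _ _ that(1)]) (use that in \<open>auto simp: top_ten intro: lin_compose\<close>)
  show "tuh A B i (tdv A B j x) = tdv A B j (tuh A B i x)" if "x \<in> bichains A B m (Suc n)" "i \<le> m" "j \<le> Suc n"
    by (rule lin_eq_on_bichains[OF _ _ that(1)]) (use that in \<open>auto simp: top_ten intro: lin_compose\<close>)
  show "tuh A B i (tuv A B j x) = tuv A B j (tuh A B i x)" if "x \<in> bichains A B m n" "i \<le> m" "j \<le> n"
    by (rule lin_eq_on_bichains[OF _ _ that(1)]) (use that in \<open>auto simp: top_ten intro: lin_compose\<close>)
qed (simp_all add: fvs.subspace_0 fvs.subspace_add fvs.subspace_neg)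

lemma bilin_tensor_boundary: "bilin fscale fscale (hoch_chains A) (hoch_chains B)
    (\<lambda>p x q y. ten A B (p - 1) (boundary A x) q y + fscale ((- 1) ^ p) (ten A B p x (q - 1) (boundary B y)))"
  using bilin_plus[OF bilin_tensor_left[where c = "\<lambda>_. True" and \<phi> = "\<lambda>m. m - 1" and V = "hoch_chains A", OF A.lin_boundary A.boundary_in]
    bilin_scale[where a = "\<lambda>i j. (-1) ^ i", OF bilin_tensor_right[where c = "\<lambda>_. True" and \<phi> = "\<lambda>m. m - 1" and W = "hoch_chains B", OF B.lin_boundary B.boundary_in]]]
  by simp

lemma tensor_boundary_eq: "tensor_boundary A B =
    tensor_ext (\<lambda>p x q y. ten A B (p - 1) (boundary A x) q y + fscale ((- 1) ^ p) (ten A B p x (q - 1) (boundary B y)))"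
  unfolding tensor_boundary_def[abs_def] tensor_ext_def lin_lin_ext[OF quo_lin_tensor]
  by (intro ext arg_cong[of _ _ "\<lambda>h. lin_ext h _"]) (auto simp: tensor_def lin_simps[OF quo_lin_tensor])

lemma lin_tensor_boundary [simp]: "lin (tensor_boundary A B)"
  by (simp add: tensor_boundary_eq)

lemma tensor_boundary_ten: "tensor_boundary A B (ten A B p x q y) =
    ten A B (p - 1) (boundary A x) q y + fscale ((- 1) ^ p) (ten A B p x (q - 1) (boundary B y))"
  unfolding tensor_boundary_eq by (rule tensor_ext_tensor[OF bilin_tensor_boundary])

lemma ten_0: "y \<in> hoch_chains B q \<Longrightarrow> ten A B p 0 q y = 0" "x \<in> hoch_chains A p \<Longrightarrow> ten A B p x q 0 = 0"
  using tensor_scale_left[of 0 "hoch_chains A" p y "hoch_chains B" q fscale fscale 0]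
    tensor_scale_right[of x "hoch_chains A" p 0 "hoch_chains B" q fscale fscale 0]
  by (simp_all add: fvs.subspace_0)

lemma ten_sum_left: "finite I \<Longrightarrow> (\<And>i. i \<in> I \<Longrightarrow> f i \<in> hoch_chains A p) \<Longrightarrow> y \<in> hoch_chains B q \<Longrightarrow>
    ten A B p (\<Sum>i\<in>I. fscale (c i) (f i)) q y = (\<Sum>i\<in>I. fscale (c i) (ten A B p (f i) q y))"
  by (induction I rule: finite_induct)
    (auto simp: ten_0 tensor_add_left tensor_scale_left fvs.subspace_sum fvs.subspace_scale)

lemma ten_sum_right: "finite I \<Longrightarrow> (\<And>i. i \<in> I \<Longrightarrow> f i \<in> hoch_chains B q) \<Longrightarrow> x \<in> hoch_chains A p \<Longrightarrow>
    ten A B p x q (\<Sum>i\<in>I. fscale (c i) (f i)) = (\<Sum>i\<in>I. fscale (c i) (ten A B p x q (f i)))"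
  by (induction I rule: finite_induct)
    (auto simp: ten_0 tensor_add_right tensor_scale_right fvs.subspace_sum fvs.subspace_scale)

lemma hb_ten: "x \<in> hoch_chains A p \<Longrightarrow> y \<in> hoch_chains B q \<Longrightarrow> hb p 0 (ten A B p x q y) = ten A B (p - 1) (boundary A x) q y"
proof (cases p)
  case (Suc p')
  assume *: "x \<in> hoch_chains A p" "y \<in> hoch_chains B q"
  have "ten A B p' (\<Sum>i\<le>p. fscale ((- 1) ^ i) (dop A i x)) q y = (\<Sum>i\<le>p. fscale ((- 1) ^ i) (ten A B p' (dop A i x) q y))"
    by (rule ten_sum_left) (use * Suc in \<open>auto intro: A.dop_in\<close>)
  thus ?thesis using * Suc by (simp add: shifted_alt_def A.boundary_eq_alt alt_sum_def tdh_ten sg_fscale del: sum.atMost_Suc)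
qed (auto simp: A.boundary_eq_alt ten_0)

lemma vb_ten: "x \<in> hoch_chains A p \<Longrightarrow> y \<in> hoch_chains B q \<Longrightarrow> vb q 0 (ten A B p x q y) = ten A B p x (q - 1) (boundary B y)"
proof (cases q)
  case (Suc q')
  assume *: "x \<in> hoch_chains A p" "y \<in> hoch_chains B q"
  have "ten A B p x q' (\<Sum>i\<le>q. fscale ((- 1) ^ i) (dop B i y)) = (\<Sum>i\<le>q. fscale ((- 1) ^ i) (ten A B p x q' (dop B i y)))"
    by (rule ten_sum_right) (use * Suc in \<open>auto intro: B.dop_in\<close>)
  thus ?thesis using * Suc by (simp add: shifted_alt_def B.boundary_eq_alt alt_sum_def tdv_ten sg_fscale del: sum.atMost_Suc)
qed (auto simp: B.boundary_eq_alt ten_0)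

lemma lin_hb: "lin (hb n k)" and lin_vb: "lin (vb n k)" and lin_db: "lin (db n k l)"
  by (simp_all add: shifted_alt_def db_def lin_alt lin_compose[OF lin_tdv lin_tdh])

lemma tensor_boundary_bichains: "x \<in> bichains A B p q \<Longrightarrow> tensor_boundary A B x = hb p 0 x + sg p (vb q 0 x)"
  unfolding sg_fscale
proof (erule lin_eq_on_bichains[OF lin_tensor_boundary lin_plus[OF lin_hb lin_fscale[OF lin_vb]]])
  fix v w assume v: "v \<in> hoch_chains A p" and w: "w \<in> hoch_chains B q"
  show "tensor_boundary A B (ten A B p v q w) = hb p 0 (ten A B p v q w) + fscale ((- 1) ^ p) (vb q 0 (ten A B p v q w))"
    unfolding hb_ten[OF v w] vb_ten[OF v w] by (rule tensor_boundary_ten)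
qed

end

section \<open>Diagonal chains and the Hochschild complex of the tensor product\<close>

lemma tensor_cat_sel [simp]:
  "scl (tensor_cat A B) = fscale"
  "Ob (tensor_cat A B) = Ob A \<times> Ob B"
  "homd (tensor_cat A B) P Q = tensor_deg (scl A) (scl B) (homd A (fst P) (fst Q)) (homd B (snd P) (snd Q))"
  by (simp_all add: tensor_cat_def)

abbreviation tm where
  "tm A B P Q \<equiv> tensor (scl A) (scl B) (homd A (fst P) (fst Q)) (homd B (snd P) (snd Q))"

text \<open>Composition in \<open>tensor_cat\<close> with the projection to the quotient moved
  inside the linear extensions. Its values on generators are then classes of tensors, and
  \<open>tensor_ext_tensor\<close> applies to either argument.\<close>

definition tcomp where
  "tcomp A B P Q R f g = tensor_ext (\<lambda>i1 f1 i2 f2. tensor_ext (\<lambda>j1 g1 j2 g2.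
     fscale (psign (i2 * j1)) (tm A B P R (i1 + j1) (cmp A (fst P) (fst Q) (fst R) f1 g1)
       (i2 + j2) (cmp B (snd P) (snd Q) (snd R) f2 g2))) g) f"

lemma cmp_tensor_cat: "cmp (tensor_cat A B) = tcomp A B"
proof (intro ext)
  fix P Q R f g
  have 1: "quo (hom_rels A B P R) (lin_ext h x) = lin_ext (\<lambda>t. quo (hom_rels A B P R) (h t)) x" for h x
    by (rule lin_lin_ext) (rule quo_lin_tensor)
  show "cmp (tensor_cat A B) P Q R f g = tcomp A B P Q R f g"
    unfolding tensor_cat_def supercat.simps tcomp_def tensor_ext_def 1
    by (intro arg_cong[of _ _ "\<lambda>h. lin_ext h _"] ext)
      (auto simp: 1 tensor_def lin_scale[OF quo_lin_tensor] intro!: ext arg_cong[of _ _ "\<lambda>h. lin_ext h _"])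
qed

lemma lin_tcomp_left: "lin (\<lambda>f. tcomp A B P Q R f g)"
  by (simp add: tcomp_def)

lemma lin_tcomp_right: "lin (tcomp A B P Q R f)"
proof -
  have "tcomp A B P Q R f = (\<lambda>g. lin_ext (\<lambda>t. case t of ((i1, f1), (i2, f2)) \<Rightarrow> tensor_ext (\<lambda>j1 g1 j2 g2.
     fscale (psign (i2 * j1)) (tm A B P R (i1 + j1) (cmp A (fst P) (fst Q) (fst R) f1 g1)
       (i2 + j2) (cmp B (snd P) (snd Q) (snd R) f2 g2))) g) f)"
    unfolding tcomp_def by (subst tensor_ext_def) (intro ext arg_cong[of _ _ "\<lambda>h. lin_ext h _"], auto)
  thus ?thesis
    by (auto intro!: linI simp: lin_ext_add_fun[symmetric] lin_ext_scale_fun[symmetric]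
        intro!: arg_cong[of _ _ "\<lambda>h. lin_ext h _"])
qed

locale graded_category_pair = A: graded_category A + B: graded_category B
  for A :: "('k::field, 'o, 'a::ab_group_add) supercat" and B :: "('k, 'p, 'b::ab_group_add) supercat"
begin

abbreviation AB where "AB \<equiv> tensor_cat A B"

lemma tcomp_tm:
  assumes P: "P \<in> Ob A \<times> Ob B" and Q: "Q \<in> Ob A \<times> Ob B" and R: "R \<in> Ob A \<times> Ob B"
    and a: "a \<in> homd A (fst P) (fst Q) i" and b: "b \<in> homd B (snd P) (snd Q) j"
    and a': "a' \<in> homd A (fst Q) (fst R) i'" and b': "b' \<in> homd B (snd Q) (snd R) j'"
  shows "tcomp A B P Q R (tm A B P Q i a j b) (tm A B Q R i' a' j' b') =
    fscale (psign (j * i')) (tm A B P R (i + i') (cmp A (fst P) (fst Q) (fst R) a a') (j + j') (cmp B (snd P) (snd Q) (snd R) b b'))"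
proof -
  have o: "fst P \<in> Ob A" "fst Q \<in> Ob A" "fst R \<in> Ob A" "snd P \<in> Ob B" "snd Q \<in> Ob B" "snd R \<in> Ob B"
    using P Q R by auto
  let ?h = "\<lambda>i1 f1 i2 f2 j1 g1 j2 g2. fscale (psign (i2 * j1)) (tm A B P R (i1 + j1) (cmp A (fst P) (fst Q) (fst R) f1 g1)
       (i2 + j2) (cmp B (snd P) (snd Q) (snd R) f2 g2)) :: (bit, 'a, 'b) tgen \<Rightarrow>\<^sub>0 'k"
  have 1: "tensor_ext (?h i1 f1 i2 f2) (tm A B Q R i' a' j' b') = ?h i1 f1 i2 f2 i' a' j' b'"
    if "f1 \<in> homd A (fst P) (fst Q) i1" "f2 \<in> homd B (snd P) (snd Q) i2" for i1 f1 i2 f2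
    by (rule tensor_ext_tensor)
      (use that o in \<open>auto simp: bilin_def A.cmp_add_right B.cmp_add_right A.cmp_scl_right B.cmp_scl_right
        A.cmp_homd B.cmp_homd tensor_add_left tensor_add_right tensor_scale_left tensor_scale_right
        fvs.scale_right_distrib mult.commute\<close>)
  have "tcomp A B P Q R (tm A B P Q i a j b) (tm A B Q R i' a' j' b') =
      tensor_ext (?h i a j b) (tm A B Q R i' a' j' b')"
    unfolding tcomp_def
  proof (rule tensor_ext_tensor)
    show "bilin (scl A) (scl B) (homd A (fst P) (fst Q)) (homd B (snd P) (snd Q))
        (\<lambda>i1 f1 i2 f2. tensor_ext (?h i1 f1 i2 f2) (tm A B Q R i' a' j' b'))"
      unfolding bilin_def
      using o a' b' A.homd_add[OF o(1,2)] A.homd_scl[OF o(1,2)] B.homd_add[OF o(4,5)] B.homd_scl[OF o(4,5)]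
      by (simp add: 1 A.cmp_add_left[OF o(1-3)] B.cmp_add_left[OF o(4-6)] A.cmp_scl_left[OF o(1-3)] B.cmp_scl_left[OF o(4-6)]
        A.cmp_homd[OF o(1-3)] B.cmp_homd[OF o(4-6)] tensor_add_left tensor_add_right tensor_scale_left tensor_scale_right
        fvs.scale_right_distrib mult.commute)
  qed
  thus ?thesis using 1[OF a b] by simp
qed

text \<open>These axioms make the boundary of \<open>AB\<close> a map on classes. Whatever else is
  used about the chains of \<open>AB\<close> is transported from the diagonal through
  \<open>Theta\<close>.\<close>

sublocale AB: graded_category AB
proof (rule graded_category.intro)
  fix P Q R i j and f f' g g' :: "(bit, 'a, 'b) tgen \<Rightarrow>\<^sub>0 'k" and c :: 'k
  show "vector_space (scl AB)" by (simp add: fvs.vector_space_axioms)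
  show "module.subspace (scl AB) (homd AB P Q i)" by simp
  show "cmp AB P Q R f g \<in> homd AB P R (i + j)"
    if o: "P \<in> Ob AB" "Q \<in> Ob AB" "R \<in> Ob AB" and f: "f \<in> homd AB P Q i" and g: "g \<in> homd AB Q R j"
    unfolding cmp_tensor_cat tensor_cat_sel
  proof (rule lin_tensor_deg_in[OF lin_tcomp_left _ f[unfolded tensor_cat_sel]])
    fix i1 a i2 b
    assume a: "a \<in> homd A (fst P) (fst Q) i1" and b: "b \<in> homd B (snd P) (snd Q) i2" and i: "i1 + i2 = i"
    show "tcomp A B P Q R (tm A B P Q i1 a i2 b) g \<in> tensor_deg (scl A) (scl B) (homd A (fst P) (fst R)) (homd B (snd P) (snd R)) (i + j)"
    proof (rule lin_tensor_deg_in[OF lin_tcomp_right _ g[unfolded tensor_cat_sel]])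
      fix j1 a' j2 b'
      assume a': "a' \<in> homd A (fst Q) (fst R) j1" and b': "b' \<in> homd B (snd Q) (snd R) j2" and j: "j1 + j2 = j"
      show "tcomp A B P Q R (tm A B P Q i1 a i2 b) (tm A B Q R j1 a' j2 b') \<in>
          tensor_deg (scl A) (scl B) (homd A (fst P) (fst R)) (homd B (snd P) (snd R)) (i + j)"
        using o i j a b a' b'
        by (subst tcomp_tm) (auto intro!: fvs.subspace_scale tensor_in_deg A.cmp_homd B.cmp_homd simp: add_ac)
    qed simp
  qed simp
qed (simp_all add: cmp_tensor_cat lin_simps[OF lin_tcomp_left] lin_simps[OF lin_tcomp_right])

end

text \<open>The exponent for moving every \<open>b\<close> past all later \<open>a\<close>: by
  \<open>kap_sum\<close> it is the sum of the products \<open>b_l * a_m\<close> over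
  \<open>l < m\<close>.\<close>

fun kap :: "(bit \<times> bit) list \<Rightarrow> bit" where
  "kap [] = 0"
| "kap ((a, b) # zs) = b * sum_list (map fst zs) + kap zs"

lemma kap_append: "kap (us @ vs) = kap us + kap vs + sum_list (map snd us) * sum_list (map fst vs)"
  by (induction us rule: kap.induct) (simp_all add: algebra_simps)

text \<open>Merging two neighbours loses exactly the pair of \<open>b\<close> and \<open>a'\<close>,
  and \<open>b * a'\<close> is the exponent in the composition of two tensors. This is why the faces
  on the two sides of \<open>theta\<close> match.\<close>

lemma kap_merge: "kap (us @ (a, b) # (a', b') # vs) = kap (us @ (a + a', b + b') # vs) + b * a'"
proof -
  have "b * a' + (x + b * a') = x" for x by (simp add: add.left_commute[of "b * a'" x])
  thus ?thesis by (simp add: kap_append algebra_simps)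
qed

definition degs :: "('o, 'a) entry list \<Rightarrow> ('p, 'b) entry list \<Rightarrow> (bit \<times> bit) list" where
  "degs s t = zip (map (fst \<circ> snd) s) (map (fst \<circ> snd) t)"

lemma length_degs [simp]: "length s = length t \<Longrightarrow> length (degs s t) = length s"
  by (simp add: degs_def)

lemma nth_degs: "length s = length t \<Longrightarrow> k < length s \<Longrightarrow> degs s t ! k = (deg s k, deg t k)"
  by (simp add: degs_def deg_def)

text \<open>The Koszul sign of the rearrangement of \<open>(a\<^sub>0, \<dots>, a\<^sub>n, b\<^sub>0, \<dots>, b\<^sub>n)\<close> into
  \<open>(a\<^sub>0, b\<^sub>0, \<dots>, a\<^sub>n, b\<^sub>n)\<close>.\<close>

definition ksign :: "('o, 'a) entry list \<Rightarrow> ('p, 'b) entry list \<Rightarrow> 'k::field" where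
  "ksign s t = psign (kap (degs s t))"

definition zent where
  "zent A B s t k = ((src s k, src t k), deg s k + deg t k,
     slot_tensor A B s t k (deg s k) (arr s k) (deg t k) (arr t k))"

definition zipt where
  "zipt A B s t = map (zent A B s t) [0..<length s]"

lemma length_zipt [simp]: "length (zipt A B s t) = length s"
  by (simp add: zipt_def)

lemma nth_zipt: "k < length s \<Longrightarrow> zipt A B s t ! k = zent A B s t k"
  by (simp add: zipt_def)

lemma src_zipt: "length s = length t \<Longrightarrow> k \<le> length s \<Longrightarrow> 0 < length s \<Longrightarrow> src (zipt A B s t) k = (src s k, src t k)"
proof (cases "k = length s")
  case True
  assume "length s = length t" "0 < length s"
  thus ?thesis using True src_length[of "zipt A B s t"] src_length[of s] src_length[of t]
      src_less[of 0 "zipt A B s t"] by (simp add: nth_zipt zent_def)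
qed (simp add: src_less nth_zipt zent_def)

lemma deg_zipt: "k < length s \<Longrightarrow> deg (zipt A B s t) k = deg s k + deg t k"
  by (simp add: deg_def nth_zipt zent_def)

lemma arr_zipt: "k < length s \<Longrightarrow> arr (zipt A B s t) k =
    slot_tensor A B s t k (deg s k) (arr s k) (deg t k) (arr t k)"
  by (simp add: arr_def nth_zipt zent_def)

lemma map_deg_upd: "i < length ts \<Longrightarrow> map (fst \<circ> snd) (upd ts i f) = map (fst \<circ> snd) ts"
  by (rule nth_equalityI) (auto simp: nth_list_update deg_def)

lemma degs_upd: "i < length s \<Longrightarrow> degs (upd s i f) t = degs s t" "i < length t \<Longrightarrow> degs s (upd t i g) = degs s t"
  by (simp_all only: degs_def map_deg_upd)

lemma zipt_upd_left:
  assumes "length s = length t" "i < length s"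
  shows "zipt A B (upd s i f) t = upd (zipt A B s t) i
    (slot_tensor A B s t i (deg s i) f (deg t i) (arr t i))"
proof (rule nth_equalityI)
  have "0 < length s" using assms by linarith
  moreover fix k assume "k < length (zipt A B (upd s i f) t)"
  ultimately show "zipt A B (upd s i f) t ! k = upd (zipt A B s t) i
    (slot_tensor A B s t i (deg s i) f (deg t i) (arr t i)) ! k"
    using assms by (cases "k = i") (simp_all add: nth_zipt zent_def src_zipt deg_zipt arr_upd)
qed simp

lemma zipt_upd_right:
  assumes "length s = length t" "i < length s"
  shows "zipt A B s (upd t i f) = upd (zipt A B s t) i
    (slot_tensor A B s t i (deg s i) (arr s i) (deg t i) f)"
proof (rule nth_equalityI)
  have "0 < length s" using assms by linarith
  moreover fix k assume "k < length (zipt A B s (upd t i f))"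
  ultimately show "zipt A B s (upd t i f) ! k = upd (zipt A B s t) i
    (slot_tensor A B s t i (deg s i) (arr s i) (deg t i) f) ! k"
    using assms by (cases "k = i") (simp_all add: nth_zipt zent_def src_zipt deg_zipt arr_upd)
qed simp

lemma rot_zipt: "length s = length t \<Longrightarrow> 0 < length s \<Longrightarrow> rot (zipt A B s t) = zipt A B (rot s) (rot t)"
proof (rule nth_equalityI)
  assume l: "length s = length t" "0 < length s"
  thus "length (rot (zipt A B s t)) = length (zipt A B (rot s) (rot t))" by simp
  fix k assume "k < length (rot (zipt A B s t))"
  hence k: "k < length s" using l by simp
  have s: "src s (length t) = src s 0" "src t (length t) = src t 0" "Suc (length t - Suc 0) = length t"
    using src_length[of s] src_length[of t] l by simp_all
  show "rot (zipt A B s t) ! k = zipt A B (rot s) (rot t) ! k"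
    using k l s src_rot[of "Suc 0" s] src_rot[of "Suc 0" t]
    by (cases "k = 0") (auto simp: Suc_leI nth_rot nth_zipt zent_def src_rot deg_rot arr_rot)
qed

lemma ksign_face:
  assumes "length s = length t" "Suc i < length s"
  shows "ksign (face A i s) (face B i t) = ksign s t * (psign (deg t i * deg s (Suc i)) :: 'k::field)"
proof -
  let ?z = "degs s t"
  have l: "length ?z = length s" using assms by simp
  have "?z = take i ?z @ ?z ! i # ?z ! Suc i # drop (i + 2) ?z"
    using assms l by (metis Cons_nth_drop_Suc Suc_lessD add_2_eq_Suc' append_take_drop_id)
  hence 1: "?z = take i ?z @ (deg s i, deg t i) # (deg s (Suc i), deg t (Suc i)) # drop (i + 2) ?z"
    using assms by (simp add: nth_degs)
  have 2: "degs (face A i s) (face B i t) = take i ?z @ (deg s i + deg s (Suc i), deg t i + deg t (Suc i)) # drop (i + 2) ?z"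
    using assms by (simp add: degs_def face_def take_zip drop_zip take_map drop_map)
  show ?thesis unfolding ksign_def 2 psign_add[symmetric] by (subst 1) (simp add: kap_merge add.assoc)
qed

text \<open>The last pair moves to the front either in each factor separately or after tensoring.
  Once the last entries are split off, the difference of the exponents depends on four parities
  only, and all their values are checked.\<close>

lemma ksign_rot:
  assumes "length s = length t" "0 < length s"
  shows "lsign s * lsign t * ksign (rot s) (rot t) = ksign s t * (lsign (zipt A B s t) :: 'k::field)"
proof -
  obtain s' x where s: "s = s' @ [x]" using assms(2) by (metis length_greater_0_conv rev_exhaust)
  obtain t' y where t: "t = t' @ [y]" using assms by (metis length_greater_0_conv rev_exhaust)
  have l: "length s' = length t'" using assms s t by simp
  let ?a = "fst (snd x)" and ?b = "fst (snd y)" and ?u = "degs s' t'"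
  have f: "map fst ?u = map (fst \<circ> snd) s'" "map snd ?u = map (fst \<circ> snd) t'" using l by (simp_all add: degs_def)
  have tz: "tdeg (zipt A B s t) = tdeg s + tdeg t"
    using assms by (simp add: tdeg_def sum_list_sum_nth deg_def nth_zipt zent_def sum.distrib)
  have d: "deg s (length s - Suc 0) = ?a" "deg t (length s - Suc 0) = ?b" using l by (simp_all add: s t deg_def nth_append)
  have 1: "kap (degs s t) = kap ?u + tdeg t' * ?a" using l f
    by (simp add: s t degs_def[of "s' @ [x]"] kap_append) (simp add: degs_def[symmetric] f tdeg_def)
  have 2: "kap (degs (rot s) (rot t)) = ?b * tdeg s' + kap ?u" using l f
    by (simp add: s t rot_def degs_def[of "_ # _"]) (simp add: degs_def[symmetric] f tdeg_def)
  have T: "tdeg s = tdeg s' + ?a" "tdeg t = tdeg t' + ?b" by (simp_all add: s t tdeg_def)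
  have L: "lsign s = (psign (?a * tdeg s') :: 'k)" "lsign t = (psign (?b * tdeg t') :: 'k)"
     "lsign (zipt A B s t) = (psign ((?a + ?b) * (tdeg s' + tdeg t')) :: 'k)"
    using assms(2) assms(1)[symmetric] d by (simp_all add: lsign_def deg_zipt tz T add.assoc add.left_commute add.commute)
  show ?thesis unfolding ksign_def 1 2 L psign_add[symmetric]
    by (cases ?a; cases ?b; cases "tdeg s'"; cases "tdeg t'") (simp_all add: psign_def add.commute)
qed

context graded_category_pair
begin

lemma cyc_tuple_zipt:
  assumes "cyc_tuple A s" "cyc_tuple B t" "length s = length t"
  shows "cyc_tuple AB (zipt A B s t)"
proof (rule cyc_tupleI)
  have l: "0 < length s" using cyc_tuple_nonempty[OF assms(1)] .
  show "0 < length (zipt A B s t)" using l by simp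
  fix i assume "i < length (zipt A B s t)"
  hence i: "i < length s" by simp
  show "src (zipt A B s t) i \<in> Ob AB" using i assms l by (simp add: src_zipt cyc_tuple_src)
  show "arr (zipt A B s t) i \<in> slot AB (zipt A B s t) i"
    using i assms l cyc_tuple_arr[OF assms(1) i] cyc_tuple_arr[OF assms(2), of i]
    by (simp add: src_zipt arr_zipt deg_zipt tensor_in_deg)
qed

lemma face_zipt:
  assumes "cyc_tuple A s" "cyc_tuple B t" "length s = length t" "Suc i < length s"
  shows "cl AB (face AB i (zipt A B s t)) = fscale (psign (deg t i * deg s (Suc i))) (cl AB (zipt A B (face A i s) (face B i t)))"
proof -
  let ?Z = "zipt A B (face A i s) (face B i t)"
  have l: "length s = length t" "0 < length s" "0 < length s - 1" "length (face A i s) = length (face B i t)" using assms(3,4) by auto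
  have cz: "cyc_tuple AB ?Z"
    using assms l by (intro cyc_tuple_zipt A.cyc_tuple_face B.cyc_tuple_face) auto
  have i: "i < length ?Z" using assms by simp
  \<comment> \<open>The composite in slot \<open>i\<close> is a sign times the pure tensor of the
    two composites; multilinearity takes the sign out of the tuple.\<close>
  have "face AB i (zipt A B s t) = upd ?Z i (scl AB (psign (deg t i * deg s (Suc i))) (arr ?Z i))"
  proof (rule nth_equalityI)
    show "length (face AB i (zipt A B s t)) = length (upd ?Z i (scl AB (psign (deg t i * deg s (Suc i))) (arr ?Z i)))"
      using assms by simp
    fix k assume "k < length (face AB i (zipt A B s t))"
    hence k: "k < length s - 1" using assms by simp
    have c: "tcomp A B (src s i, src t i) (src s (Suc i), src t (Suc i)) (src s (Suc (Suc i)), src t (Suc (Suc i)))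
        (arr (zipt A B s t) i) (arr (zipt A B s t) (Suc i)) = fscale (psign (deg t i * deg s (Suc i))) (arr ?Z i)"
      using tcomp_tm[of "(src s i, src t i)" "(src s (Suc i), src t (Suc i))" "(src s (Suc (Suc i)), src t (Suc (Suc i)))"
          "arr s i" "deg s i" "arr t i" "deg t i" "arr s (Suc i)" "deg s (Suc i)" "arr t (Suc i)" "deg t (Suc i)"]
        assms cyc_tuple_arr[OF assms(1)] cyc_tuple_arr[OF assms(2)]
      by (simp add: arr_zipt cyc_tuple_src src_face deg_face arr_face)
    consider "k < i" | "k = i" | "i < k" by linarith
    thus "face AB i (zipt A B s t) ! k = upd ?Z i (scl AB (psign (deg t i * deg s (Suc i))) (arr ?Z i)) ! k"
    proof cases
      case 1
      thus ?thesis using k assms l by (simp add: nth_face nth_zipt zent_def src_face deg_face arr_face)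
    next
      case 2
      thus ?thesis using k assms l c
        by (simp add: nth_face src_zipt deg_zipt src_face deg_face cmp_tensor_cat)
    next
      case 3
      thus ?thesis using k assms l by (simp add: nth_face nth_zipt zent_def src_face deg_face arr_face)
    qed
  qed
  hence "cl AB (face AB i (zipt A B s t)) = fscale (psign (deg t i * deg s (Suc i))) (cl AB (upd ?Z i (arr ?Z i)))"
    using cl_upd_scl[OF cz i cyc_tuple_arr[OF cz i], of "psign (deg t i * deg s (Suc i))"] by argo
  thus ?thesis unfolding upd_self[OF i] .
qed



end

section \<open>The comparison map from the diagonal and its inverse\<close>

definition biext :: "('x \<Rightarrow> 'y \<Rightarrow> ('z \<Rightarrow>\<^sub>0 'k::field)) \<Rightarrow> ('x \<Rightarrow>\<^sub>0 'k) \<Rightarrow> ('y \<Rightarrow>\<^sub>0 'k) \<Rightarrow> ('z \<Rightarrow>\<^sub>0 'k)" where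
  "biext \<theta> v w = lin_ext (\<lambda>s. lin_ext (\<theta> s) w) v"

lemma lin_biext_left: "lin (\<lambda>v. biext \<theta> v w)"
  by (simp add: biext_def)

lemma lin_biext_right: "lin (biext \<theta> v)"
  by (simp add: biext_def[abs_def] lin_ext_swap[of _ _ v])

lemma bilin_biext: "bilin fscale fscale V W (\<lambda>i v j w. biext \<theta> v w)"
  by (simp add: bilin_def lin_simps[OF lin_biext_left] lin_simps[OF lin_biext_right])

lemma cl_in_hoch: "cyc_tuple A s \<Longrightarrow> cl A s \<in> hoch_chains A (length s - 1)"
  using cyc_tuple_nonempty[of A s] by (intro cl_in_hoch_chains) auto

text \<open>An update keeps the length and all degrees, so a function that sees a tuple only through
  its degrees and its class inherits multilinearity from \<open>cl\<close>.\<close>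

lemma multilin_via_cl:
  assumes "\<And>ds v w. v \<in> hoch_chains A (length ds - 1) \<Longrightarrow> w \<in> hoch_chains A (length ds - 1) \<Longrightarrow>
      f ds (v + w) = f ds v + f ds w"
    and "\<And>ds c v. v \<in> hoch_chains A (length ds - 1) \<Longrightarrow> f ds (fscale c v) = fscale c (f ds v)"
  shows "multilin A (\<lambda>s. f (map (fst \<circ> snd) s) (cl A s))"
proof (rule multilinI)
  fix s i x y assume s: "cyc_tuple A s" "i < length s" and x: "x \<in> slot A s i"
  have u: "cl A (upd s i z) \<in> hoch_chains A (length (map (fst \<circ> snd) s) - 1)"
    if "z \<in> slot A s i" for z
    using cl_in_hoch[OF cyc_tuple_upd[OF s that]] by simp
  show "f (map (fst \<circ> snd) (upd s i (x + y))) (cl A (upd s i (x + y))) =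
      f (map (fst \<circ> snd) (upd s i x)) (cl A (upd s i x)) + f (map (fst \<circ> snd) (upd s i y)) (cl A (upd s i y))"
    if y: "y \<in> slot A s i"
    unfolding cl_upd_add[OF s x y] map_deg_upd[OF s(2)] by (rule assms(1)[OF u[OF x] u[OF y]])
  show "f (map (fst \<circ> snd) (upd s i (scl A c x))) (cl A (upd s i (scl A c x))) =
      fscale c (f (map (fst \<circ> snd) (upd s i x)) (cl A (upd s i x)))" for c
    unfolding cl_upd_scl[OF s x] map_deg_upd[OF s(2)] by (rule assms(2)[OF u[OF x]])
qed

lemma cyc_tuple_set:
  assumes "cyc_tuple A ts" "i < length ts" "f \<in> homd A (src ts i) (src ts (Suc i)) e"
  shows "cyc_tuple A (ts[i := (src ts i, e, f)])"
proof (rule cyc_tupleI)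
  have d: "deg (ts[i := (src ts i, e, f)]) k = (if k = i then e else deg ts k)"
    "arr (ts[i := (src ts i, e, f)]) k = (if k = i then f else arr ts k)" if "k < length ts" for k
    using that by (auto simp: deg_def arr_def nth_list_update)
  fix k assume "k < length (ts[i := (src ts i, e, f)])"
  thus "arr (ts[i := (src ts i, e, f)]) k \<in>
       slot A (ts[i := (src ts i, e, f)]) k"
    using assms by (simp add: d cyc_tuple_arr)
qed (use assms in \<open>auto simp: cyc_tuple_src\<close>)

lemma upd_set: "i < length ts \<Longrightarrow> upd (ts[i := (src ts i, e, f)]) i g = ts[i := (src ts i, e, g)]"
  by (simp add: deg_def)

text \<open>Consequently the representative that \<open>quo\<close> chooses for the class of a
  cyclic tuple is a combination of cyclic tuples (\<open>cl_in_span\<close>), and a formula that is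
  known only on those can be applied to it term by term.\<close>

lemma (in graded_category) chain_rels_subset: "chain_rels A \<subseteq> fvs.span {gen ts | ts. cyc_tuple A ts}"
proof -
  let ?S = "fvs.span {gen ts | ts. cyc_tuple A ts} :: (('o, 'm) entry list \<Rightarrow>\<^sub>0 'k) set"
  have g: "gen ts \<in> ?S" if "cyc_tuple A ts" for ts using that by (intro fvs.span_base) blast
  show ?thesis
    unfolding chain_rels_def
    by (rule fvs.span_minimal)
      (auto intro!: fvs.span_diff fvs.span_scale g cyc_tuple_upd homd_add homd_scl simp: cyc_tuple_src)
qed

lemma (in graded_category) cl_in_span: "cyc_tuple A s \<Longrightarrow> cl A s \<in> fvs.span {gen ts | ts. cyc_tuple A ts}"
proof -
  assume s: "cyc_tuple A s"
  have "cl A s - gen s \<in> fvs.span {gen ts | ts. cyc_tuple A ts}"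
    using quo_diff_in[of "chain_rels A" "gen s"] chain_rels_subset by (auto simp: cl_def)
  moreover have "gen s \<in> fvs.span {gen ts | ts. cyc_tuple A ts}"
    using s by (intro fvs.span_base) blast
  ultimately show ?thesis using fvs.span_add[of "cl A s - gen s" _ "gen s"] by simp
qed

definition theta where
  "theta A B s t = (if length s = length t then fscale (ksign s t) (cl (tensor_cat A B) (zipt A B s t)) else 0)"

definition Theta where
  "Theta A B = tensor_ext (\<lambda>m v n w. biext (theta A B) v w)"

lemma lin_Theta [simp]: "lin (Theta A B)"
  by (simp add: Theta_def)

lemma Theta_ten: "Theta A B (ten A B m v n w) = biext (theta A B) v w"
  by (simp add: Theta_def tensor_ext_tensor[OF bilin_biext])

text \<open>The multilinear expansion of a tuple of tensors into pairs of tuples, with two accumulators.\<close>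

primrec unzip :: "(('o, 'a) entry list \<Rightarrow> ('p, 'b) entry list \<Rightarrow> ('z \<Rightarrow>\<^sub>0 'k::field)) \<Rightarrow>
    ('o \<times> 'p, (bit, 'a, 'b) tgen \<Rightarrow>\<^sub>0 'k) entry list \<Rightarrow> ('o, 'a) entry list \<Rightarrow> ('p, 'b) entry list \<Rightarrow> ('z \<Rightarrow>\<^sub>0 'k)" where
  "unzip \<phi> [] s t = \<phi> s t"
| "unzip \<phi> (u # us) s t = tensor_ext (\<lambda>i a j b. unzip \<phi> us (s @ [(fst (fst u), i, a)]) (t @ [(snd (fst u), j, b)])) (snd (snd u))"

lemma unzip_linear:
  assumes "i < length us"
  shows "unzip \<phi> (us[i := (X, e, x + y)]) s t = unzip \<phi> (us[i := (X, e, x)]) s t + unzip \<phi> (us[i := (X, e, y)]) s t"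
    and "unzip \<phi> (us[i := (X, e, fscale c x)]) s t = fscale c (unzip \<phi> (us[i := (X, e, x)]) s t)"
proof -
  have "\<forall>i s t. i < length us \<longrightarrow> unzip \<phi> (us[i := (X, e, x + y)]) s t = unzip \<phi> (us[i := (X, e, x)]) s t + unzip \<phi> (us[i := (X, e, y)]) s t
    \<and> unzip \<phi> (us[i := (X, e, fscale c x)]) s t = fscale c (unzip \<phi> (us[i := (X, e, x)]) s t)"
  proof (induction us)
    case (Cons u us)
    show ?case
    proof (intro allI impI)
      fix i s t assume "i < length (u # us)"
      thus "unzip \<phi> ((u # us)[i := (X, e, x + y)]) s t = unzip \<phi> ((u # us)[i := (X, e, x)]) s t + unzip \<phi> ((u # us)[i := (X, e, y)]) s t
        \<and> unzip \<phi> ((u # us)[i := (X, e, fscale c x)]) s t = fscale c (unzip \<phi> ((u # us)[i := (X, e, x)]) s t)"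
        using Cons.IH by (cases i)
          (simp_all add: tensor_ext_def case_prod_unfold lin_ext_add_fun[symmetric] lin_ext_scale_fun[symmetric])
    qed
  qed simp
  thus "unzip \<phi> (us[i := (X, e, x + y)]) s t = unzip \<phi> (us[i := (X, e, x)]) s t + unzip \<phi> (us[i := (X, e, y)]) s t"
    "unzip \<phi> (us[i := (X, e, fscale c x)]) s t = fscale c (unzip \<phi> (us[i := (X, e, x)]) s t)" using assms by blast+
qed

lemma multilin_unzip: "multilin (tensor_cat A B) (\<lambda>us. unzip \<phi> us [] [])"
  by (rule multilinI) (simp_all add: unzip_linear)

context graded_category_pair
begin

lemma biext_cl:
  assumes s: "cyc_tuple A s" and t: "cyc_tuple B t"
    and l: "\<And>t. cyc_tuple B t \<Longrightarrow> multilin A (\<lambda>s. \<theta> s t)" and r: "\<And>s. cyc_tuple A s \<Longrightarrow> multilin B (\<theta> s)"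
  shows "biext \<theta> (cl A s) (cl B t) = \<theta> s t"
proof -
  have "biext \<theta> (cl A s) (cl B t) = lin_ext (\<lambda>s. \<theta> s t) (cl A s)"
    unfolding biext_def by (rule lin_ext_cong_span[OF _ A.cl_in_span[OF s]]) (rule lin_ext_cl[OF r])
  also have "\<dots> = \<theta> s t" by (rule lin_ext_cl[OF l[OF t]])
  finally show ?thesis .
qed

lemma multilin_theta_left: "cyc_tuple B t \<Longrightarrow> multilin A (\<lambda>s. theta A B s t)"
proof (rule multilinI)
  fix s i f g assume t: "cyc_tuple B t" and s: "cyc_tuple A s" and i: "i < length s"
    and f: "f \<in> slot A s i"
  let ?W = "homd B (src t i) (src t (Suc i))" and ?V = "homd A (src s i) (src s (Suc i))"
  let ?t = "\<lambda>f. tensor (scl A) (scl B) ?V ?W (deg s i) f (deg t i) (arr t i)"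
  have l: "0 < length s" using i by linarith
  have h: "?t f \<in> slot AB (zipt A B s t) i"
    if "length s = length t" "f \<in> ?V (deg s i)" for f
    using that i l t by (simp add: src_zipt deg_zipt tensor_in_deg cyc_tuple_arr)
  note z = cyc_tuple_zipt[OF s t]
  show "theta A B (upd s i (f + g)) t = theta A B (upd s i f) t + theta A B (upd s i g) t"
    if g: "g \<in> slot A s i"
  proof (cases "length s = length t")
    case True
    have "?t (f + g) = ?t f + ?t g"
      by (rule tensor_add_left) (use f g t i True in \<open>auto simp: cyc_tuple_arr\<close>)
    thus ?thesis using True i multilin_add[OF multilin_cl z[OF True], of i "?t f" "?t g"] h[OF True f] h[OF True g]
      by (simp add: theta_def zipt_upd_left ksign_def degs_upd fvs.scale_right_distrib)
  qed (simp add: theta_def)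
  show "theta A B (upd s i (scl A c f)) t = fscale c (theta A B (upd s i f) t)" for c
  proof (cases "length s = length t")
    case True
    have "?t (scl A c f) = fscale c (?t f)"
      by (rule tensor_scale_left) (use f t i True in \<open>auto simp: cyc_tuple_arr\<close>)
    thus ?thesis using True i multilin_scl[OF multilin_cl z[OF True], of i "?t f" c] h[OF True f]
      by (simp add: theta_def zipt_upd_left ksign_def degs_upd mult.commute)
  qed (simp add: theta_def)
qed

lemma multilin_theta_right: "cyc_tuple A s \<Longrightarrow> multilin B (theta A B s)"
proof (rule multilinI)
  fix t i f g assume s: "cyc_tuple A s" and t: "cyc_tuple B t" and i: "i < length t"
    and f: "f \<in> slot B t i"
  let ?W = "homd B (src t i) (src t (Suc i))" and ?V = "homd A (src s i) (src s (Suc i))"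
  let ?t = "\<lambda>f. tensor (scl A) (scl B) ?V ?W (deg s i) (arr s i) (deg t i) f"
  have l: "0 < length t" using i by linarith
  have h: "?t f \<in> slot AB (zipt A B s t) i"
    if "length s = length t" "f \<in> ?W (deg t i)" for f
    using that i l s by (simp add: src_zipt deg_zipt tensor_in_deg cyc_tuple_arr)
  note z = cyc_tuple_zipt[OF s t]
  show "theta A B s (upd t i (f + g)) = theta A B s (upd t i f) + theta A B s (upd t i g)"
    if g: "g \<in> slot B t i"
  proof (cases "length s = length t")
    case True
    have "?t (f + g) = ?t f + ?t g"
      by (rule tensor_add_right) (use f g s i True in \<open>auto simp: cyc_tuple_arr\<close>)
    thus ?thesis using True i multilin_add[OF multilin_cl z[OF True], of i "?t f" "?t g"] h[OF True f] h[OF True g]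
      by (simp add: theta_def zipt_upd_right ksign_def degs_upd fvs.scale_right_distrib)
  qed (simp add: theta_def)
  show "theta A B s (upd t i (scl B c f)) = fscale c (theta A B s (upd t i f))" for c
  proof (cases "length s = length t")
    case True
    have "?t (scl B c f) = fscale c (?t f)"
      by (rule tensor_scale_right) (use f s i True in \<open>auto simp: cyc_tuple_arr\<close>)
    thus ?thesis using True i multilin_scl[OF multilin_cl z[OF True], of i "?t f" c] h[OF True f]
      by (simp add: theta_def zipt_upd_right ksign_def degs_upd mult.commute)
  qed (simp add: theta_def)
qed

lemma Theta_cl: "cyc_tuple A s \<Longrightarrow> cyc_tuple B t \<Longrightarrow> Theta A B (ten A B m (cl A s) n (cl B t)) = theta A B s t"
  by (simp add: Theta_ten biext_cl multilin_theta_left multilin_theta_right)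

lemma ten_left_induct:
  assumes U: "fvs.subspace U" and w: "w \<in> hoch_chains B n" and v: "v \<in> hoch_chains A m"
    and gen: "\<And>s. cyc_tuple A s \<Longrightarrow> length s = Suc m \<Longrightarrow> ten A B m (cl A s) n w \<in> U"
  shows "ten A B m v n w \<in> U"
proof -
  let ?V = "{v \<in> hoch_chains A m. ten A B m v n w \<in> U}"
  have "ten A B m 0 n w = 0"
    using tensor_scale_left[of 0 "hoch_chains A" m w "hoch_chains B" n fscale fscale 0] w by (simp add: fvs.subspace_0)
  hence "fvs.subspace ?V"
    by (intro fvs.subspaceI) (auto simp: w fvs.subspace_0 U fvs.subspace_add fvs.subspace_scale tensor_add_left tensor_scale_left)
  hence "hoch_chains A m \<subseteq> ?V"
    by (subst hoch_chains_eq, intro fvs.span_minimal) (auto simp: gen cl_in_hoch_chains)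
  thus ?thesis using v by blast
qed

lemma ten_right_induct:
  assumes U: "fvs.subspace U" and v: "v \<in> hoch_chains A m" and w: "w \<in> hoch_chains B n"
    and gen: "\<And>t. cyc_tuple B t \<Longrightarrow> length t = Suc n \<Longrightarrow> ten A B m v n (cl B t) \<in> U"
  shows "ten A B m v n w \<in> U"
proof -
  let ?W = "{w \<in> hoch_chains B n. ten A B m v n w \<in> U}"
  have "ten A B m v n 0 = 0"
    using tensor_scale_right[of v "hoch_chains A" m 0 "hoch_chains B" n fscale fscale 0] v by (simp add: fvs.subspace_0)
  hence "fvs.subspace ?W"
    by (intro fvs.subspaceI) (auto simp: v fvs.subspace_0 U fvs.subspace_add fvs.subspace_scale tensor_add_right tensor_scale_right)
  hence "hoch_chains B n \<subseteq> ?W"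
    by (subst hoch_chains_eq, intro fvs.span_minimal) (auto simp: gen cl_in_hoch_chains)
  thus ?thesis using w by blast
qed

text \<open>Both factors are spanned by classes of tuples. They are replaced one at a time, because
  the tensor is linear in each argument separately.\<close>

lemma bichains_eq: "bichains A B m n =
  fvs.span {ten A B m (cl A s) n (cl B t) | s t. cyc_tuple A s \<and> length s = Suc m \<and> cyc_tuple B t \<and> length t = Suc n}"
    (is "_ = fvs.span ?G")
proof
  let ?U = "fvs.span ?G"
  have *: "ten A B m v n (cl B t) \<in> ?U"
    if t: "cyc_tuple B t" "length t = Suc n" and v: "v \<in> hoch_chains A m" for v t
  proof (rule ten_left_induct[OF _ cl_in_hoch_chains[OF t] v])
    fix s assume "cyc_tuple A s" "length s = Suc m"
    thus "ten A B m (cl A s) n (cl B t) \<in> ?U" using t by (intro fvs.span_base CollectI exI[of _ s] exI[of _ t]) simp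
  qed simp
  have "ten A B m v n w \<in> ?U" if v: "v \<in> hoch_chains A m" and w: "w \<in> hoch_chains B n" for v w
    by (rule ten_right_induct[OF _ v w]) (simp_all add: * v)
  thus "bichains A B m n \<subseteq> fvs.span ?G"
    unfolding bichains_def by (intro fvs.span_minimal) auto
  show "fvs.span ?G \<subseteq> bichains A B m n"
    by (rule fvs.span_minimal) (auto intro!: ten_in_bichains cl_in_hoch_chains)
qed

lemma lin_eq_on_bichains_cl:
  assumes "lin f" "lin g" "x \<in> bichains A B m n"
    and "\<And>s t. cyc_tuple A s \<Longrightarrow> length s = Suc m \<Longrightarrow> cyc_tuple B t \<Longrightarrow> length t = Suc n \<Longrightarrow>
      f (ten A B m (cl A s) n (cl B t)) = g (ten A B m (cl A s) n (cl B t))"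
  shows "f x = g x"
  using assms(3) unfolding bichains_eq
  by (rule lin_eq_on_span[OF assms(1,2), rotated]) (use assms(4) in auto)

lemma Theta_in: "x \<in> bichains A B n n \<Longrightarrow> Theta A B x \<in> hoch_chains AB n"
  unfolding bichains_eq
  by (rule lin_span_in[OF lin_Theta, rotated])
    (auto simp: Theta_cl theta_def intro!: fvs.subspace_scale cl_in_hoch_chains cyc_tuple_zipt)

text \<open>\<open>unzip\<close> works from left to right, so the induction on \<open>m\<close>
  descends from \<open>n\<close>, with the entries before \<open>m\<close> already in the
  accumulators. The claim is quantified over \<open>s\<close> and \<open>t\<close>, since expanding
  slot \<open>m\<close> replaces the two entries there by arbitrary homogeneous morphisms.\<close>

lemma unzip_zipt:
  assumes s: "cyc_tuple A s" and t: "cyc_tuple B t" and n: "length s = n" "length t = n"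
    and l: "\<And>t. cyc_tuple B t \<Longrightarrow> multilin A (\<lambda>s. \<phi> s t)" and r: "\<And>s. cyc_tuple A s \<Longrightarrow> multilin B (\<phi> s)"
  shows "unzip \<phi> (zipt A B s t) [] [] = \<phi> s t"
proof -
  have "\<forall>s t. cyc_tuple A s \<longrightarrow> cyc_tuple B t \<longrightarrow> length s = n \<longrightarrow> length t = n \<longrightarrow>
      unzip \<phi> (map (zent A B s t) [m..<n]) (take m s) (take m t) = \<phi> s t" if "m \<le> n" for m
    using that
  proof (induction rule: inc_induct)
    case (step m)
    show ?case
    proof (intro allI impI)
      fix s t assume s: "cyc_tuple A s" and t: "cyc_tuple B t" and ls: "length s = n" and lt: "length t = n"
      let ?V = "homd A (src s m) (src s (Suc m))" and ?W = "homd B (src t m) (src t (Suc m))"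
      let ?s = "\<lambda>i a. s[m := (src s m, i, a)]" and ?t = "\<lambda>j b. t[m := (src t m, j, b)]"
      let ?h = "\<lambda>i a j b. unzip \<phi> (map (zent A B s t) [Suc m..<n]) (take m s @ [(src s m, i, a)]) (take m t @ [(src t m, j, b)])"
      have m: "m < length s" "m < length t" using step ls lt by simp_all
      have cs: "cyc_tuple A (?s i a)" if "a \<in> ?V i" for i a by (rule cyc_tuple_set[OF s m(1) that])
      have ct: "cyc_tuple B (?t j b)" if "b \<in> ?W j" for j b by (rule cyc_tuple_set[OF t m(2) that])
      have h: "?h i a j b = \<phi> (?s i a) (?t j b)" if a: "a \<in> ?V i" and b: "b \<in> ?W j" for i a j b
      proof -
        \<comment> \<open>The later slots depend on entry \<open>m\<close> at most through its
          source, for instance at the cyclic end, and the source is unchanged.\<close>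
        have z: "map (zent A B (?s i a) (?t j b)) [Suc m..<n] = map (zent A B s t) [Suc m..<n]"
          using m by (auto simp: zent_def deg_def arr_def)
        have tk: "take (Suc m) (?s i a) = take m s @ [(src s m, i, a)]" "take (Suc m) (?t j b) = take m t @ [(src t m, j, b)]"
          using m by (simp_all add: take_Suc_conv_app_nth)
        show ?thesis using step.IH[rule_format, OF cs[OF a] ct[OF b]] ls lt z tk by simp
      qed
      have "unzip \<phi> (map (zent A B s t) [m..<n]) (take m s) (take m t) =
          tensor_ext ?h (tensor (scl A) (scl B) ?V ?W (deg s m) (arr s m) (deg t m) (arr t m))"
        using step.hyps by (simp add: upt_conv_Cons zent_def)
      also have "\<dots> = ?h (deg s m) (arr s m) (deg t m) (arr t m)"
      proof (rule tensor_ext_tensor, unfold bilin_def, intro allI ballI conjI)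
        fix i j v w assume v: "v \<in> ?V i" and w: "w \<in> ?W j"
        note S = cyc_tuple_src[OF s] and T = cyc_tuple_src[OF t]
        have dv: "deg (?s i v) m = i" "deg (?t j w) m = j" using m by (simp_all add: deg_def)
        note L = l[OF ct[OF w]] and R = r[OF cs[OF v]]
        show "?h i (v + v') j w = ?h i v j w + ?h i v' j w" if v': "v' \<in> ?V i" for v'
          using multilin_add[OF L cs[OF v], of m v v'] v v' m h[OF v w] h[OF v' w] h[OF A.homd_add[OF S S v v'] w]
          by (simp add: upd_set dv)
        show "?h i v j (w + w') = ?h i v j w + ?h i v j w'" if w': "w' \<in> ?W j" for w'
          using multilin_add[OF R ct[OF w], of m w w'] w w' m h[OF v w] h[OF v w'] h[OF v B.homd_add[OF T T w w']]
          by (simp add: upd_set dv)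
        show "?h i (scl A c v) j w = fscale c (?h i v j w)" for c
          using multilin_scl[OF L cs[OF v], of m v c] v m h[OF v w] h[OF A.homd_scl[OF S S v] w]
          by (simp add: upd_set dv)
        show "?h i v j (scl B c w) = fscale c (?h i v j w)" for c
          using multilin_scl[OF R ct[OF w], of m w c] w m h[OF v w] h[OF v B.homd_scl[OF T T w]]
          by (simp add: upd_set dv)
      qed
      also have "\<dots> = \<phi> (?s (deg s m) (arr s m)) (?t (deg t m) (arr t m))"
        by (rule h) (use s t m in \<open>auto simp: cyc_tuple_arr\<close>)
      finally show "unzip \<phi> (map (zent A B s t) [m..<n]) (take m s) (take m t) = \<phi> s t"
        using m by (simp add: upd_self)
    qed
  qed simp
  from this[of 0] show ?thesis using s t n by (simp add: zipt_def)
qed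

text \<open>The sign is the one of \<open>theta\<close>, as it is its own inverse.\<close>

definition unzip_val where
  "unzip_val s t = (if length s = length t then fscale (ksign s t) (ten A B (length s - 1) (cl A s) (length t - 1) (cl B t)) else 0)"

lemma multilin_unzip_val: "cyc_tuple B t \<Longrightarrow> multilin A (\<lambda>s. unzip_val s t)" "cyc_tuple A s \<Longrightarrow> multilin B (unzip_val s)"
proof -
  let ?\<phi> = "\<lambda>ds es v w. if length ds = length es then fscale (psign (kap (zip ds es)))
      (ten A B (length ds - 1) v (length es - 1) w) else 0"
  have e: "unzip_val s t = ?\<phi> (map (fst \<circ> snd) s) (map (fst \<circ> snd) t) (cl A s) (cl B t)" for s t
    by (simp add: unzip_val_def ksign_def degs_def)
  note T = tensor_add_left tensor_add_right tensor_scale_left tensor_scale_right fvs.scale_right_distrib mult.commute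
  show "multilin A (\<lambda>s. unzip_val s t)" if t: "cyc_tuple B t"
    unfolding e by (rule multilin_via_cl) (use cl_in_hoch[OF t] in \<open>auto simp: T comp_def\<close>)
  show "multilin B (unzip_val s)" if s: "cyc_tuple A s"
    unfolding e by (rule multilin_via_cl) (use cl_in_hoch[OF s] in \<open>auto simp: T comp_def\<close>)
qed

lemma Theta_left_inverse:
  assumes "x \<in> bichains A B n n"
  shows "lin_ext (\<lambda>us. unzip unzip_val us [] []) (Theta A B x) = x"
proof (rule lin_eq_on_bichains_cl[OF lin_compose[OF lin_Theta lin_lin_ext_op] lin_id assms])
  fix s t assume *: "cyc_tuple A s" "length s = Suc n" "cyc_tuple B t" "length t = Suc n"
  thus "lin_ext (\<lambda>us. unzip unzip_val us [] []) (Theta A B (ten A B n (cl A s) n (cl B t))) = ten A B n (cl A s) n (cl B t)"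
    using unzip_zipt[OF *(1,3,2,4) multilin_unzip_val]
    by (simp add: Theta_cl theta_def lin_ext_cl[OF multilin_unzip]) (simp add: unzip_val_def ksign_def)
qed

definition pure_entry where
  "pure_entry us k i a j b \<longleftrightarrow> a \<in> homd A (fst (src us k)) (fst (src us (Suc k))) i \<and>
     b \<in> homd B (snd (src us k)) (snd (src us (Suc k))) j \<and> i + j = deg us k \<and>
     arr us k = tm A B (src us k) (src us (Suc k)) i a j b"

lemma pure_entry_zipt:
  assumes us: "cyc_tuple AB us" and p: "\<And>k. k < length us \<Longrightarrow> \<exists>i a j b. pure_entry us k i a j b"
  shows "\<exists>s t. cyc_tuple A s \<and> cyc_tuple B t \<and> length s = length us \<and> length t = length us \<and> us = zipt A B s t"
proof -
  obtain i a j b where *: "\<And>k. k < length us \<Longrightarrow> pure_entry us k (i k) (a k) (j k) (b k)" using p by metis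
  define s where "s = map (\<lambda>k. (fst (src us k), i k, a k)) [0..<length us]"
  define t where "t = map (\<lambda>k. (snd (src us k), j k, b k)) [0..<length us]"
  note l = cyc_tuple_nonempty[OF us]
  have len: "length s = length us" "length t = length us" by (simp_all add: s_def t_def)
  have src: "src s k = fst (src us k)" "src t k = snd (src us k)" if "k \<le> length us" for k
  proof -
    have "src s k = fst (src us k) \<and> src t k = snd (src us k)"
    proof (cases "k = length us")
      case True
      thus ?thesis using src_length[of s] src_length[of t] src_length[of us] src_less[of 0 s] src_less[of 0 t] l len
        by (simp add: s_def t_def)
    next
      case False
      thus ?thesis using that len by (simp add: src_less) (simp add: s_def t_def src_less)
    qed
    thus "src s k = fst (src us k)" "src t k = snd (src us k)" by auto
  qed
  have e: "deg s k = i k" "arr s k = a k" "deg t k = j k" "arr t k = b k" if "k < length us" for k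
    using that by (simp_all add: deg_def arr_def s_def t_def)
  have o: "fst (src us k) \<in> Ob A" "snd (src us k) \<in> Ob B" for k
    using cyc_tuple_src[OF us, of k] by auto
  have cs: "cyc_tuple A s" by (rule cyc_tupleI) (use * l o in \<open>auto simp: len src e pure_entry_def\<close>)
  have ct: "cyc_tuple B t" by (rule cyc_tupleI) (use * l o in \<open>auto simp: len src e pure_entry_def\<close>)
  have "us = zipt A B s t"
    by (rule entry_list_eqI) (use * l in \<open>auto simp: len src_zipt deg_zipt arr_zipt src e pure_entry_def prod_eq_iff\<close>)
  thus ?thesis using cs ct len by blast
qed

text \<open>Induction on the number \<open>m\<close> of leading entries that need not be pure
  tensors. In the step, the morphisms in slot \<open>m\<close> for which the claim holds form a
  subspace; it contains the pure tensors and hence the whole homogeneous component.\<close>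

lemma cl_in_span_zipt:
  assumes "m \<le> n" "cyc_tuple AB us" "length us = n" "\<And>k. m \<le> k \<Longrightarrow> k < n \<Longrightarrow> \<exists>i a j b. pure_entry us k i a j b"
  shows "cl AB us \<in> fvs.span {cl AB (zipt A B s t) | s t. cyc_tuple A s \<and> cyc_tuple B t \<and> length s = n \<and> length t = n}"
    (is "_ \<in> ?S")
  using assms
proof (induction m arbitrary: us)
  case 0
  have "\<exists>i a j b. pure_entry us k i a j b" if "k < length us" for k
    using 0(4)[of k] 0(3) that by blast
  then obtain s t where "cyc_tuple A s" "cyc_tuple B t" "length s = length us" "length t = length us" "us = zipt A B s t"
    using pure_entry_zipt[OF 0(2)] by blast
  thus ?case using 0(3) by (intro fvs.span_base CollectI exI[of _ s] exI[of _ t]) simp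
next
  case (Suc m)
  have m: "m < length us" using Suc by simp
  let ?P = "src us m" and ?Q = "src us (Suc m)"
  note z = cyc_tuple_arr[OF Suc.prems(2) m]
  have sub: "fvs.subspace {x \<in> homd AB ?P ?Q (deg us m). cl AB (upd us m x) \<in> ?S}"
  proof (rule fvs.subspaceI)
    have 0: "0 \<in> homd AB ?P ?Q (deg us m)" by (simp add: fvs.subspace_0)
    have "cl AB (upd us m 0) = fscale 0 (cl AB (upd us m 0))"
      using cl_upd_scl[OF Suc.prems(2) m 0, of 0] by simp
    hence "cl AB (upd us m 0) = 0" by simp
    thus "0 \<in> {x \<in> homd AB ?P ?Q (deg us m). cl AB (upd us m x) \<in> ?S}" using 0 by (simp add: fvs.span_zero)
  next
    fix x y assume x: "x \<in> {x \<in> homd AB ?P ?Q (deg us m). cl AB (upd us m x) \<in> ?S}"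
      and y: "y \<in> {x \<in> homd AB ?P ?Q (deg us m). cl AB (upd us m x) \<in> ?S}"
    have "cl AB (upd us m (x + y)) = cl AB (upd us m x) + cl AB (upd us m y)"
      by (rule cl_upd_add[OF Suc.prems(2) m]) (use x y in auto)
    thus "x + y \<in> {x \<in> homd AB ?P ?Q (deg us m). cl AB (upd us m x) \<in> ?S}"
      using x y by (simp add: fvs.subspace_add fvs.span_add)
  next
    fix c x assume x: "x \<in> {x \<in> homd AB ?P ?Q (deg us m). cl AB (upd us m x) \<in> ?S}"
    have "cl AB (upd us m (scl AB c x)) = fscale c (cl AB (upd us m x))"
      by (rule cl_upd_scl[OF Suc.prems(2) m]) (use x in auto)
    thus "fscale c x \<in> {x \<in> homd AB ?P ?Q (deg us m). cl AB (upd us m x) \<in> ?S}"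
      using x by (simp add: fvs.subspace_scale fvs.span_scale)
  qed
  have gen: "tm A B ?P ?Q i a j b \<in> {x \<in> homd AB ?P ?Q (deg us m). cl AB (upd us m x) \<in> ?S}"
    if a: "a \<in> homd A (fst ?P) (fst ?Q) i" and b: "b \<in> homd B (snd ?P) (snd ?Q) j" and ij: "i + j = deg us m" for i a j b
  proof -
    let ?x = "tm A B ?P ?Q i a j b"
    have x: "?x \<in> homd AB ?P ?Q (deg us m)" unfolding tensor_cat_sel by (rule tensor_in_deg[where V = "homd A (fst ?P) (fst ?Q)" and W = "homd B (snd ?P) (snd ?Q)", OF a b ij])
    have "cl AB (upd us m ?x) \<in> ?S"
    proof (rule Suc.IH)
      show "cyc_tuple AB (upd us m ?x)" by (rule cyc_tuple_upd[OF Suc.prems(2) m x])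
      fix k assume k: "m \<le> k" "k < n"
      show "\<exists>i a j b. pure_entry (upd us m ?x) k i a j b"
      proof (cases "k = m")
        case True
        have "pure_entry (upd us m ?x) k i a j b" using True m a b ij by (simp add: pure_entry_def arr_upd)
        thus ?thesis by blast
      next
        case False
        then obtain i a j b where "pure_entry us k i a j b" using Suc.prems(4)[of k] k by auto
        hence "pure_entry (upd us m ?x) k i a j b" using False m by (simp add: pure_entry_def arr_upd)
        thus ?thesis by blast
      qed
    qed (use Suc.prems in auto)
    thus ?thesis using x by simp
  qed
  have "homd AB ?P ?Q (deg us m) \<subseteq> {x \<in> homd AB ?P ?Q (deg us m). cl AB (upd us m x) \<in> ?S}"
  proof -
    have "homd AB ?P ?Q (deg us m) = fvs.span {tm A B ?P ?Q i v j w | i v j w. v \<in> homd A (fst ?P) (fst ?Q) i \<and> w \<in> homd B (snd ?P) (snd ?Q) j \<and> i + j = deg us m}"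
      by (simp add: tensor_deg_eq)
    also have "\<dots> \<subseteq> {x \<in> homd AB ?P ?Q (deg us m). cl AB (upd us m x) \<in> ?S}"
      by (rule fvs.span_minimal[OF _ sub]) (use gen in blast)
    finally show ?thesis .
  qed
  thus ?case using z m by (auto simp: upd_self)
qed

lemma Theta_surj: "hoch_chains AB n \<subseteq> Theta A B ` bichains A B n n"
  unfolding hoch_chains_eq
proof (rule fvs.span_minimal)
  show sub: "fvs.subspace (Theta A B ` bichains A B n n)" by (rule subspace_lin_image) auto
  have "cl AB us \<in> Theta A B ` bichains A B n n" if us: "cyc_tuple AB us" "length us = Suc n" for us
  proof -
    have "cl AB us \<in> fvs.span {cl AB (zipt A B s t) | s t. cyc_tuple A s \<and> cyc_tuple B t \<and> length s = Suc n \<and> length t = Suc n}"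
      by (rule cl_in_span_zipt[OF order_refl us]) simp
    also have "\<dots> \<subseteq> Theta A B ` bichains A B n n"
    proof (rule fvs.span_minimal[OF _ sub], clarify)
      fix s t assume *: "cyc_tuple A s" "cyc_tuple B t" "length s = Suc n" "length t = Suc n"
      have "cl AB (zipt A B s t) = Theta A B (fscale (ksign s t) (ten A B n (cl A s) n (cl B t)))"
        using * by (simp add: lin_scale[OF lin_Theta] Theta_cl theta_def ksign_def)
      thus "cl AB (zipt A B s t) \<in> Theta A B ` bichains A B n n"
        using * by (auto intro!: fvs.subspace_scale ten_in_bichains cl_in_hoch_chains)
    qed
    finally show ?thesis .
  qed
  thus "{cl AB ts |ts. cyc_tuple AB ts \<and> length ts = Suc n} \<subseteq> Theta A B ` bichains A B n n" by blast
qed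

lemma theta_face:
  assumes s: "cyc_tuple A s" and t: "cyc_tuple B t" and l: "length s = length t" and i: "Suc i < length s"
  shows "fscale (ksign s t) (cl AB (face AB i (zipt A B s t))) = theta A B (face A i s) (face B i t)"
proof -
  have "length (face A i s) = length (face B i t)" using l i by simp
  thus ?thesis
    by (simp add: theta_def face_zipt[OF s t l i] ksign_face[OF l i])
qed

text \<open>For an inner face the sign of the composition of tensors is absorbed by
  \<open>ksign_face\<close>. For the last face both tuples are rotated and \<open>ksign_rot\<close>
  compares the signs, which reduces it to face 0.\<close>

lemma dop_theta:
  assumes s: "cyc_tuple A s" and t: "cyc_tuple B t" and l: "length s = length t" "length s = Suc (Suc n)" and i: "i \<le> Suc n"
  shows "dop AB i (theta A B s t) = fscale (dsign i s * dsign i t) (theta A B (dface A i s) (dface B i t))"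
proof -
  have z: "length (zipt A B s t) = Suc (Suc n)" using l by simp
  have "dop AB i (theta A B s t) = fscale (ksign s t * dsign i (zipt A B s t)) (cl AB (dface AB i (zipt A B s t)))"
    using l i z by (simp add: theta_def AB.dop_cl dtup_def)
  also have "\<dots> = fscale (dsign i s * dsign i t) (theta A B (dface A i s) (dface B i t))"
  proof (cases "i = Suc n")
    case True
    have l0: "0 < length s" "length (rot s) = length (rot t)" "Suc 0 < length (rot s)" using l by simp_all
    have "fscale (ksign s t * lsign (zipt A B s t)) (cl AB (face AB 0 (zipt A B (rot s) (rot t)))) =
       fscale (lsign s * lsign t) (fscale (ksign (rot s) (rot t)) (cl AB (face AB 0 (zipt A B (rot s) (rot t)))))"
      using ksign_rot[OF l(1) l0(1), where 'k = 'k, of A B] by simp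
    also have "\<dots> = fscale (lsign s * lsign t) (theta A B (face A 0 (rot s)) (face B 0 (rot t)))"
      by (simp only: theta_face[OF cyc_tuple_rot[OF s] cyc_tuple_rot[OF t] l0(2,3)])
    finally show ?thesis using True l z
      by (simp add: dface_def dsign_def rot_zipt[OF l(1) l0(1)])
  next
    case False
    hence "Suc i < length s" using i l by simp
    thus ?thesis using theta_face[OF s t l(1), of i] l by (simp add: dface_def dsign_def)
  qed
  finally show ?thesis .
qed

end

sublocale superadditive_pair \<subseteq> graded_category_pair A B ..

context superadditive_pair
begin

lemma dop_Theta:
  assumes x: "x \<in> bichains A B (Suc n) (Suc n)" and i: "i \<le> Suc n"
  shows "dop AB i (Theta A B x) = Theta A B (tdh A B i (tdv A B i x))"
proof (rule lin_eq_on_bichains_cl[OF lin_compose[OF lin_Theta lin_dop]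
      lin_compose[OF lin_compose[OF lin_tdv lin_tdh] lin_Theta] x])
  fix s t assume *: "cyc_tuple A s" "length s = Suc (Suc n)" "cyc_tuple B t" "length t = Suc (Suc n)"
  have F: "cyc_tuple A (dface A i s)" "cyc_tuple B (dface B i t)"
    using * by (auto intro!: A.cyc_tuple_dface B.cyc_tuple_dface)
  have h: "cl A (dface A i s) \<in> hoch_chains A n" "cl B (dface B i t) \<in> hoch_chains B n"
    using F * by (auto intro!: cl_in_hoch_chains simp: length_dface)
  have "Theta A B (tdh A B i (tdv A B i (ten A B (Suc n) (cl A s) (Suc n) (cl B t)))) =
      Theta A B (ten A B n (fscale (dsign i s) (cl A (dface A i s))) n (fscale (dsign i t) (cl B (dface B i t))))"
    using * i by (simp add: top_ten A.dop_cl B.dop_cl dtup_def)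
  also have "\<dots> = fscale (dsign i s * dsign i t) (theta A B (dface A i s) (dface B i t))"
    using h F by (simp add: tensor_scale_left tensor_scale_right fvs.subspace_scale lin_scale[OF lin_Theta] Theta_cl)
  finally show "dop AB i (Theta A B (ten A B (Suc n) (cl A s) (Suc n) (cl B t))) =
      Theta A B (tdh A B i (tdv A B i (ten A B (Suc n) (cl A s) (Suc n) (cl B t))))"
    using dop_theta[OF *(1,3) _ *(2) i] * by (simp add: Theta_cl)
qed

lemma boundary_Theta:
  assumes x: "x \<in> bichains A B n n"
  shows "boundary AB (Theta A B x) = Theta A B (db n 0 0 x)"
proof (cases n)
  case 0
  thus ?thesis using Theta_in[OF x] by (simp add: AB.boundary_eq_alt lin_0[OF lin_Theta])
next
  case (Suc m)
  show ?thesis using Theta_in[OF x] dop_Theta[of x m] x Suc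
    by (simp add: AB.boundary_eq_alt db_def alt_sum_def lin_sum[OF lin_Theta] additive_sg[OF additive_lin[OF lin_Theta]]
      del: sum.atMost_Suc)
qed

end

section \<open>Shuffles as words\<close>

text \<open>\<open>True\<close> calls up the next entry of the first tuple and \<open>False\<close>
  the next one of the second. The equations mirror those of \<open>shf\<close>, so that
  \<open>shf_words\<close> follows the same recursion.\<close>

fun words :: "nat \<Rightarrow> nat \<Rightarrow> bool list set" where
  "words 0 0 = {[]}"
| "words (Suc p) 0 = Cons True ` words p 0"
| "words 0 (Suc q) = Cons False ` words 0 q"
| "words (Suc p) (Suc q) = Cons True ` words p (Suc q) \<union> Cons False ` words (Suc p) q"

definition cnt :: "bool list \<Rightarrow> nat \<Rightarrow> nat" where
  "cnt w r = length (filter (\<lambda>b. b) (take r w))"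

abbreviation trues :: "bool list \<Rightarrow> nat" where
  "trues w \<equiv> length (filter (\<lambda>b. b) w)"

abbreviation falses :: "bool list \<Rightarrow> nat" where
  "falses w \<equiv> length (filter Not w)"

text \<open>The number of pairs of a \<open>False\<close> before a \<open>True\<close>. Its parity
  is at once the sign of the shuffle permutation (\<open>sign_shuffle\<close>) and the sign
  accumulated by the recursion of \<open>shf\<close>.\<close>

fun inversions :: "bool list \<Rightarrow> nat" where
  "inversions [] = 0"
| "inversions (True # w) = inversions w"
| "inversions (False # w) = trues w + inversions w"

lemma words_iff: "w \<in> words p q \<longleftrightarrow> trues w = p \<and> falses w = q"
proof (induction p q arbitrary: w rule: words.induct)
  case 1
  have "falses w = 0 \<Longrightarrow> trues w = 0 \<Longrightarrow> w = []" using sum_length_filter_compl[of "\<lambda>b. b" w] by simp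
  thus ?case by auto
next
  case (2 p)
  show ?case using 2 by (cases w) (auto simp: image_iff)
next
  case (3 q)
  show ?case using 3 by (cases w) (auto simp: image_iff)
next
  case (4 p q)
  show ?case using 4 by (cases w) (auto simp: image_iff)
qed

lemma finite_words [simp]: "finite (words p q)"
  by (induction p q rule: words.induct) auto

lemma cnt_0 [simp]: "cnt w 0 = 0"
  by (simp add: cnt_def)

lemma cnt_Cons_Suc: "cnt (b # w) (Suc r) = (if b then Suc (cnt w r) else cnt w r)"
  by (simp add: cnt_def)

lemma cnt_Suc: "r < length w \<Longrightarrow> cnt w (Suc r) = (if w ! r then Suc (cnt w r) else cnt w r)"
  by (simp add: cnt_def take_Suc_conv_app_nth)

lemma cnt_length: "cnt w (length w) = trues w"
  by (simp add: cnt_def)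

lemma cnt_mono: "r \<le> r' \<Longrightarrow> cnt w r \<le> cnt w r'"
proof -
  assume "r \<le> r'"
  hence "take r' w = take r w @ take (r' - r) (drop r w)" by (metis le_add_diff_inverse take_add)
  thus ?thesis by (simp add: cnt_def)
qed

lemma cnt_le: "cnt w r \<le> trues w"
  using cnt_mono[of r "max r (length w)" w] by (simp add: cnt_def)

lemma cnt_less: "r < length w \<Longrightarrow> w ! r \<Longrightarrow> cnt w r < trues w"
  using cnt_Suc[of r w] cnt_le[of w "Suc r"] by simp

lemma cnt_card: "r \<le> length w \<Longrightarrow> cnt w r = card {l. l < r \<and> w ! l}"
  by (auto simp: cnt_def length_filter_conv_card intro!: arg_cong[of _ _ card])

lemma trues_Not [simp]: "trues (map Not w) = falses w"
  by (simp add: filter_map comp_def)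

lemma falses_comp [simp]: "length (filter ((\<lambda>b. b) \<circ> Not) w) = falses w"
  by (simp add: comp_def)

lemma inversions_swap: "inversions (u @ False # True # v) = Suc (inversions (u @ True # False # v))"
  by (induction u rule: inversions.induct) auto

lemma inversions_pos_split:
  assumes "inversions w \<noteq> 0"
  obtains u v where "w = u @ False # True # v"
proof -
  have "inversions w \<noteq> 0 \<Longrightarrow> \<exists>u v. w = u @ False # True # v"
  proof (induction w rule: inversions.induct)
    case (2 w)
    then obtain u v where "w = u @ False # True # v" by auto
    thus ?case by (intro exI[of _ "True # u"] exI[of _ v]) simp
  next
    case (3 w)
    show ?case
    proof (cases "inversions w = 0")
      case False
      then obtain u v where "w = u @ False # True # v" using 3 by auto
      thus ?thesis by (intro exI[of _ "False # u"] exI[of _ v]) simp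
    next
      case True
      hence "trues w \<noteq> 0" using 3 by simp
      show ?thesis
      proof (cases w)
        case Nil thus ?thesis using \<open>trues w \<noteq> 0\<close> by simp
      next
        case (Cons b w')
        have b using Cons True \<open>trues w \<noteq> 0\<close> by (cases b) auto
        thus ?thesis using Cons by (intro exI[of _ "[]"] exI[of _ w']) simp
      qed
    qed
  qed simp
  thus ?thesis using assms that by blast
qed

lemma inversions_0: "inversions w = 0 \<Longrightarrow> r < length w \<Longrightarrow> w ! r \<longleftrightarrow> r < trues w"
proof (induction w arbitrary: r rule: inversions.induct)
  case (2 w)
  thus ?case by (cases r) auto
next
  case (3 w)
  thus ?case by (cases r) auto
qed simp

text \<open>Letters are numbered from 0, the shuffled positions of a tuple from 1; hence
  \<open>Suc r\<close>.\<close>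

definition shuffle_word :: "nat \<Rightarrow> nat \<Rightarrow> (nat \<Rightarrow> nat) \<Rightarrow> bool list" where
  "shuffle_word p q \<sigma> = map (\<lambda>r. inv \<sigma> (Suc r) \<le> p) [0..<p + q]"

lemma length_shuffle_word [simp]: "length (shuffle_word p q \<sigma>) = p + q"
  by (simp add: shuffle_word_def)

lemma nth_shuffle_word: "r < p + q \<Longrightarrow> shuffle_word p q \<sigma> ! r \<longleftrightarrow> inv \<sigma> (Suc r) \<le> p"
  by (simp add: shuffle_word_def)

lemma pq_shuffles_permutes: "\<sigma> \<in> pq_shuffles p q \<Longrightarrow> \<sigma> permutes {1..p + q}"
  by (simp add: pq_shuffles_def)

text \<open>As \<sigma> increases on each block, the positions before \<open>r\<close> that carry
  the same letter are the images of the smaller indices of that block. Counting them recovers the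
  index from the word alone, which also gives injectivity of \<open>shuffle_word\<close>.\<close>

lemma shuffle_inv:
  assumes \<sigma>: "\<sigma> \<in> pq_shuffles p q" and r: "r < p + q"
  shows "inv \<sigma> (Suc r) = (if shuffle_word p q \<sigma> ! r then Suc (cnt (shuffle_word p q \<sigma>) r)
    else p + Suc (cnt (map Not (shuffle_word p q \<sigma>)) r))"
proof -
  note P = pq_shuffles_permutes[OF \<sigma>]
  have m1: "strict_mono_on {1..p} \<sigma>" and m2: "strict_mono_on {p + 1..p + q} \<sigma>"
    using \<sigma> by (simp_all add: pq_shuffles_def)
  let ?w = "shuffle_word p q \<sigma>" and ?j = "inv \<sigma> (Suc r)"
  have j: "?j \<in> {1..p + q}" using permutes_in_image[OF permutes_inv[OF P], of "Suc r"] r by simp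
  have sj: "\<sigma> ?j = Suc r" by (rule permutes_inverses(1)[OF P])
  have inj: "inj \<sigma>" by (rule permutes_inj[OF P])
  have surj: "\<exists>i\<in>{1..p + q}. \<sigma> i = Suc l" if "l < p + q" for l
    using permutes_in_image[OF permutes_inv[OF P], of "Suc l"] that permutes_inverses(1)[OF P, of "Suc l"] by auto
  have iv: "inv \<sigma> (\<sigma> i) = i" for i by (rule permutes_inverses(2)[OF P])
  have rng: "\<sigma> i \<in> {1..p + q} \<longleftrightarrow> i \<in> {1..p + q}" for i by (rule permutes_in_image[OF P])
  show ?thesis
  proof (cases "?j \<le> p")
    case True
    have lt: "\<sigma> i < Suc r \<longleftrightarrow> i < ?j" if "i \<in> {1..p}" for i
      using strict_mono_on_less[OF m1, of i ?j] that j True sj by auto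
    have "{l. l < r \<and> ?w ! l} = (\<lambda>i. \<sigma> i - 1) ` {1..<?j}"
    proof (intro equalityI subsetI)
      fix l assume l: "l \<in> {l. l < r \<and> ?w ! l}"
      then obtain i where i: "i \<in> {1..p + q}" "\<sigma> i = Suc l" using surj[of l] r by auto
      have "i \<le> p" using l i r iv[of i] nth_shuffle_word[of l p q \<sigma>] by simp
      thus "l \<in> (\<lambda>i. \<sigma> i - 1) ` {1..<?j}" using i l lt[of i] by (intro image_eqI[of _ _ i]) auto
    next
      fix l assume "l \<in> (\<lambda>i. \<sigma> i - 1) ` {1..<?j}"
      then obtain i where i: "i \<in> {1..<?j}" "l = \<sigma> i - 1" by auto
      hence "\<sigma> i \<in> {1..p + q}" "\<sigma> i < Suc r" using lt[of i] True j rng[of i] by auto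
      thus "l \<in> {l. l < r \<and> ?w ! l}" using i True r iv[of i] by (auto simp: nth_shuffle_word)
    qed
    moreover have "inj_on (\<lambda>i. \<sigma> i - 1) {1..<?j}"
    proof (rule inj_onI)
      fix x y assume xy: "x \<in> {1..<?j}" "y \<in> {1..<?j}" "\<sigma> x - 1 = \<sigma> y - 1"
      have "0 < \<sigma> x" "0 < \<sigma> y" using rng[of x] rng[of y] xy j by auto
      hence "\<sigma> x = \<sigma> y" using xy(3) by linarith
      thus "x = y" using inj by (simp add: inj_eq)
    qed
    ultimately have "cnt ?w r = ?j - 1" using r by (simp add: cnt_card card_image)
    thus ?thesis using True j r by (simp add: nth_shuffle_word)
  next
    case False
    have lt: "\<sigma> i < Suc r \<longleftrightarrow> i < ?j" if "i \<in> {p + 1..p + q}" for i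
      using strict_mono_on_less[OF m2, of i ?j] that j False sj by auto
    have "{l. l < r \<and> map Not ?w ! l} = (\<lambda>i. \<sigma> i - 1) ` {p + 1..<?j}"
    proof (intro equalityI subsetI)
      fix l assume l: "l \<in> {l. l < r \<and> map Not ?w ! l}"
      then obtain i where i: "i \<in> {1..p + q}" "\<sigma> i = Suc l" using surj[of l] r by auto
      have "l < p + q" using l r by simp
      hence "\<not> i \<le> p" using l i iv[of i] nth_shuffle_word[of l p q \<sigma>] by simp
      thus "l \<in> (\<lambda>i. \<sigma> i - 1) ` {p + 1..<?j}" using i l lt[of i] by (intro image_eqI[of _ _ i]) auto
    next
      fix l assume "l \<in> (\<lambda>i. \<sigma> i - 1) ` {p + 1..<?j}"
      then obtain i where i: "i \<in> {p + 1..<?j}" "l = \<sigma> i - 1" by auto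
      hence "\<sigma> i \<in> {1..p + q}" "\<sigma> i < Suc r" using lt[of i] j rng[of i] by auto
      thus "l \<in> {l. l < r \<and> map Not ?w ! l}" using i r iv[of i] by (auto simp: nth_shuffle_word)
    qed
    moreover have "inj_on (\<lambda>i. \<sigma> i - 1) {p + 1..<?j}"
    proof (rule inj_onI)
      fix x y assume xy: "x \<in> {p + 1..<?j}" "y \<in> {p + 1..<?j}" "\<sigma> x - 1 = \<sigma> y - 1"
      have "0 < \<sigma> x" "0 < \<sigma> y" using rng[of x] rng[of y] xy j by auto
      hence "\<sigma> x = \<sigma> y" using xy(3) by linarith
      thus "x = y" using inj by (simp add: inj_eq)
    qed
    ultimately have "cnt (map Not ?w) r = ?j - (p + 1)" using r by (simp add: cnt_card card_image)
    thus ?thesis using False j r by (simp add: nth_shuffle_word)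
  qed
qed

lemma shuffle_word_inj: "inj_on (shuffle_word p q) (pq_shuffles p q)"
proof (rule inj_onI)
  fix \<sigma> \<tau> assume *: "\<sigma> \<in> pq_shuffles p q" "\<tau> \<in> pq_shuffles p q" "shuffle_word p q \<sigma> = shuffle_word p q \<tau>"
  note P = pq_shuffles_permutes[OF *(1)] pq_shuffles_permutes[OF *(2)]
  have "inv \<sigma> k = inv \<tau> k" for k
  proof (cases "k \<in> {1..p + q}")
    case True
    then obtain r where "k = Suc r" "r < p + q" by (cases k) auto
    thus ?thesis using shuffle_inv[OF *(1), of r] shuffle_inv[OF *(2), of r] *(3) by simp
  next
    case False
    thus ?thesis using permutes_not_in[OF permutes_inv[OF P(1)]] permutes_not_in[OF permutes_inv[OF P(2)]] by simp
  qed
  hence "inv \<sigma> = inv \<tau>" by auto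
  thus "\<sigma> = \<tau>" using P by (metis permutes_inv_inv)
qed

lemma shuffle_word_in_words:
  assumes "\<sigma> \<in> pq_shuffles p q"
  shows "shuffle_word p q \<sigma> \<in> words p q"
proof -
  note P = pq_shuffles_permutes[OF assms]
  let ?w = "shuffle_word p q \<sigma>"
  have "bij_betw (\<lambda>r. inv \<sigma> (Suc r)) {r. r < p + q \<and> ?w ! r} {1..p}"
  proof (rule bij_betwI[where g = "\<lambda>i. \<sigma> i - 1"])
    show "(\<lambda>r. inv \<sigma> (Suc r)) \<in> {r. r < p + q \<and> ?w ! r} \<rightarrow> {1..p}"
    proof
      fix r assume "r \<in> {r. r < p + q \<and> ?w ! r}"
      thus "inv \<sigma> (Suc r) \<in> {1..p}" using permutes_in_image[OF permutes_inv[OF P], of "Suc r"] by (auto simp: nth_shuffle_word)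
    qed
    have s: "Suc (\<sigma> i - 1) = \<sigma> i" "\<sigma> i \<in> {1..p + q}" if "i \<in> {1..p}" for i
      using permutes_in_image[OF P, of i] that by auto
    show "(\<lambda>i. \<sigma> i - 1) \<in> {1..p} \<rightarrow> {r. r < p + q \<and> ?w ! r}"
    proof
      fix i assume i: "i \<in> {1..p}"
      have "\<sigma> i - 1 < p + q" using s[OF i] by (simp only: atLeastAtMost_iff) linarith
      thus "\<sigma> i - 1 \<in> {r. r < p + q \<and> ?w ! r}"
        using i s(1)[OF i] permutes_inverses(2)[OF P, of i] by (simp add: nth_shuffle_word)
    qed
    show "\<sigma> (inv \<sigma> (Suc r)) - 1 = r" for r using permutes_inverses(1)[OF P, of "Suc r"] by simp
    show "inv \<sigma> (Suc (\<sigma> i - 1)) = i" if "i \<in> {1..p}" for i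
      using s(1)[OF that] permutes_inverses(2)[OF P, of i] by simp
  qed
  hence "card {r. r < p + q \<and> ?w ! r} = p" by (simp add: bij_betw_same_card)
  hence "trues ?w = p" using cnt_card[of "p + q" ?w] cnt_length[of ?w] by simp
  moreover have "trues ?w + falses ?w = p + q" using sum_length_filter_compl[of "\<lambda>b. b" ?w] by simp
  ultimately show ?thesis by (simp add: words_iff)
qed

lemma shuffle_word_id:
  assumes "w \<in> words p q" "inversions w = 0"
  shows "id \<in> pq_shuffles p q" "shuffle_word p q id = w"
proof -
  show "id \<in> pq_shuffles p q" by (simp add: pq_shuffles_def permutes_id strict_mono_on_def)
  have "length w = p + q" using assms(1) sum_length_filter_compl[of "\<lambda>b. b" w] by (simp add: words_iff)
  thus "shuffle_word p q id = w" using assms inversions_0[of w]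
    by (intro nth_equalityI) (auto simp: nth_shuffle_word words_iff Suc_le_eq)
qed

text \<open>The two exchanged values come from different blocks, so \<sigma> stays increasing on
  each block.\<close>

lemma shuffle_word_swap:
  assumes \<sigma>: "\<sigma> \<in> pq_shuffles p q" and w: "shuffle_word p q \<sigma> = u @ True # False # v"
  defines "k \<equiv> Suc (length u)"
  shows "transpose k (Suc k) \<circ> \<sigma> \<in> pq_shuffles p q"
    and "shuffle_word p q (transpose k (Suc k) \<circ> \<sigma>) = u @ False # True # v"
    and "sign (transpose k (Suc k) \<circ> \<sigma>) = - sign \<sigma>"
proof -
  note P = pq_shuffles_permutes[OF \<sigma>]
  let ?t = "transpose k (Suc k)"
  have len: "length u + 2 \<le> p + q" using arg_cong[OF w, of length] by simp
  have T: "?t permutes {1..p + q}" using len by (intro permutes_swap_id) (auto simp: k_def)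
  have wk: "inv \<sigma> k \<le> p" "\<not> inv \<sigma> (Suc k) \<le> p"
    using nth_shuffle_word[of "length u" p q \<sigma>] nth_shuffle_word[of "Suc (length u)" p q \<sigma>] len w
    by (simp_all add: nth_append k_def)
  have iv: "inv \<sigma> (\<sigma> i) = i" for i by (rule permutes_inverses(2)[OF P])
  have lt: "?t (\<sigma> i) < ?t (\<sigma> j)" if "i < j" "\<sigma> i < \<sigma> j" "\<not> (\<sigma> i = k \<and> \<sigma> j = Suc k)" for i j
    using that by (auto simp: transpose_def)
  have m: "strict_mono_on {1..p} \<sigma>" "strict_mono_on {p + 1..p + q} \<sigma>"
    using \<sigma> by (simp_all add: pq_shuffles_def)
  have "strict_mono_on {1..p} (?t \<circ> \<sigma>)"
  proof (rule strict_mono_onI)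
    fix i j assume ij: "i \<in> {1..p}" "j \<in> {1..p}" "i < j"
    thus "(?t \<circ> \<sigma>) i < (?t \<circ> \<sigma>) j"
      using lt[of i j] strict_mono_onD[OF m(1) ij] wk(2) iv[of j] by (metis atLeastAtMost_iff comp_apply)
  qed
  moreover have "strict_mono_on {p + 1..p + q} (?t \<circ> \<sigma>)"
  proof (rule strict_mono_onI)
    fix i j assume ij: "i \<in> {p + 1..p + q}" "j \<in> {p + 1..p + q}" "i < j"
    thus "(?t \<circ> \<sigma>) i < (?t \<circ> \<sigma>) j"
      using lt[of i j] strict_mono_onD[OF m(2) ij] wk(1) iv[of i] by (metis Suc_eq_plus1 atLeastAtMost_iff comp_apply not_less_eq_eq)
  qed
  ultimately show "?t \<circ> \<sigma> \<in> pq_shuffles p q"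
    using permutes_compose[OF P T] by (simp add: pq_shuffles_def)
  have inv: "inv (?t \<circ> \<sigma>) = inv \<sigma> \<circ> ?t"
    using o_inv_distrib[OF permutes_bij[OF T] permutes_bij[OF P]] by simp
  show "shuffle_word p q (?t \<circ> \<sigma>) = u @ False # True # v"
  proof (rule nth_equalityI)
    show l: "length (shuffle_word p q (?t \<circ> \<sigma>)) = length (u @ False # True # v)" using arg_cong[OF w, of length] by simp
    fix r assume "r < length (shuffle_word p q (?t \<circ> \<sigma>))"
    hence r: "r < p + q" by simp
    have wr: "(u @ True # False # v) ! i \<longleftrightarrow> inv \<sigma> (Suc i) \<le> p" if "i < p + q" for i
      using nth_shuffle_word[OF that, of \<sigma>] w by simp
    have e: "(shuffle_word p q (?t \<circ> \<sigma>)) ! r \<longleftrightarrow> inv \<sigma> (?t (Suc r)) \<le> p"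
      using r by (simp add: nth_shuffle_word inv)
    consider "r = length u" | "r = Suc (length u)" | "r \<noteq> length u" "r \<noteq> Suc (length u)" by blast
    thus "shuffle_word p q (?t \<circ> \<sigma>) ! r = (u @ False # True # v) ! r"
    proof cases
      case 1 thus ?thesis using e wk by (simp add: k_def nth_append)
    next
      case 2 thus ?thesis using e wk by (simp add: k_def nth_append)
    next
      case 3
      hence "?t (Suc r) = Suc r" by (simp add: k_def transpose_def)
      moreover have "(u @ True # False # v) ! r = (u @ False # True # v) ! r"
        using 3 by (auto simp: nth_append nth_Cons')
      ultimately show ?thesis using e wr[OF r] by simp
    qed
  qed
  have "sign (?t \<circ> \<sigma>) = sign ?t * sign \<sigma>"
    by (rule sign_compose) (use T P in \<open>auto simp: permutation_permutes\<close>)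
  thus "sign (?t \<circ> \<sigma>) = - sign \<sigma>" by (simp add: sign_swap_id)
qed

text \<open>Induction on the inversions, starting from the sorted word of the identity. A word with
  an inversion has a \<open>False\<close> directly before a \<open>True\<close>; exchanging them
  removes one inversion and corresponds to one transposition, so the sign is obtained along the
  way.\<close>

lemma shuffle_word_surj:
  assumes "w \<in> words p q"
  shows "\<exists>\<sigma>\<in>pq_shuffles p q. shuffle_word p q \<sigma> = w \<and> sign \<sigma> = (- 1) ^ inversions w"
  using assms
proof (induction "inversions w" arbitrary: w)
  case 0
  thus ?case using shuffle_word_id[of w p q] by (metis power_0 sign_id)
next
  case (Suc m)
  obtain u v where uv: "w = u @ False # True # v" using inversions_pos_split[of w] Suc.hyps(2) by (metis nat.distinct(1))
  let ?w = "u @ True # False # v"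
  have m: "m = inversions ?w" using Suc.hyps(2) uv inversions_swap by simp
  have "?w \<in> words p q" using Suc.prems uv by (simp add: words_iff)
  from Suc.hyps(1)[OF m this] obtain \<sigma> where \<sigma>: "\<sigma> \<in> pq_shuffles p q" "shuffle_word p q \<sigma> = ?w" "sign \<sigma> = (- 1) ^ inversions ?w"
    by blast
  show ?case using shuffle_word_swap[OF \<sigma>(1,2)] \<sigma>(3) uv inversions_swap[of u v] by (intro bexI) auto
qed

lemma shuffle_word_bij: "bij_betw (shuffle_word p q) (pq_shuffles p q) (words p q)"
  unfolding bij_betw_def using shuffle_word_inj shuffle_word_in_words shuffle_word_surj by blast

lemma sign_shuffle: "\<sigma> \<in> pq_shuffles p q \<Longrightarrow> sign \<sigma> = (- 1) ^ inversions (shuffle_word p q \<sigma>)"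
  using shuffle_word_surj[OF shuffle_word_in_words] shuffle_word_inj by (metis inj_onD)


text \<open>The degeneracies that one factor undergoes in a shuffle: an identity is inserted at
  every step of the other factor. \<open>k\<close> is the position reached so far.\<close>

fun pad :: "('k, 'o, 'm) supercat \<Rightarrow> bool list \<Rightarrow> nat \<Rightarrow> ('o, 'm) entry list \<Rightarrow> ('o, 'm) entry list" where
  "pad A [] k s = s"
| "pad A (True # w) k s = pad A w (Suc k) s"
| "pad A (False # w) k s = pad A w (Suc k) (degen A k s)"

lemma nth_pad:
  assumes "length s = Suc (k + trues w)"
  shows "length (pad A w k s) = Suc (k + length w) \<and> (\<forall>m\<le>k. pad A w k s ! m = s ! m) \<and>
    (\<forall>r<length w. pad A w k s ! Suc (k + r) = (if w ! r then s ! Suc (k + cnt w r)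
       else (src s (Suc (k + cnt w r)), 0, ident A (src s (Suc (k + cnt w r))))))"
  using assms
proof (induction A w k s rule: pad.induct)
  case (2 A w k s)
  have "length s = Suc (Suc k + trues w)" using 2(2) by simp
  note IH = 2(1)[OF this]
  show ?case
  proof (intro conjI allI impI)
    fix r assume "r < length (True # w)"
    thus "pad A (True # w) k s ! Suc (k + r) = (if (True # w) ! r then s ! Suc (k + cnt (True # w) r)
       else (src s (Suc (k + cnt (True # w) r)), 0, ident A (src s (Suc (k + cnt (True # w) r)))))"
      using IH by (cases r) (auto simp: cnt_Cons_Suc)
  qed (use IH in auto)
next
  case (3 A w k s)
  let ?s = "degen A k s"
  have k: "k < length s" and l: "length s = Suc (k + trues w)" using 3(2) by simp_all
  have "length ?s = Suc (Suc k + trues w)" using k l by simp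
  note IH = 3(1)[OF this]
  show ?case
  proof (intro conjI allI impI)
    fix m assume "m \<le> k"
    thus "pad A (False # w) k s ! m = s ! m" using IH k by (simp add: nth_degen)
  next
    fix r assume r: "r < length (False # w)"
    show "pad A (False # w) k s ! Suc (k + r) = (if (False # w) ! r then s ! Suc (k + cnt (False # w) r)
       else (src s (Suc (k + cnt (False # w) r)), 0, ident A (src s (Suc (k + cnt (False # w) r)))))"
    proof (cases r)
      case 0
      thus ?thesis using IH k by (simp add: nth_degen)
    next
      case (Suc r')
      have r': "r' < length w" using r Suc by simp
      have e: "pad A (False # w) k s ! Suc (k + r) = (if w ! r' then ?s ! Suc (Suc k + cnt w r')
         else (src ?s (Suc (Suc k + cnt w r')), 0, ident A (src ?s (Suc (Suc k + cnt w r')))))"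
        using IH r' Suc by simp
      have "src ?s (Suc (Suc k + cnt w r')) = src s (Suc (k + cnt w r'))"
        using k l cnt_le[of w r'] by (simp add: src_degen)
      moreover have "?s ! Suc (Suc k + cnt w r') = s ! Suc (k + cnt w r')" if "w ! r'"
        using k l cnt_less[OF r' that] by (simp add: nth_degen)
      ultimately show ?thesis using e Suc by (simp add: cnt_Cons_Suc)
    qed
  qed (use IH in auto)
qed simp

lemma
  assumes "length s = Suc (trues w)"
  shows length_pad: "length (pad A w 0 s) = Suc (length w)"
    and src_pad_0: "src (pad A w 0 s) 0 = src s 0"
    and src_pad_Suc: "r \<le> length w \<Longrightarrow> src (pad A w 0 s) (Suc r) = src s (Suc (cnt w r))"
    and deg_pad_0: "deg (pad A w 0 s) 0 = deg s 0"
    and arr_pad_0: "arr (pad A w 0 s) 0 = arr s 0"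
    and deg_pad_Suc: "r < length w \<Longrightarrow> deg (pad A w 0 s) (Suc r) = (if w ! r then deg s (Suc (cnt w r)) else 0)"
    and arr_pad_Suc: "r < length w \<Longrightarrow> arr (pad A w 0 s) (Suc r) =
      (if w ! r then arr s (Suc (cnt w r)) else ident A (src s (Suc (cnt w r))))"
proof -
  note E = nth_pad[of s 0 w A, simplified, OF assms]
  show l: "length (pad A w 0 s) = Suc (length w)" using E by simp
  show 0: "src (pad A w 0 s) 0 = src s 0" using E assms by (simp add: src_less l)
  show "src (pad A w 0 s) (Suc r) = src s (Suc (cnt w r))" if r: "r \<le> length w"
  proof (cases "r = length w")
    case True
    thus ?thesis using src_length[of "pad A w 0 s"] src_length[of s] 0 l assms by (simp add: cnt_length)
  next
    case False
    hence "r < length w" using r by simp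
    thus ?thesis using E l assms cnt_less[of r w] by (simp add: src_less)
  qed
qed (use nth_pad[of s 0 w A] assms in \<open>auto simp: deg_def arr_def\<close>)

lemma (in superadditive_category) cyc_tuple_pad:
  "cyc_tuple A s \<Longrightarrow> length s = Suc (k + trues w) \<Longrightarrow> cyc_tuple A (pad A w k s)"
proof (induction w arbitrary: k s)
  case (Cons b w)
  show ?case
  proof (cases b)
    case True
    thus ?thesis using Cons.IH[of s "Suc k"] Cons.prems by simp
  next
    case False
    have "k < length s" using Cons.prems by simp
    thus ?thesis using Cons.IH[of "degen A k s" "Suc k"] Cons.prems False by (simp add: cyc_tuple_degen)
  qed
qed simp

lemma kap_sum: "kap zs = (\<Sum>m<length zs. \<Sum>l<m. snd (zs ! l) * fst (zs ! m))"
proof (induction zs rule: rev_induct)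
  case (snoc z zs)
  have "kap (zs @ [z]) = kap zs + sum_list (map snd zs) * fst z" by (cases z) (simp add: kap_append)
  also have "sum_list (map snd zs) = (\<Sum>l<length zs. snd (zs ! l))"
    by (simp add: sum_list_sum_nth atLeast0LessThan)
  finally show ?case using snoc by (simp add: nth_append sum_distrib_right)
qed simp

text \<open>These cardinalities are the ones by which \<open>shuffle_tuple\<close> locates the
  objects of its identities.\<close>

lemma card_shuffle:
  assumes "r \<le> p + q"
  shows "card {l \<in> {1..<Suc r}. inv \<sigma> l \<le> p} = cnt (shuffle_word p q \<sigma>) r"
    and "card {l \<in> {1..<Suc r}. inv \<sigma> l > p} = cnt (map Not (shuffle_word p q \<sigma>)) r"
proof -
  have "{l \<in> {1..<Suc r}. inv \<sigma> l \<le> p} = Suc ` {l. l < r \<and> shuffle_word p q \<sigma> ! l}"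
    using assms by (auto simp: nth_shuffle_word image_iff gr0_conv_Suc Suc_le_eq)
  thus "card {l \<in> {1..<Suc r}. inv \<sigma> l \<le> p} = cnt (shuffle_word p q \<sigma>) r"
    using assms by (simp add: cnt_card card_image)
  have "{l \<in> {1..<Suc r}. inv \<sigma> l > p} = Suc ` {l. l < r \<and> map Not (shuffle_word p q \<sigma>) ! l}"
    using assms by (auto simp: nth_shuffle_word image_iff gr0_conv_Suc Suc_le_eq)
  thus "card {l \<in> {1..<Suc r}. inv \<sigma> l > p} = cnt (map Not (shuffle_word p q \<sigma>)) r"
    using assms by (simp add: cnt_card card_image)
qed

lemma words_facts:
  assumes "w \<in> words p q"
  shows "length w = p + q" "trues w = p" "falses w = q"
  using assms sum_length_filter_compl[of "\<lambda>b. b" w] by (auto simp: words_iff)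

text \<open>The inserted identities are even, so among the pairs of positions in
  \<open>kap_sum\<close> only those survive that have a proper entry of \<open>t\<close> before a
  proper entry of \<open>s\<close>. Position 0 accounts for the factor \<open>deg t 0\<close>, and
  the other pairs are reindexed by \<sigma>.\<close>

lemma koszul_ksign:
  assumes \<sigma>: "\<sigma> \<in> pq_shuffles p q" and ls: "length s = Suc p" and lt: "length t = Suc q"
  defines "w \<equiv> shuffle_word p q \<sigma>"
  shows "koszul_sign \<sigma> s t = ksign (pad A w 0 s) (pad B (map Not w) 0 t)"
proof -
  note P = pq_shuffles_permutes[OF \<sigma>]
  note W = words_facts[OF shuffle_word_in_words[OF \<sigma>], folded w_def]
  let ?S = "pad A w 0 s" and ?T = "pad B (map Not w) 0 t"
  have s: "length s = Suc (trues w)" and t: "length t = Suc (trues (map Not w))" using ls lt W by simp_all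
  have l: "length ?S = Suc (p + q)" "length ?T = Suc (p + q)" using length_pad[OF s] length_pad[OF t] W by simp_all
  have iv: "inv \<sigma> (\<sigma> i) = i" and vi: "\<sigma> (inv \<sigma> i) = i" for i
    using permutes_inverses[OF P] by auto
  have rng: "\<sigma> i \<in> {1..p + q} \<longleftrightarrow> i \<in> {1..p + q}" "inv \<sigma> i \<in> {1..p + q} \<longleftrightarrow> i \<in> {1..p + q}" for i
    using permutes_in_image[OF P] permutes_in_image[OF permutes_inv[OF P]] by auto
  have dS: "deg ?S (Suc r) = (if inv \<sigma> (Suc r) \<le> p then deg s (inv \<sigma> (Suc r)) else 0)" if "r < p + q" for r
    using shuffle_inv[OF \<sigma> that] nth_shuffle_word[OF that, of \<sigma>] that W deg_pad_Suc[OF s, of r A] by (auto simp: w_def)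
  have dT: "deg ?T (Suc r) = (if inv \<sigma> (Suc r) \<le> p then 0 else deg t (inv \<sigma> (Suc r) - p))" if "r < p + q" for r
    using shuffle_inv[OF \<sigma> that] nth_shuffle_word[OF that, of \<sigma>] that W deg_pad_Suc[OF t, of r B] by (auto simp: w_def)
  have "kap (degs ?S ?T) = (\<Sum>m<Suc (p + q). \<Sum>l<m. deg ?T l * deg ?S m)"
    using l by (simp add: kap_sum nth_degs del: sum.lessThan_Suc)
  also have "\<dots> = (\<Sum>r<p + q. deg ?T 0 * deg ?S (Suc r) + (\<Sum>l<r. deg ?T (Suc l) * deg ?S (Suc r)))"
    by (simp only: sum.lessThan_Suc_shift) simp
  also have "\<dots> = deg t 0 * (\<Sum>r<p + q. deg ?S (Suc r)) + (\<Sum>r<p + q. \<Sum>l<r. deg ?T (Suc l) * deg ?S (Suc r))"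
    by (simp add: sum.distrib sum_distrib_left deg_pad_0[OF t])
  also have "(\<Sum>r<p + q. deg ?S (Suc r)) = (\<Sum>r\<in>{r. r < p + q \<and> inv \<sigma> (Suc r) \<le> p}. deg s (inv \<sigma> (Suc r)))"
    by (rule sum.mono_neutral_cong_right) (auto simp: dS)
  also have "\<dots> = (\<Sum>i=1..p. deg s i)"
  proof (rule sum.reindex_bij_witness[of _ "\<lambda>i. \<sigma> i - 1" "\<lambda>r. inv \<sigma> (Suc r)"])
    fix i assume i: "i \<in> {1..p}"
    hence "\<sigma> i \<in> {1..p + q}" using rng(1)[of i] by auto
    hence "Suc (\<sigma> i - 1) = \<sigma> i" "\<sigma> i - 1 < p + q" by auto
    thus "inv \<sigma> (Suc (\<sigma> i - 1)) = i" "\<sigma> i - 1 \<in> {r. r < p + q \<and> inv \<sigma> (Suc r) \<le> p}"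
      using i by (simp_all add: iv)
  next
    fix r assume "r \<in> {r. r < p + q \<and> inv \<sigma> (Suc r) \<le> p}"
    thus "inv \<sigma> (Suc r) \<in> {1..p}" using rng(2)[of "Suc r"] by auto
  qed (simp_all add: vi)
  also have "(\<Sum>r<p + q. \<Sum>l<r. deg ?T (Suc l) * deg ?S (Suc r)) =
     (\<Sum>(r, l)\<in>(SIGMA r:{..<p + q}. {..<r}). deg ?T (Suc l) * deg ?S (Suc r))"
    by (rule sum.Sigma) auto
  also have "\<dots> = (\<Sum>(r, l)\<in>{(r, l). r < p + q \<and> l < r \<and> inv \<sigma> (Suc r) \<le> p \<and> \<not> inv \<sigma> (Suc l) \<le> p}.
      deg s (inv \<sigma> (Suc r)) * deg t (inv \<sigma> (Suc l) - p))"
    by (rule sum.mono_neutral_cong_right) (auto simp: dS dT mult.commute split: if_splits)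
  also have "\<dots> = (\<Sum>(i, j)\<in>{(i, j). i \<in> {1..p} \<and> j \<in> {1..q} \<and> \<sigma> (p + j) < \<sigma> i}. deg s i * deg t j)"
  \<comment> \<open>The positions \<open>r\<close> and \<open>l\<close> are counted from 0, the
    values of \<sigma> from 1; the entries of \<open>t\<close> are the indices above
    \<open>p\<close>.\<close>
  proof (rule sum.reindex_bij_witness[of _ "\<lambda>(i, j). (\<sigma> i - 1, \<sigma> (p + j) - 1)" "\<lambda>(r, l). (inv \<sigma> (Suc r), inv \<sigma> (Suc l) - p)"])
    fix x assume "x \<in> {(i, j). i \<in> {1..p} \<and> j \<in> {1..q} \<and> \<sigma> (p + j) < \<sigma> i}"
    then obtain i j where x: "x = (i, j)" and ij: "i \<in> {1..p}" "j \<in> {1..q}" "\<sigma> (p + j) < \<sigma> i" by auto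
    have "\<sigma> i \<in> {1..p + q}" "\<sigma> (p + j) \<in> {1..p + q}" using rng(1)[of i] rng(1)[of "p + j"] ij by auto
    hence e: "Suc (\<sigma> i - 1) = \<sigma> i" "\<sigma> i - 1 < p + q" "Suc (\<sigma> (p + j) - 1) = \<sigma> (p + j)" "\<sigma> (p + j) - 1 < \<sigma> i - 1"
      using ij(3) by auto
    thus "(case case x of (i, j) \<Rightarrow> (\<sigma> i - 1, \<sigma> (p + j) - 1) of (r, l) \<Rightarrow> (inv \<sigma> (Suc r), inv \<sigma> (Suc l) - p)) = x"
      using ij by (simp add: x iv)
    show "(case x of (i, j) \<Rightarrow> (\<sigma> i - 1, \<sigma> (p + j) - 1))
         \<in> {(r, l). r < p + q \<and> l < r \<and> inv \<sigma> (Suc r) \<le> p \<and> \<not> inv \<sigma> (Suc l) \<le> p}"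
      using ij e by (simp add: x iv)
  next
    fix x assume "x \<in> {(r, l). r < p + q \<and> l < r \<and> inv \<sigma> (Suc r) \<le> p \<and> \<not> inv \<sigma> (Suc l) \<le> p}"
    then obtain r l where x: "x = (r, l)" and rl: "r < p + q" "l < r" "inv \<sigma> (Suc r) \<le> p" "\<not> inv \<sigma> (Suc l) \<le> p" by auto
    have g: "inv \<sigma> (Suc r) \<in> {1..p + q}" "inv \<sigma> (Suc l) \<in> {1..p + q}" using rng(2)[of "Suc r"] rng(2)[of "Suc l"] rl by auto
    show "(case case x of (r, l) \<Rightarrow> (inv \<sigma> (Suc r), inv \<sigma> (Suc l) - p) of (i, j) \<Rightarrow> (\<sigma> i - 1, \<sigma> (p + j) - 1)) = x"
      using rl by (simp add: x vi)
    show "(case x of (r, l) \<Rightarrow> (inv \<sigma> (Suc r), inv \<sigma> (Suc l) - p)) \<in> {(i, j). i \<in> {1..p} \<and> j \<in> {1..q} \<and> \<sigma> (p + j) < \<sigma> i}"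
      using rl g by (auto simp: x vi)
  qed auto
  finally have k: "kap (degs ?S ?T) = deg t 0 * (\<Sum>i=1..p. deg s i) +
      (\<Sum>(i, j)\<in>{(i, j). i \<in> {1..p} \<and> j \<in> {1..q} \<and> \<sigma> (p + j) < \<sigma> i}. deg s i * deg t j)" .
  show ?thesis unfolding ksign_def k koszul_sign_def Let_def using ls lt by simp
qed

text \<open>The bridge from permutations to degeneracies: a shuffled tuple is the slotwise tensor of
  two tuples padded at complementary positions.\<close>

lemma shuffle_tuple_zipt:
  assumes \<sigma>: "\<sigma> \<in> pq_shuffles p q" and ls: "length s = Suc p" and lt: "length t = Suc q"
  defines "w \<equiv> shuffle_word p q \<sigma>"
  shows "shuffle_tuple A B \<sigma> s t = zipt A B (pad A w 0 s) (pad B (map Not w) 0 t)"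
proof (rule nth_equalityI)
  note W = words_facts[OF shuffle_word_in_words[OF \<sigma>], folded w_def]
  let ?S = "pad A w 0 s" and ?T = "pad B (map Not w) 0 t"
  have s: "length s = Suc (trues w)" and t: "length t = Suc (trues (map Not w))" using ls lt W by simp_all
  have l: "length ?S = Suc (p + q)" "length ?T = Suc (p + q)" using length_pad[OF s] length_pad[OF t] W by simp_all
  show "length (shuffle_tuple A B \<sigma> s t) = length (zipt A B ?S ?T)"
    using l ls lt by (simp add: shuffle_tuple_def Let_def del: upt_Suc)
  fix k assume "k < length (shuffle_tuple A B \<sigma> s t)"
  hence k: "k < Suc (p + q)" using ls lt by (simp add: shuffle_tuple_def Let_def del: upt_Suc)
  show "shuffle_tuple A B \<sigma> s t ! k = zipt A B ?S ?T ! k"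
  proof (cases k)
    case 0
    thus ?thesis using l ls lt src_pad_Suc[OF s, of 0 A] src_pad_Suc[OF t, of 0 B]
      by (simp add: shuffle_tuple_def Let_def nth_zipt zent_def src_pad_0[OF s] src_pad_0[OF t] deg_pad_0[OF s] deg_pad_0[OF t]
        arr_pad_0[OF s] arr_pad_0[OF t])
  next
    case (Suc r)
    have r: "r < p + q" using k Suc by simp
    have r': "r < length w" "r < length (map Not w)" using r W by simp_all
    note I = shuffle_inv[OF \<sigma> r, folded w_def]
    have lew: "w ! r \<longleftrightarrow> inv \<sigma> (Suc r) \<le> p" unfolding w_def by (rule nth_shuffle_word[OF r])
    note C = card_shuffle[of r p q \<sigma>, folded w_def]
    have n: "[1..<p + q + 1] ! r = Suc r" using r by (simp del: upt_Suc)
    have SS: "src ?S (Suc r) = src s (Suc (cnt w r))" "src ?T (Suc r) = src t (Suc (cnt (map Not w) r))"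
      "src ?S (Suc (Suc r)) = src s (Suc (cnt w (Suc r)))" "src ?T (Suc (Suc r)) = src t (Suc (cnt (map Not w) (Suc r)))"
      using r' by (simp_all only: src_pad_Suc[OF s] src_pad_Suc[OF t] less_imp_le Suc_leI)
    have z: "zipt A B ?S ?T ! k = zent A B ?S ?T (Suc r)" using r l Suc by (simp add: nth_zipt)
    show ?thesis
    proof (cases "w ! r")
      case True
      have le: "inv \<sigma> (Suc r) \<le> p" using True lew by blast
      have I': "inv \<sigma> (Suc r) = Suc (cnt w r)" using I True by argo
      have c: "Suc (cnt w r) \<le> p" using le I' by argo
      have "shuffle_tuple A B \<sigma> s t ! k = (let j = Suc (cnt w r); Y = src t (Suc (cnt (map Not w) r)) in
         ((src s j, Y), deg s j, tensor (scl A) (scl B) (homd A (src s j) (src s (Suc j))) (homd B Y Y) (deg s j) (arr s j) 0 (ident B Y)))"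
        using I' c C r ls lt n Suc by (simp add: shuffle_tuple_def Let_def del: upt_Suc)
      thus ?thesis unfolding z zent_def SS using True r'
        by (simp add: Let_def cnt_Suc deg_pad_Suc[OF s] deg_pad_Suc[OF t] arr_pad_Suc[OF s] arr_pad_Suc[OF t])
    next
      case False
      have le: "\<not> inv \<sigma> (Suc r) \<le> p" using False lew by blast
      have I': "inv \<sigma> (Suc r) = p + Suc (cnt (map Not w) r)" using I False by argo
      have "shuffle_tuple A B \<sigma> s t ! k = (let i = Suc (cnt (map Not w) r); X = src s (Suc (cnt w r)) in
         ((X, src t i), deg t i, tensor (scl A) (scl B) (homd A X X) (homd B (src t i) (src t (Suc i))) 0 (ident A X) (deg t i) (arr t i)))"
        using I' C r ls lt n Suc by (simp add: shuffle_tuple_def Let_def del: upt_Suc)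
      thus ?thesis unfolding z zent_def SS using False r'
        by (simp add: Let_def cnt_Suc deg_pad_Suc[OF s] deg_pad_Suc[OF t] arr_pad_Suc[OF s] arr_pad_Suc[OF t])
    qed
  qed
qed

context superadditive_pair
begin

text \<open>Both shifts are \<open>k\<close>, since each step of the recursion raises both by one
  and they start equal.\<close>

lemma shf_words:
  assumes "cyc_tuple A s" "length s = Suc (p + k)" "cyc_tuple B t" "length t = Suc (q + k)"
  shows "shf p q k k (ten A B (p + k) (cl A s) (q + k) (cl B t)) =
    (\<Sum>w\<in>words p q. sg (inversions w) (ten A B (p + q + k) (cl A (pad A w k s)) (p + q + k) (cl B (pad B (map Not w) k t))))"
  using assms
proof (induction p q arbitrary: k s t rule: words.induct)
  case 1
  thus ?case by simp
next
  case (2 p)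
  have k: "k < length s" "k < length t" using 2 by simp_all
  have "tuv A B k (ten A B (Suc p + k) (cl A s) (0 + k) (cl B t)) = ten A B (p + Suc k) (cl A s) (0 + Suc k) (cl B (degen B k t))"
    using k by (simp add: tuv_ten B.uop_cl utup_def)
  thus ?case using 2(1)[of s "Suc k" "degen B k t"] 2(2-) k
    by (simp add: B.cyc_tuple_degen sum.reindex)
next
  case (3 q)
  have k: "k < length s" "k < length t" using 3 by simp_all
  have "tuh A B k (ten A B (0 + k) (cl A s) (Suc q + k) (cl B t)) = ten A B (0 + Suc k) (cl A (degen A k s)) (q + Suc k) (cl B t)"
    using k by (simp add: tuh_ten A.uop_cl utup_def)
  moreover have "trues w = 0" if "w \<in> words 0 q" for w using that by (simp add: words_iff)
  ultimately show ?case using 3(1)[of "degen A k s" "Suc k" t] 3(2-) k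
    by (simp add: A.cyc_tuple_degen sum.reindex)
next
  case (4 p q)
  have k: "k < length s" "k < length t" using 4 by simp_all
  let ?f = "\<lambda>w. sg (inversions w) (ten A B (Suc p + Suc q + k) (cl A (pad A w k s)) (Suc p + Suc q + k) (cl B (pad B (map Not w) k t)))"
  have 1: "tuv A B k (ten A B (Suc p + k) (cl A s) (Suc q + k) (cl B t)) = ten A B (p + Suc k) (cl A s) (Suc q + Suc k) (cl B (degen B k t))"
    using k by (simp add: tuv_ten B.uop_cl utup_def)
  have 2: "tuh A B k (ten A B (Suc p + k) (cl A s) (Suc q + k) (cl B t)) = ten A B (Suc p + Suc k) (cl A (degen A k s)) (q + Suc k) (cl B t)"
    using k by (simp add: tuh_ten A.uop_cl utup_def)
  have a: "shf p (Suc q) (Suc k) (Suc k) (ten A B (p + Suc k) (cl A s) (Suc q + Suc k) (cl B (degen B k t))) = (\<Sum>w\<in>Cons True ` words p (Suc q). ?f w)"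
    using 4(1)[of s "Suc k" "degen B k t"] 4(3-) k by (simp add: B.cyc_tuple_degen sum.reindex)
  \<comment> \<open>A leading \<open>False\<close> has an inversion with each of the
    \<open>Suc p\<close> later letters \<open>True\<close>; this is the sign in the recursion of
    \<open>shf\<close>.\<close>
  have t: "trues w = Suc p" if "w \<in> words (Suc p) q" for w using that by (simp add: words_iff)
  have b: "sg (Suc p) (shf (Suc p) q (Suc k) (Suc k) (ten A B (Suc p + Suc k) (cl A (degen A k s)) (q + Suc k) (cl B t))) = (\<Sum>w\<in>Cons False ` words (Suc p) q. ?f w)"
    using 4(2)[of "degen A k s" "Suc k" t] 4(3-) k
    by (simp add: A.cyc_tuple_degen sum.reindex t sg_sum sg_sg[symmetric] sum_negf del: shf.simps)
  have "shf (Suc p) (Suc q) k k (ten A B (Suc p + k) (cl A s) (Suc q + k) (cl B t)) = (\<Sum>w\<in>Cons True ` words p (Suc q). ?f w) + (\<Sum>w\<in>Cons False ` words (Suc p) q. ?f w)"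
    unfolding shf.simps(4) 1 2 a b ..
  also have "\<dots> = (\<Sum>w\<in>words (Suc p) (Suc q). ?f w)"
    unfolding words.simps(4) by (rule sum.union_disjoint[symmetric]) auto
  finally show ?case .
qed

text \<open>Here \<open>koszul_sign\<close> turns into the \<open>ksign\<close> inside
  \<open>theta\<close>, and the sum over permutations into a sum over words, which is the simplicial
  shuffle map.\<close>

lemma quo_shuffle_gen:
  assumes s: "cyc_tuple A s" and t: "cyc_tuple B t" and ls: "length s = Suc p" and lt: "length t = Suc q"
  shows "quo (chain_rels AB) (shuffle_gen A B s t) = Theta A B (shf p q 0 0 (ten A B p (cl A s) q (cl B t)))"
proof -
  note Q = lin_quo_chain_rels[of AB]
  have "quo (chain_rels AB) (shuffle_gen A B s t) =
      (\<Sum>\<sigma>\<in>pq_shuffles p q. fscale (of_int (sign \<sigma>) * koszul_sign \<sigma> s t) (cl AB (shuffle_tuple A B \<sigma> s t)))"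
    using ls lt by (simp add: shuffle_gen_def lin_sum[OF Q] lin_scale[OF Q] cl_def)
  also have "\<dots> = (\<Sum>\<sigma>\<in>pq_shuffles p q. (\<lambda>w. sg (inversions w) (theta A B (pad A w 0 s) (pad B (map Not w) 0 t))) (shuffle_word p q \<sigma>))"
  proof (rule sum.cong[OF refl])
    fix \<sigma> assume \<sigma>: "\<sigma> \<in> pq_shuffles p q"
    let ?w = "shuffle_word p q \<sigma>"
    note W = words_facts[OF shuffle_word_in_words[OF \<sigma>]]
    have l: "length (pad A ?w 0 s) = length (pad B (map Not ?w) 0 t)"
      using length_pad[of s ?w A] length_pad[of t "map Not ?w" B] ls lt W by simp
    show "fscale (of_int (sign \<sigma>) * koszul_sign \<sigma> s t) (cl AB (shuffle_tuple A B \<sigma> s t)) =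
       sg (inversions ?w) (theta A B (pad A ?w 0 s) (pad B (map Not ?w) 0 t))"
      using l by (simp add: sign_shuffle[OF \<sigma>] koszul_ksign[OF \<sigma> ls lt, of A B] shuffle_tuple_zipt[OF \<sigma> ls lt] theta_def sg_fscale)
  qed
  also have "\<dots> = (\<Sum>w\<in>words p q. sg (inversions w) (theta A B (pad A w 0 s) (pad B (map Not w) 0 t)))"
    by (rule sum.reindex_bij_betw[OF shuffle_word_bij])
  also have "\<dots> = (\<Sum>w\<in>words p q. sg (inversions w) (Theta A B (ten A B (p + q) (cl A (pad A w 0 s)) (p + q) (cl B (pad B (map Not w) 0 t)))))"
  proof (rule sum.cong[OF refl])
    fix w assume "w \<in> words p q"
    note W = words_facts[OF this]
    have "cyc_tuple A (pad A w 0 s)" "cyc_tuple B (pad B (map Not w) 0 t)"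
      using A.cyc_tuple_pad[OF s, of 0 w] B.cyc_tuple_pad[OF t, of 0 "map Not w"] ls lt W by simp_all
    thus "sg (inversions w) (theta A B (pad A w 0 s) (pad B (map Not w) 0 t)) =
       sg (inversions w) (Theta A B (ten A B (p + q) (cl A (pad A w 0 s)) (p + q) (cl B (pad B (map Not w) 0 t))))"
      by (simp add: Theta_cl)
  qed
  also have "\<dots> = Theta A B (shf p q 0 0 (ten A B p (cl A s) q (cl B t)))"
    using shf_words[OF s _ t, of p 0 q] ls lt
    by (simp add: lin_sum[OF lin_Theta] additive_sg[OF additive_lin[OF lin_Theta]])
  finally show ?thesis .
qed

text \<open>The bisimplicial part yields additivity only, whereas equality on spans of classes
  requires linearity over the field.\<close>

lemma lin_shf: "lin (shf p q k l)"
proof (induction p q arbitrary: k l rule: words.induct)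
  case 1
  have "shf 0 0 k l = (\<lambda>x. x)" by (intro ext) simp
  thus ?case using lin_id by metis
next
  case (2 p)
  have "shf (Suc p) 0 k l = (\<lambda>x. shf p 0 (Suc k) (Suc l) (tuv A B l x))" by (intro ext) simp
  thus ?case using lin_compose[OF lin_tuv 2] by metis
next
  case (3 q)
  have "shf 0 (Suc q) k l = (\<lambda>x. shf 0 q (Suc k) (Suc l) (tuh A B k x))" by (intro ext) simp
  thus ?case using lin_compose[OF lin_tuh 3] by metis
next
  case (4 p q)
  have e: "shf (Suc p) (Suc q) k l = (\<lambda>x. shf p (Suc q) (Suc k) (Suc l) (tuv A B l x) +
     fscale ((- 1) ^ Suc p) (shf (Suc p) q (Suc k) (Suc l) (tuh A B k x)))"
    by (intro ext) (simp only: shf.simps sg_fscale)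
  show ?case unfolding e
    by (rule lin_plus[OF lin_compose[OF lin_tuv 4(1)] lin_fscale[OF lin_compose[OF lin_tuh 4(2)]]])
qed

definition shuffle_cl where
  "shuffle_cl s t = Theta A B (shf (length s - 1) (length t - 1) 0 0 (ten A B (length s - 1) (cl A s) (length t - 1) (cl B t)))"

lemma multilin_shuffle_cl: "cyc_tuple B t \<Longrightarrow> multilin A (\<lambda>s. shuffle_cl s t)" "cyc_tuple A s \<Longrightarrow> multilin B (shuffle_cl s)"
proof -
  let ?\<phi> = "\<lambda>ds es v w. Theta A B (shf (length ds - 1) (length es - 1) 0 0 (ten A B (length ds - 1) v (length es - 1) w))"
  have e: "shuffle_cl s t = ?\<phi> (map (fst \<circ> snd) s) (map (fst \<circ> snd) t) (cl A s) (cl B t)" for s t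
    by (simp add: shuffle_cl_def)
  note T = tensor_add_left tensor_add_right tensor_scale_left tensor_scale_right lin_simps[OF lin_compose[OF lin_shf lin_Theta]]
  show "multilin A (\<lambda>s. shuffle_cl s t)" if t: "cyc_tuple B t"
    unfolding e by (rule multilin_via_cl) (use cl_in_hoch[OF t] in \<open>auto simp: T\<close>)
  show "multilin B (shuffle_cl s)" if s: "cyc_tuple A s"
    unfolding e by (rule multilin_via_cl) (use cl_in_hoch[OF s] in \<open>auto simp: T\<close>)
qed

text \<open>\<open>shuffle_gen\<close> is identified with the multilinear \<open>shuffle_cl\<close>
  on cyclic tuples only. By \<open>cl_in_span\<close> this covers every tuple that occurs in the
  chosen representatives.\<close>

lemma biext_shuffle:
  assumes s: "cyc_tuple A s" and t: "cyc_tuple B t"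
  shows "biext (\<lambda>s t. quo (chain_rels AB) (shuffle_gen A B s t)) (cl A s) (cl B t) = shuffle_cl s t"
proof -
  have e: "quo (chain_rels AB) (shuffle_gen A B s t) = shuffle_cl s t" if "cyc_tuple A s" "cyc_tuple B t" for s t
    using quo_shuffle_gen[OF that, of "length s - 1" "length t - 1"] cyc_tuple_nonempty[OF that(1)] cyc_tuple_nonempty[OF that(2)]
    by (simp add: shuffle_cl_def)
  have "biext (\<lambda>s t. quo (chain_rels AB) (shuffle_gen A B s t)) (cl A s) (cl B t) = biext shuffle_cl (cl A s) (cl B t)"
    unfolding biext_def
    by (intro lin_ext_cong_span[OF _ A.cl_in_span[OF s]] lin_ext_cong_span[OF _ B.cl_in_span[OF t]] e)
  thus ?thesis using biext_cl[OF s t multilin_shuffle_cl] by simp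
qed

lemma sh_eq: "sh A B = tensor_ext (\<lambda>p x q y. biext (\<lambda>s t. quo (chain_rels AB) (shuffle_gen A B s t)) x y)"
proof
  fix z
  note L = lin_lin_ext[OF lin_quo_chain_rels[of AB]]
  show "sh A B z = tensor_ext (\<lambda>p x q y. biext (\<lambda>s t. quo (chain_rels AB) (shuffle_gen A B s t)) x y) z"
    unfolding sh_def tensor_ext_def L
    by (intro arg_cong[of _ _ "\<lambda>h. lin_ext h z"] ext) (auto simp: L biext_def)
qed

lemma lin_sh [simp]: "lin (sh A B)"
  by (simp add: sh_eq)

lemma sh_bichains:
  assumes "x \<in> bichains A B p q"
  shows "sh A B x = Theta A B (shf p q 0 0 x)"
proof (rule lin_eq_on_bichains_cl[OF lin_sh lin_compose[OF lin_shf lin_Theta] assms])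
  fix s t assume *: "cyc_tuple A s" "length s = Suc p" "cyc_tuple B t" "length t = Suc q"
  have "sh A B (ten A B p (cl A s) q (cl B t)) = shuffle_cl s t"
    by (simp only: sh_eq tensor_ext_tensor[OF bilin_biext] biext_shuffle[OF *(1,3)])
  thus "sh A B (ten A B p (cl A s) q (cl B t)) = Theta A B (shf p q 0 0 (ten A B p (cl A s) q (cl B t)))"
    using * by (simp add: shuffle_cl_def)
qed

end

section \<open>Homology\<close>

context graded_category
begin

lemma subspace_boundaries [simp]: "fvs.subspace (boundary A ` hoch_chains A n)"
  by (simp add: subspace_lin_image[OF lin_boundary])

lemma lin_hclass [simp]: "lin (hclass A n)"
  unfolding hclass_def by (rule quo_linear) simp

lemma hclass_idem [simp]: "hclass A n (hclass A n x) = hclass A n x"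
  unfolding hclass_def by (rule quo_idem) simp

lemma hclass_eq_0_iff: "hclass A n x = 0 \<longleftrightarrow> x \<in> boundary A ` hoch_chains A (Suc n)"
  unfolding hclass_def by (subst quo_eq_0_iff) auto

lemma hclass_boundary: "y \<in> hoch_chains A (Suc n) \<Longrightarrow> hclass A n (boundary A y) = 0"
  by (simp add: hclass_eq_0_iff)

lemma hclass_diff: "\<exists>y\<in>hoch_chains A (Suc n). hclass A n x = x + boundary A y"
proof -
  have "hclass A n x - x \<in> boundary A ` hoch_chains A (Suc n)"
    unfolding hclass_def using quo_diff_in[of "boundary A ` hoch_chains A (n + 1)" x] by simp
  thus ?thesis by (auto simp: algebra_simps)
qed

lemma subspace_cycles [simp]: "fvs.subspace (cycles A n)"
  unfolding cycles_def
  by (rule fvs.subspaceI) (auto simp: lin_simps[OF lin_boundary] fvs.subspace_0 fvs.subspace_add fvs.subspace_scale)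

lemma subspace_HH [simp]: "fvs.subspace (HH A n)"
  unfolding HH_def by (rule subspace_lin_image) simp_all

lemma hclass_HH: "x \<in> HH A n \<Longrightarrow> hclass A n x = x"
  by (auto simp: HH_def)

end

context superadditive_category
begin

lemma boundary_boundary: "x \<in> hoch_chains A n \<Longrightarrow> boundary A (boundary A x) = 0"
proof -
  assume x: "x \<in> hoch_chains A n"
  show ?thesis
  proof (cases n)
    case 0
    thus ?thesis using x by (simp add: boundary_eq_alt lin_0[OF lin_boundary])
  next
    case (Suc m)
    have "alt_sum m (dop A) (alt_sum (Suc m) (dop A) x) = 0"
    proof (cases m)
      case (Suc m')
      show ?thesis
        by (rule alt_sum_alt) (use x Suc \<open>n = Suc m\<close> in \<open>auto simp: additive_lin dop_dop\<close>)
    qed simp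
    thus ?thesis using x Suc boundary_in[OF x] boundary_eq_alt[of "boundary A x" m] by (simp add: boundary_eq_alt[of x n])
  qed
qed

lemma hclass_cycle: "x \<in> cycles A n \<Longrightarrow> hclass A n x \<in> cycles A n"
  using hclass_diff[of n x] boundary_in[of _ "Suc n"] boundary_boundary
  by (auto simp: cycles_def lin_simps[OF lin_boundary] fvs.subspace_add)

lemma HH_cycles: "x \<in> HH A n \<Longrightarrow> x \<in> cycles A n"
  by (auto simp: HH_def hclass_cycle)

text \<open>Over a field the boundary has a linear right inverse \<open>g\<close> on its image. For
  every \<open>x\<close> the difference \<open>x - hclass A n x\<close> is a boundary, and
  \<open>h\<close> picks a preimage of it. Off the cycles \<open>hclass\<close> is corrected by the
  term with \<open>h (n - 1)\<close>, which makes \<open>P\<close> a projection to cycles with the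
  homotopy formula on all chains.\<close>

lemma homology_projection:
  obtains h P where "\<And>n. lin (h n)" "\<And>n. lin (P n)"
    "\<And>n x. x \<in> hoch_chains A n \<Longrightarrow> h n x \<in> hoch_chains A (Suc n)"
    "\<And>n x. x \<in> hoch_chains A n \<Longrightarrow> P n x \<in> cycles A n"
    "\<And>n x. x \<in> hoch_chains A n \<Longrightarrow> x = P n x + boundary A (h n x) + h (n - 1) (boundary A x)"
    "\<And>n x. x \<in> cycles A n \<Longrightarrow> P n x = hclass A n x"
    "\<And>n x. x \<in> hoch_chains A (Suc n) \<Longrightarrow> P n (boundary A x) = 0"
proof -
  interpret vp: vector_space_pair "fscale :: 'k \<Rightarrow> (('o, 'm) entry list \<Rightarrow>\<^sub>0 'k) \<Rightarrow> _" "fscale :: 'k \<Rightarrow> (('o, 'm) entry list \<Rightarrow>\<^sub>0 'k) \<Rightarrow> _"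
    by unfold_locales
  have "\<exists>g. range g \<subseteq> hoch_chains A n \<and> lin g \<and> (\<forall>v\<in>boundary A ` hoch_chains A n. boundary A (g v) = v)" for n
    using vp.linear_exists_right_inverse_on[OF lin_boundary subspace_hoch_chains] by blast
  then obtain g where g: "\<And>n x. g n x \<in> hoch_chains A n" "\<And>n. lin (g n)"
    "\<And>n x. x \<in> hoch_chains A n \<Longrightarrow> boundary A (g n (boundary A x)) = boundary A x"
    by (metis imageI range_subsetD)
  define h where "h n x = g (Suc n) (x - hclass A n x)" for n x
  define P where "P n x = hclass A n x - h (n - 1) (boundary A x)" for n x
  have lh: "lin (h n)" for n
    unfolding h_def[abs_def] by (rule lin_compose[OF lin_sub[OF lin_id lin_hclass] g(2)])
  have lP: "lin (P n)" for n
    unfolding P_def[abs_def] by (rule lin_sub[OF lin_hclass lin_compose[OF lin_boundary lh]])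
  have hb: "boundary A (h n x) = x - hclass A n x" for n x
  proof -
    obtain y where "y \<in> hoch_chains A (Suc n)" "hclass A n x = x + boundary A y" using hclass_diff by blast
    moreover from this have "x - hclass A n x = boundary A (- y)" "- y \<in> hoch_chains A (Suc n)"
      by (simp_all add: lin_minus[OF lin_boundary] fvs.subspace_neg)
    ultimately show ?thesis unfolding h_def using g(3)[of "- y" "Suc n"] by simp
  qed
  \<comment> \<open>For \<open>n = 0\<close> the truncated index \<open>n - 1\<close> does no harm,
    since the boundary of \<open>x\<close> is 0 there. For \<open>n > 0\<close> the class of the
    boundary vanishes and \<open>h\<close> reduces to \<open>g\<close>.\<close>
  have htpy_diag: "h (n - 1) (boundary A x) = (if n = 0 then 0 else g n (boundary A x))" if "x \<in> hoch_chains A n" for n x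
  proof (cases n)
    case 0
    hence "boundary A x = 0" using that by (simp add: boundary_eq_alt)
    thus ?thesis using 0 by (simp add: lin_0[OF lh])
  next
    case (Suc m)
    thus ?thesis using hclass_boundary[of x m] that by (simp add: h_def)
  qed
  show ?thesis
  proof (rule that[of h P])
    fix n x
    show "lin (h n)" by (rule lh)
    show "lin (P n)" by (rule lP)
    show "h n x \<in> hoch_chains A (Suc n)" by (simp add: h_def g(1))
    show "x = P n x + boundary A (h n x) + h (n - 1) (boundary A x)" by (simp add: P_def hb)
    show "P n x \<in> cycles A n" if x: "x \<in> hoch_chains A n"
    proof -
      have e: "P n x = hclass A n x - (if n = 0 then 0 else g n (boundary A x))" unfolding P_def htpy_diag[OF x] ..
      obtain y where y: "y \<in> hoch_chains A (Suc n)" "hclass A n x = x + boundary A y" using hclass_diff by blast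
      have "boundary A x = 0" if "n = 0" using that x by (simp add: boundary_eq_alt)
      hence "boundary A (P n x) = 0"
        using g(3)[OF x] boundary_boundary[OF y(1)] by (auto simp: e y(2) lin_simps[OF lin_boundary])
      moreover have "P n x \<in> hoch_chains A n"
        using x y boundary_in[OF y(1)] g(1)[of n] by (auto simp: e fvs.subspace_diff fvs.subspace_add)
      ultimately show ?thesis by (simp add: cycles_def)
    qed
    show "P n x = hclass A n x" if "x \<in> cycles A n"
      using that by (simp add: P_def cycles_def lin_0[OF lh])
    show "P n (boundary A x) = 0" if "x \<in> hoch_chains A (Suc n)"
      using that by (simp add: P_def hclass_boundary boundary_boundary lin_0[OF lh])
  qed
qed

end

abbreviation hten :: "('k::field, 'o, 'a::ab_group_add) supercat \<Rightarrow> ('k, 'p, 'b::ab_group_add) supercat \<Rightarrow>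
    nat \<Rightarrow> (('o, 'a) entry list \<Rightarrow>\<^sub>0 'k) \<Rightarrow> nat \<Rightarrow> (('p, 'b) entry list \<Rightarrow>\<^sub>0 'k) \<Rightarrow> ('k, 'o, 'a, 'p, 'b) tensor_chain" where
  "hten A B \<equiv> tensor fscale fscale (HH A) (HH B)"

context superadditive_pair
begin

section \<open>The shuffle map and its homotopy inverse on Hochschild complexes\<close>

lemma lin_tot_cone: "(\<And>p k l. lin (U p k l)) \<Longrightarrow> lin (tot_cone U p k l)"
proof -
  assume U: "\<And>p k l. lin (U p k l)"
  show ?thesis
  proof (cases p)
    case 0
    have "tot_cone U p k l = (\<lambda>x. tdh A B (Suc k) (U 0 (Suc k) (Suc l) (tuh A B k (tuv A B l x))))"
      by (intro ext) (simp add: tot_cone_def diag_cone_def 0)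
    thus ?thesis using lin_compose[OF lin_compose[OF lin_compose[OF lin_tuv lin_tuh] U] lin_tdh] by simp
  next
    case (Suc p')
    have "tot_cone U p k l = (\<lambda>x. U p' (Suc k) l (tuh A B k x))"
      by (intro ext) (simp add: tot_cone_def cone_h_def Suc)
    thus ?thesis using lin_compose[OF lin_tuh U] by simp
  qed
qed

lemma lin_psi: "lin (psi n p k l)"
proof (induction n arbitrary: p k l)
  case 0
  show ?case by (cases "p = 0") (simp_all add: lin_id lin_zero)
next
  case (Suc n)
  show ?case unfolding psi.simps
    by (rule lin_tot_cone) (rule lin_compose[OF lin_db Suc.IH])
qed

lemma sh_in: "z \<in> tensor_chains A B n \<Longrightarrow> sh A B z \<in> hoch_chains AB n"
proof (rule lin_tensor_deg_in[OF lin_sh subspace_hoch_chains])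
  fix p v q w assume *: "v \<in> hoch_chains A p" "w \<in> hoch_chains B q" "p + q = n"
  have b: "ten A B p v q w \<in> bichains A B p q" using * by (simp add: ten_in_bichains)
  have "shf p q 0 0 (ten A B p v q w) \<in> bichains A B n n"
    using natural_in[OF natural_shf, of "ten A B p v q w" p 0 q 0] b *(3) by simp
  thus "sh A B (ten A B p v q w) \<in> hoch_chains AB n"
    by (simp add: sh_bichains[OF b] Theta_in)
qed

lemma boundary_sh_bichains:
  assumes x: "x \<in> bichains A B p q"
  shows "boundary AB (sh A B x) = sh A B (tensor_boundary A B x)"
proof -
  have s: "shf p q 0 0 x \<in> bichains A B (p + q) (p + q)"
    using natural_in[OF natural_shf, of x p 0 q 0] x by simp
  have h: "hb p 0 x \<in> bichains A B (p - 1) q" using natural_in[OF natural_hb, of x p 0 q 0] x by simp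
  have v: "vb q 0 x \<in> bichains A B p (q - 1)" using natural_in[OF natural_vb, of x p 0 q 0] x by simp
  have z: "shf p q' 0 0 0 = 0" "shf p' q 0 0 0 = 0" for p' q' by (rule lin_0[OF lin_shf])+
  have "boundary AB (sh A B x) = Theta A B (db (p + q) 0 0 (shf p q 0 0 x))"
    by (simp add: sh_bichains[OF x] boundary_Theta[OF s])
  also have "db (p + q) 0 0 (shf p q 0 0 x) = shf (p - 1) q 0 0 (hb p 0 x) + sg p (shf p (q - 1) 0 0 (vb q 0 x))"
    using db_shf[of x p 0 q 0] x by (auto simp: z)
  also have "Theta A B \<dots> = sh A B (hb p 0 x) + sg p (sh A B (vb q 0 x))"
    by (simp add: sh_bichains[OF h] sh_bichains[OF v] lin_add[OF lin_Theta] additive_sg[OF additive_lin[OF lin_Theta]])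
  also have "\<dots> = sh A B (tensor_boundary A B x)"
    by (simp add: tensor_boundary_bichains[OF x] lin_add[OF lin_sh] additive_sg[OF additive_lin[OF lin_sh]])
  finally show ?thesis .
qed

lemma boundary_sh:
  assumes "z \<in> tensor_chains A B n"
  shows "boundary AB (sh A B z) = sh A B (tensor_boundary A B z)"
  by (rule lin_eq_on_tensor_deg[OF lin_compose[OF lin_sh AB.lin_boundary] lin_compose[OF lin_tensor_boundary lin_sh] assms])
    (rule boundary_sh_bichains, rule ten_in_bichains)

lemma tensor_boundary_sum:
  assumes z: "\<And>p. p \<le> Suc n \<Longrightarrow> z p \<in> bichains A B p (Suc n - p)"
  shows "tensor_boundary A B (\<Sum>p\<le>Suc n. z p) = (\<Sum>p\<le>n. tot_bd (Suc n) 0 0 z p)"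
proof -
  have "tensor_boundary A B (\<Sum>p\<le>Suc n. z p) = (\<Sum>p\<le>Suc n. hb p 0 (z p) + sg p (vb (Suc n - p) 0 (z p)))"
    by (simp only: lin_sum[OF lin_tensor_boundary]) (rule sum.cong, auto simp: tensor_boundary_bichains[OF z])
  also have "\<dots> = (\<Sum>p\<le>Suc n. hb p 0 (z p)) + (\<Sum>p\<le>Suc n. sg p (vb (Suc n - p) 0 (z p)))"
    by (rule sum.distrib)
  also have "(\<Sum>p\<le>Suc n. hb p 0 (z p)) = (\<Sum>p\<le>n. hb (Suc p) 0 (z (Suc p)))"
    by (subst sum.atMost_Suc_shift) simp
  also have "(\<Sum>p\<le>Suc n. sg p (vb (Suc n - p) 0 (z p))) = (\<Sum>p\<le>n. sg p (vb (Suc n - p) 0 (z p)))"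
    by simp
  finally show ?thesis by (simp only: tot_bd_def sum.distrib)
qed

text \<open>The inverse of \<open>Theta\<close> in every degree, by \<open>Xi_Theta\<close> and
  \<open>Theta_Xi\<close>.\<close>

definition Xi where
  "Xi = lin_ext (\<lambda>us. unzip unzip_val us [] [])"

definition Psi where
  "Psi n w = (\<Sum>p\<le>n. psi n p 0 0 (Xi w))"

lemma Xi_Theta: "x \<in> bichains A B n n \<Longrightarrow> Xi (Theta A B x) = x"
  by (simp add: Xi_def Theta_left_inverse)

lemma Xi_in: "w \<in> hoch_chains AB n \<Longrightarrow> Xi w \<in> bichains A B n n"
  and Theta_Xi: "w \<in> hoch_chains AB n \<Longrightarrow> Theta A B (Xi w) = w"
  using Theta_surj[of n] by (auto simp: Xi_Theta dest!: subsetD)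

lemma lin_Psi: "lin (Psi n)"
  unfolding Psi_def[abs_def] Xi_def
  by (intro lin_sum_fun lin_compose[OF lin_lin_ext_op lin_psi])

lemma psi_in: "x \<in> bichains A B n n \<Longrightarrow> p \<le> n \<Longrightarrow> psi n p 0 0 x \<in> bichains A B p (n - p)"
  using natural_in[OF natural_psi, of p n x 0 0] by simp

lemma Psi_in: "w \<in> hoch_chains AB n \<Longrightarrow> Psi n w \<in> tensor_chains A B n"
  unfolding Psi_def
  by (rule fvs.subspace_sum) (auto intro!: subsetD[OF bichains_subset] psi_in Xi_in)

lemma Xi_boundary: "w \<in> hoch_chains AB n \<Longrightarrow> Xi (boundary AB w) = db n 0 0 (Xi w)"
proof -
  assume w: "w \<in> hoch_chains AB n"
  have "boundary AB w = Theta A B (db n 0 0 (Xi w))"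
    using boundary_Theta[OF Xi_in[OF w]] by (simp add: Theta_Xi[OF w])
  moreover have "db n 0 0 (Xi w) \<in> bichains A B (n - 1) (n - 1)"
    using natural_in[OF natural_db, of "Xi w" n 0 0] Xi_in[OF w] by simp
  ultimately show ?thesis by (simp add: Xi_Theta)
qed

lemma Psi_boundary:
  assumes w: "w \<in> hoch_chains AB (Suc n)"
  shows "tensor_boundary A B (Psi (Suc n) w) = Psi n (boundary AB w)"
proof -
  note x = Xi_in[OF w]
  have "tensor_boundary A B (Psi (Suc n) w) = (\<Sum>p\<le>n. tot_bd (Suc n) 0 0 (\<lambda>p. psi (Suc n) p 0 0 (Xi w)) p)"
    unfolding Psi_def by (rule tensor_boundary_sum) (rule psi_in[OF x])
  also have "\<dots> = Psi n (boundary AB w)"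
    unfolding Psi_def Xi_boundary[OF w]
    by (rule sum.cong[OF refl], rule tot_bd_psi) (use x in auto)
  finally show ?thesis .
qed

lemma tensor_boundary_0: "z \<in> tensor_chains A B 0 \<Longrightarrow> tensor_boundary A B z = 0"
  by (rule lin_eq_on_tensor_deg[OF lin_tensor_boundary lin_zero])
    (auto simp: tensor_boundary_ten A.boundary_eq_alt B.boundary_eq_alt ten_0)

lemma Psi_cycle:
  assumes w: "w \<in> cycles AB n"
  shows "tensor_boundary A B (Psi n w) = 0"
proof (cases n)
  case 0
  thus ?thesis using tensor_boundary_0 Psi_in w by (auto simp: cycles_def)
next
  case (Suc m)
  thus ?thesis using Psi_boundary[of w m] w lin_0[OF lin_Psi] by (simp add: cycles_def)
qed

text \<open>\<open>v\<close> is the image of the diagonal homotopy under \<open>Theta\<close>; the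
  term of the homotopy that involves the boundary drops out because \<open>Xi w\<close> is a cycle
  of the diagonal.\<close>

lemma sh_Psi:
  assumes w: "w \<in> cycles AB n"
  shows "\<exists>v\<in>hoch_chains AB (Suc n). sh A B (Psi n w) = w + boundary AB v"
proof -
  let ?x = "Xi w"
  have wn: "w \<in> hoch_chains AB n" using w by (simp add: cycles_def)
  note x = Xi_in[OF wn]
  have d: "db n 0 0 ?x = 0" using Xi_boundary[OF wn] w by (simp add: cycles_def Xi_def)
  have v: "htpy_diag n 0 0 ?x \<in> bichains A B (Suc n) (Suc n)" using natural_in[OF natural_htpy_diag, of ?x n 0 0] x by simp
  have h: "db (Suc n) 0 0 (htpy_diag n 0 0 ?x) = (\<Sum>p\<le>n. shf p (n - p) 0 0 (psi n p 0 0 ?x)) - ?x"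
    using db_htpy_diag[of ?x n 0 0] x d natural_simps(1)[OF natural_htpy_diag] by simp
  have "sh A B (Psi n w) = Theta A B (\<Sum>p\<le>n. shf p (n - p) 0 0 (psi n p 0 0 ?x))"
    unfolding Psi_def lin_sum[OF lin_sh] lin_sum[OF lin_Theta]
    by (rule sum.cong) (auto simp: sh_bichains[OF psi_in[OF x]])
  also have "(\<Sum>p\<le>n. shf p (n - p) 0 0 (psi n p 0 0 ?x)) = ?x + db (Suc n) 0 0 (htpy_diag n 0 0 ?x)" by (simp add: h)
  also have "Theta A B \<dots> = w + boundary AB (Theta A B (htpy_diag n 0 0 ?x))"
    by (simp add: lin_add[OF lin_Theta] Theta_Xi[OF wn] boundary_Theta[OF v])
  finally show ?thesis using Theta_in[OF v] by blast
qed

text \<open>Tensors of two cycles satisfy the assumptions, and these are all that is needed to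
  compare homologies. The terms of \<open>tot_bd_htpy_tot\<close> that contain a boundary of
  \<open>x\<close> drop out.\<close>

lemma Psi_sh:
  assumes x: "x \<in> bichains A B a (n - a)" and a: "a \<le> n" and h: "hb a 0 x = 0" and v: "vb (n - a) 0 x = 0"
  shows "\<exists>z\<in>tensor_chains A B (Suc n). Psi n (sh A B x) = x + tensor_boundary A B z"
proof -
  let ?z = "\<lambda>p. htpy_tot n a p 0 0 x"
  have z: "?z p \<in> bichains A B p (Suc n - p)" if "p \<le> Suc n" for p
    using natural_in[OF natural_htpy_tot[OF a that], of x 0 0] x by simp
  have s: "shf a (n - a) 0 0 x \<in> bichains A B n n"
    using natural_in[OF natural_shf, of x a 0 "n - a" 0] x a by simp
  have tbz: "tot_bd (Suc n) 0 0 ?z p = psi n p 0 0 (shf a (n - a) 0 0 x) - (if p = a then x else 0)" if p: "p \<le> n" for p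
  proof -
    have "htpy_tot (n - 1) (a - 1) p 0 0 0 = 0" if "a \<noteq> 0"
    proof (cases "p \<le> Suc (n - 1)")
      case True
      thus ?thesis using natural_simps(1)[OF natural_htpy_tot, of "a - 1" "n - 1" p] a that by simp
    qed (use p in simp)
    moreover have "htpy_tot (n - 1) a p 0 0 0 = 0" if "a \<noteq> n"
    proof -
      have "a \<le> n - 1" "p \<le> Suc (n - 1)" using a p that by simp_all
      thus ?thesis using natural_simps(1)[OF natural_htpy_tot] by blast
    qed
    ultimately show ?thesis using tot_bd_htpy_tot[OF a p, of x 0 0, unfolded h v] x by (cases "a = n"; cases "a = 0") simp_all
  qed
  have "tensor_boundary A B (\<Sum>p\<le>Suc n. ?z p) = (\<Sum>p\<le>n. tot_bd (Suc n) 0 0 ?z p)"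
    by (rule tensor_boundary_sum) (rule z)
  also have "\<dots> = (\<Sum>p\<le>n. psi n p 0 0 (shf a (n - a) 0 0 x) - (if p = a then x else 0))"
    by (rule sum.cong) (simp_all add: tbz)
  also have "\<dots> = Psi n (sh A B x) - x"
    using a by (simp add: sum_subtractf Psi_def sh_bichains[OF x] Xi_Theta[OF s])
  finally have "Psi n (sh A B x) = x + tensor_boundary A B (\<Sum>p\<le>Suc n. ?z p)" by simp
  moreover have "(\<Sum>p\<le>Suc n. ?z p) \<in> tensor_chains A B (Suc n)"
    by (rule fvs.subspace_sum) (auto intro!: subsetD[OF bichains_subset] z)
  ultimately show ?thesis by blast
qed

section \<open>The induced map on homology and the Kuenneth isomorphism\<close>

lemma sh_ten_cycle:
  assumes "x \<in> cycles A p" "y \<in> cycles B q" "p + q = n"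
  shows "sh A B (ten A B p x q y) \<in> cycles AB n"
proof -
  have *: "x \<in> hoch_chains A p" "y \<in> hoch_chains B q" "boundary A x = 0" "boundary B y = 0"
    using assms by (simp_all add: cycles_def)
  have "ten A B p x q y \<in> tensor_chains A B n" using * assms(3) by (auto intro: tensor_in_deg)
  moreover have "tensor_boundary A B (ten A B p x q y) = 0" using * by (simp add: tensor_boundary_ten ten_0)
  ultimately show ?thesis using sh_in boundary_sh by (simp add: cycles_def lin_0[OF lin_sh])
qed

lemma hclass_sh_ten:
  assumes x: "x \<in> cycles A p" and y: "y \<in> cycles B q" and n: "p + q = n"
  shows "hclass AB n (sh A B (ten A B p (hclass A p x) q (hclass B q y))) = hclass AB n (sh A B (ten A B p x q y))"
proof -
  obtain a where a: "a \<in> hoch_chains A (Suc p)" "hclass A p x = x + boundary A a" using A.hclass_diff by blast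
  obtain b where b: "b \<in> hoch_chains B (Suc q)" "hclass B q y = y + boundary B b" using B.hclass_diff by blast
  have *: "x \<in> hoch_chains A p" "y \<in> hoch_chains B q" "boundary A x = 0" "boundary B y = 0"
    using x y by (simp_all add: cycles_def)
  have ba: "boundary A a \<in> hoch_chains A p" "boundary B b \<in> hoch_chains B q"
    using A.boundary_in[OF a(1)] B.boundary_in[OF b(1)] by simp_all
  let ?y = "hclass B q y"
  have y': "?y \<in> hoch_chains B q" "boundary B ?y = 0" using B.hclass_cycle[OF y] by (simp_all add: cycles_def)
  have xh: "hclass A p x \<in> hoch_chains A p" using A.hclass_cycle[OF x] by (simp add: cycles_def)
  \<comment> \<open>The representatives are exchanged one factor at a time. As \<open>x\<close> is a
    cycle, the boundary of \<open>x \<otimes> b\<close> is \<open>x \<otimes> boundary B b\<close>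
    with the sign of \<open>p\<close>, which the factor in \<open>?z2\<close> undoes.\<close>
  let ?z1 = "ten A B (Suc p) a q ?y" and ?z2 = "fscale ((- 1) ^ p) (ten A B p x (Suc q) b)"
  have z: "?z1 \<in> tensor_chains A B (Suc n)" "?z2 \<in> tensor_chains A B (Suc n)"
    using a b y' * n by (auto intro!: tensor_in_deg fvs.subspace_scale)
  have "ten A B p (hclass A p x) q ?y = ten A B p x q ?y + ten A B p (boundary A a) q ?y"
    unfolding a(2) by (rule tensor_add_left) (use * ba y' in auto)
  also have "ten A B p x q ?y = ten A B p x q y + ten A B p x q (boundary B b)"
    unfolding b(2) by (rule tensor_add_right) (use * ba in auto)
  also have "ten A B p (boundary A a) q ?y = tensor_boundary A B ?z1"
    unfolding tensor_boundary_ten y'(2) by (simp add: ten_0 a(1))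
  also have "ten A B p x q (boundary B b) = tensor_boundary A B ?z2"
    unfolding lin_scale[OF lin_tensor_boundary] tensor_boundary_ten *(3)
    by (simp add: ten_0 b(1) power_mult_distrib[symmetric])
  finally have "ten A B p (hclass A p x) q ?y = ten A B p x q y + tensor_boundary A B (?z1 + ?z2)"
    by (simp only: lin_add[OF lin_tensor_boundary] add_ac)
  hence "sh A B (ten A B p (hclass A p x) q ?y) = sh A B (ten A B p x q y) + boundary AB (sh A B (?z1 + ?z2))"
    using boundary_sh[of "?z1 + ?z2" "Suc n"] z by (simp add: lin_add[OF lin_sh] fvs.subspace_add)
  moreover have "sh A B (?z1 + ?z2) \<in> hoch_chains AB (Suc n)" by (rule sh_in) (use z in \<open>simp add: fvs.subspace_add\<close>)
  ultimately show ?thesis by (simp add: lin_add[OF AB.lin_hclass] AB.hclass_boundary)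
qed

text \<open>Elements of \<open>HH A p\<close> are chosen cycles, but tensors over \<open>HH\<close>
  and over the chains are taken modulo different relations, so the inclusion of classes into chains
  has to be tensored.\<close>

definition HH_incl where
  "HH_incl = tensor_ext (ten A B)"

lemma HH_incl_hten: "HH_incl (hten A B p x q y) = ten A B p x q y"
  unfolding HH_incl_def
proof (rule tensor_ext_tensor)
  have "HH A i \<subseteq> hoch_chains A i" "HH B i \<subseteq> hoch_chains B i" for i
    using A.HH_cycles B.HH_cycles by (auto simp: cycles_def)
  thus "bilin fscale fscale (HH A) (HH B) (ten A B)"
    by (auto simp: bilin_def subset_iff tensor_add_left tensor_add_right tensor_scale_left tensor_scale_right)
qed

lemma lin_HH_incl [simp]: "lin HH_incl"
  by (simp add: HH_incl_def)

definition HH_sh where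
  "HH_sh n u = hclass AB n (sh A B (HH_incl u))"

lemma lin_HH_sh: "lin (HH_sh n)"
  unfolding HH_sh_def[abs_def] by (rule lin_compose[OF lin_compose[OF lin_HH_incl lin_sh] AB.lin_hclass])

lemma HH_sh_hten:
  assumes "x \<in> cycles A p" "y \<in> cycles B q" "p + q = n"
  shows "HH_sh n (hten A B p (hclass A p x) q (hclass B q y)) = hclass AB n (sh A B (ten A B p x q y))"
  by (simp add: HH_sh_def HH_incl_hten hclass_sh_ten[OF assms])

lemma HH_sh_in:
  assumes "u \<in> tensor_deg fscale fscale (HH A) (HH B) n"
  shows "HH_sh n u \<in> HH AB n"
proof (rule lin_tensor_deg_in[OF lin_HH_sh AB.subspace_HH assms])
  fix p x q y assume *: "x \<in> HH A p" "y \<in> HH B q" "p + q = n"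
  thus "HH_sh n (hten A B p x q y) \<in> HH AB n"
    unfolding HH_sh_def HH_incl_hten HH_def[of AB]
    by (intro imageI sh_ten_cycle A.HH_cycles B.HH_cycles)
qed

text \<open>Injectivity comes from the left inverse \<open>Q\<close> after \<open>Psi n\<close>: on
  tensors of cycles \<open>Psi\<close> undoes \<open>sh\<close> up to a boundary, and
  \<open>Q\<close> kills boundaries. For surjectivity, a cycle \<open>w\<close> is homologous to the
  shuffle of \<open>Psi n w\<close>, and \<open>homotopy\<close> replaces this cycle of the tensor
  product by a sum of tensors of cycles.\<close>

lemma HH_sh_bij: "bij_betw (HH_sh n) (tensor_deg fscale fscale (HH A) (HH B) n) (HH AB n)"
proof -
  let ?T = "tensor_deg fscale fscale (HH A) (HH B) n"
  obtain hA PA where A: "\<And>n. lin (hA n)" "\<And>n. lin (PA n)"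
    "\<And>n x. x \<in> hoch_chains A n \<Longrightarrow> hA n x \<in> hoch_chains A (Suc n)"
    "\<And>n x. x \<in> hoch_chains A n \<Longrightarrow> PA n x \<in> cycles A n"
    "\<And>n x. x \<in> hoch_chains A n \<Longrightarrow> x = PA n x + boundary A (hA n x) + hA (n - 1) (boundary A x)"
    "\<And>n x. x \<in> cycles A n \<Longrightarrow> PA n x = hclass A n x"
    "\<And>n x. x \<in> hoch_chains A (Suc n) \<Longrightarrow> PA n (boundary A x) = 0"
    using A.homology_projection by blast
  obtain hB PB where B: "\<And>n. lin (hB n)" "\<And>n. lin (PB n)"
    "\<And>n x. x \<in> hoch_chains B n \<Longrightarrow> hB n x \<in> hoch_chains B (Suc n)"
    "\<And>n x. x \<in> hoch_chains B n \<Longrightarrow> PB n x \<in> cycles B n"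
    "\<And>n x. x \<in> hoch_chains B n \<Longrightarrow> x = PB n x + boundary B (hB n x) + hB (n - 1) (boundary B x)"
    "\<And>n x. x \<in> cycles B n \<Longrightarrow> PB n x = hclass B n x"
    "\<And>n x. x \<in> hoch_chains B (Suc n) \<Longrightarrow> PB n (boundary B x) = 0"
    using B.homology_projection by blast
  have PAin: "PA n x \<in> hoch_chains A n" "boundary A (PA n x) = 0" if "x \<in> hoch_chains A n" for n x
    using A(4)[OF that] by (simp_all add: cycles_def)
  have PBin: "PB n x \<in> hoch_chains B n" "boundary B (PB n x) = 0" if "x \<in> hoch_chains B n" for n x
    using B(4)[OF that] by (simp_all add: cycles_def)
  have PA0: "PA (p - 1) (boundary A x) = 0" if "x \<in> hoch_chains A p" for p x
    using that A(7) by (cases p) (auto simp: A.boundary_eq_alt lin_0[OF A(2)])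
  have PB0: "PB (p - 1) (boundary B x) = 0" if "x \<in> hoch_chains B p" for p x
    using that B(7) by (cases p) (auto simp: B.boundary_eq_alt lin_0[OF B(2)])
  note sub = subspace_hoch_chains
  have add: "(v::'v::ab_group_add) = a + b + c \<Longrightarrow> a + b + c = v" for v a b c by simp
  \<comment> \<open>The standard homotopy on a tensor product: it contracts the first factor and,
    where that one is already projected, the second. The sign is that of moving \<open>hB\<close>
    past an element of degree \<open>p\<close>.\<close>
  define K where "K = tensor_ext (\<lambda>p x q y. ten A B (Suc p) (hA p x) q y + fscale ((- 1) ^ p) (ten A B p (PA p x) (Suc q) (hB q y)))"
  define PP where "PP = tensor_ext (\<lambda>p x q y. ten A B p (PA p x) q (PB q y))"
  define Q where "Q = tensor_ext (\<lambda>p x q y. hten A B p (hclass A p (PA p x)) q (hclass B q (PB q y)))"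
  have lK: "lin K" and lPP: "lin PP" and lQ: "lin Q" by (simp_all add: K_def PP_def Q_def)
  have K: "K (ten A B p x q y) = ten A B (Suc p) (hA p x) q y + fscale ((- 1) ^ p) (ten A B p (PA p x) (Suc q) (hB q y))" for p x q y
    unfolding K_def
    by (rule tensor_ext_tensor)
      (simp add: bilin_def A(3) B(3) PAin lin_simps[OF A(1)] lin_simps[OF A(2)] lin_simps[OF B(1)]
        tensor_add_left tensor_add_right tensor_scale_left tensor_scale_right fvs.scale_right_distrib mult.commute algebra_simps)
  have PP: "PP (ten A B p x q y) = ten A B p (PA p x) q (PB q y)" for p x q y
    unfolding PP_def
    by (rule tensor_ext_tensor)
      (simp add: bilin_def PAin PBin lin_simps[OF A(2)] lin_simps[OF B(2)]
        tensor_add_left tensor_add_right tensor_scale_left tensor_scale_right)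
  have HA: "hclass A n (PA n x) \<in> HH A n" if "x \<in> hoch_chains A n" for n x
    using A(4)[OF that] by (simp add: HH_def)
  have HB: "hclass B n (PB n x) \<in> HH B n" if "x \<in> hoch_chains B n" for n x
    using B(4)[OF that] by (simp add: HH_def)
  have Q: "Q (ten A B p x q y) = hten A B p (hclass A p (PA p x)) q (hclass B q (PB q y))" for p x q y
    unfolding Q_def
    by (rule tensor_ext_tensor)
      (simp add: bilin_def HA HB lin_simps[OF A(2)] lin_simps[OF B(2)] lin_simps[OF A.lin_hclass] lin_simps[OF B.lin_hclass]
        tensor_add_left tensor_add_right tensor_scale_left tensor_scale_right)
  have hten0: "hten A B p 0 q y = 0" if "y \<in> HH B q" for p q y
    using tensor_scale_left[of 0 "HH A" p y "HH B" q fscale fscale 0] that by (simp add: fvs.subspace_0)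
  have hten0': "hten A B p x q 0 = 0" if "x \<in> HH A p" for p q x
    using tensor_scale_right[of x "HH A" p 0 "HH B" q fscale fscale 0] that by (simp add: fvs.subspace_0)
  \<comment> \<open>In each term of the boundary one factor is a boundary, which \<open>PA\<close>
    or \<open>PB\<close> sends to 0.\<close>
  have Q0: "Q (tensor_boundary A B z) = 0" if "z \<in> tensor_chains A B m" for z m
    by (rule lin_eq_on_tensor_deg[OF lin_compose[OF lin_tensor_boundary lQ] lin_zero that])
      (simp add: tensor_boundary_ten lin_add[OF lQ] lin_scale[OF lQ] Q PA0[simplified] PB0[simplified]
        lin_0[OF A.lin_hclass] lin_0[OF B.lin_hclass] hten0 hten0' HA HB)
  have homotopy: "z = PP z + tensor_boundary A B (K z) + K (tensor_boundary A B z)" if "z \<in> tensor_chains A B m" for z m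
  proof (rule lin_eq_on_tensor_deg[OF lin_id _ that])
    show "lin (\<lambda>z. PP z + tensor_boundary A B (K z) + K (tensor_boundary A B z))"
      by (intro lin_plus lPP lin_compose[OF lK lin_tensor_boundary] lin_compose[OF lin_tensor_boundary lK])
    fix p x q y assume x: "x \<in> hoch_chains A p" and y: "y \<in> hoch_chains B q" and "p + q = m"
    have hx: "hA p x \<in> hoch_chains A (Suc p)" and hy: "hB q y \<in> hoch_chains B (Suc q)" using A(3) B(3) x y by simp_all
    have bhx: "boundary A (hA p x) \<in> hoch_chains A p" and bhy: "boundary B (hB q y) \<in> hoch_chains B q"
      using A.boundary_in[OF hx] B.boundary_in[OF hy] by simp_all
    \<comment> \<open>For \<open>p = 0\<close> the degree \<open>Suc (p - 1)\<close> is 1 and not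
      \<open>p\<close>, but then the boundary of \<open>x\<close> is 0 and both sides vanish. The
      same holds for \<open>q\<close> in \<open>hby\<close>.\<close>
    have hbx: "hA (p - 1) (boundary A x) \<in> hoch_chains A p"
      "ten A B (Suc (p - 1)) (hA (p - 1) (boundary A x)) q y = ten A B p (hA (p - 1) (boundary A x)) q y"
      using A(3)[OF A.boundary_in[OF x]] x y
      by (cases p; simp add: A.boundary_eq_alt lin_0[OF A(1)] fvs.subspace_0 ten_0)+
    have hby: "hB (q - 1) (boundary B y) \<in> hoch_chains B q"
      "ten A B p (PA p x) (Suc (q - 1)) (hB (q - 1) (boundary B y)) = ten A B p (PA p x) q (hB (q - 1) (boundary B y))"
      using B(3)[OF B.boundary_in[OF y]] PAin[OF x] y
      by (cases q; simp add: B.boundary_eq_alt lin_0[OF B(1)] fvs.subspace_0 ten_0)+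
    have 1: "ten A B p x q y = ten A B p (PA p x) q y + ten A B p (boundary A (hA p x)) q y + ten A B p (hA (p - 1) (boundary A x)) q y"
      using arg_cong[OF A(5)[OF x], of "\<lambda>x. ten A B p x q y"] PAin[OF x] bhx hbx y
      by (simp add: tensor_add_left fvs.subspace_add)
    have 2: "ten A B p (PA p x) q y = ten A B p (PA p x) q (PB q y) + ten A B p (PA p x) q (boundary B (hB q y)) +
        ten A B p (PA p x) q (hB (q - 1) (boundary B y))"
      using arg_cong[OF B(5)[OF y], of "\<lambda>y. ten A B p (PA p x) q y"] PAin[OF x] PBin[OF y] bhy hby
      by (simp add: tensor_add_right fvs.subspace_add)
    have 3: "tensor_boundary A B (K (ten A B p x q y)) = ten A B p (boundary A (hA p x)) q y
        - fscale ((- 1) ^ p) (ten A B (Suc p) (hA p x) (q - 1) (boundary B y)) + ten A B p (PA p x) q (boundary B (hB q y))"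
      using PAin[OF x] hy
      by (simp add: K lin_add[OF lin_tensor_boundary] lin_scale[OF lin_tensor_boundary] tensor_boundary_ten ten_0
        fvs.scale_right_distrib power_mult_distrib[symmetric] B.boundary_in[OF hy, simplified])
    have 4: "K (tensor_boundary A B (ten A B p x q y)) = ten A B p (hA (p - 1) (boundary A x)) q y +
        fscale ((- 1) ^ p) (ten A B (Suc p) (hA p x) (q - 1) (boundary B y)) + ten A B p (PA p x) q (hB (q - 1) (boundary B y))"
      unfolding tensor_boundary_ten lin_add[OF lK] lin_scale[OF lK] K PA0[OF x] hbx(2) hby(2)
      using B(3)[OF y] by (simp add: ten_0 fvs.scale_right_distrib power_mult_distrib[symmetric])
    show "ten A B p x q y = PP (ten A B p x q y) + tensor_boundary A B (K (ten A B p x q y)) + K (tensor_boundary A B (ten A B p x q y))"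
      unfolding 3 4 PP by (subst 1, subst 2) (simp add: algebra_simps)
  qed
  have K_in: "K z \<in> tensor_chains A B (Suc m)" if "z \<in> tensor_chains A B m" for z m
    by (rule lin_tensor_deg_in[OF lK subspace_tensor_deg that])
      (auto simp: K intro!: fvs.subspace_add fvs.subspace_scale tensor_in_deg A(3) B(3) PAin)
  have surj: "hclass AB n w \<in> HH_sh n ` ?T" if w: "w \<in> cycles AB n" for w
  proof -
    let ?z = "Psi n w"
    have wn: "w \<in> hoch_chains AB n" using w by (simp add: cycles_def)
    note z = Psi_in[OF wn]
    have "?z = PP ?z + tensor_boundary A B (K ?z)" using homotopy[OF z] Psi_cycle[OF w] by (simp add: lin_0[OF lK])
    hence s: "sh A B ?z = sh A B (PP ?z) + boundary AB (sh A B (K ?z))"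
      using boundary_sh[OF K_in[OF z]] by (metis lin_add lin_sh)
    obtain v where v: "v \<in> hoch_chains AB (Suc n)" "sh A B ?z = w + boundary AB v" using sh_Psi[OF w] by blast
    have "hclass AB n (sh A B ?z) = hclass AB n w"
      unfolding v(2) lin_add[OF AB.lin_hclass] AB.hclass_boundary[OF v(1)] by simp
    moreover have "hclass AB n (sh A B ?z) = hclass AB n (sh A B (PP ?z))"
      unfolding s lin_add[OF AB.lin_hclass] AB.hclass_boundary[OF sh_in[OF K_in[OF z]]] by simp
    ultimately have "hclass AB n w = hclass AB n (sh A B (PP ?z))" by simp
    also have "\<dots> \<in> HH_sh n ` ?T"
    proof (rule lin_tensor_deg_in[OF lin_compose[OF lin_compose[OF lPP lin_sh] AB.lin_hclass] _ z])
      show "fvs.subspace (HH_sh n ` ?T)" by (rule subspace_lin_image[OF lin_HH_sh]) simp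
      fix p x q y assume *: "x \<in> hoch_chains A p" "y \<in> hoch_chains B q" "p + q = n"
      have "hclass AB n (sh A B (PP (ten A B p x q y))) = HH_sh n (hten A B p (hclass A p (PA p x)) q (hclass B q (PB q y)))"
        unfolding PP by (rule HH_sh_hten[symmetric]) (use * A(4) B(4) in auto)
      moreover have "hten A B p (hclass A p (PA p x)) q (hclass B q (PB q y)) \<in> ?T"
        using * HA HB by (auto intro: tensor_in_deg)
      ultimately show "hclass AB n (sh A B (PP (ten A B p x q y))) \<in> HH_sh n ` ?T" by blast
    qed
    finally show ?thesis .
  qed
  have retract: "Q (Psi n (sh A B (HH_incl u))) = u" if "u \<in> ?T" for u
  proof (rule lin_eq_on_tensor_deg[OF _ lin_id that])
    show "lin (\<lambda>u. Q (Psi n (sh A B (HH_incl u))))"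
      by (rule lin_compose[OF lin_compose[OF lin_compose[OF lin_HH_incl lin_sh] lin_Psi] lQ])
    fix p x q y assume *: "x \<in> HH A p" "y \<in> HH B q" "p + q = n"
    have c: "x \<in> cycles A p" "y \<in> cycles B q" using * A.HH_cycles B.HH_cycles by auto
    hence h: "x \<in> hoch_chains A p" "y \<in> hoch_chains B q" "boundary A x = 0" "boundary B y = 0" by (simp_all add: cycles_def)
    have q: "q = n - p" "p \<le> n" using *(3) by auto
    have "hb p 0 (ten A B p x q y) = 0" "vb (n - p) 0 (ten A B p x q y) = 0"
      using hb_ten[OF h(1,2)] vb_ten[OF h(1,2)] h ten_0 q by simp_all
    then obtain z where z: "z \<in> tensor_chains A B (Suc n)" "Psi n (sh A B (ten A B p x q y)) = ten A B p x q y + tensor_boundary A B z"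
      using Psi_sh[of "ten A B p x q y" p n] ten_in_bichains[OF h(1,2)] q by auto
    have "Q (Psi n (sh A B (HH_incl (hten A B p x q y)))) = Q (ten A B p x q y)"
      by (simp add: HH_incl_hten z(2) lin_add[OF lQ] Q0[OF z(1)])
    thus "Q (Psi n (sh A B (HH_incl (hten A B p x q y)))) = hten A B p x q y"
      using c * by (simp add: Q A(6) B(6) A.hclass_HH B.hclass_HH)
  qed
  have inj0: "u = 0" if u: "u \<in> ?T" and 0: "HH_sh n u = 0" for u
  proof -
    obtain v where v: "v \<in> hoch_chains AB (Suc n)" "sh A B (HH_incl u) = boundary AB v"
      using 0 by (auto simp: HH_sh_def AB.hclass_eq_0_iff)
    have "u = Q (tensor_boundary A B (Psi (Suc n) v))"
      using retract[OF u] v by (simp add: Psi_boundary[OF v(1)])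
    thus ?thesis using Q0[OF Psi_in[OF v(1)]] by simp
  qed
  have "inj_on (HH_sh n) ?T"
  proof (rule inj_onI)
    fix u u' assume "u \<in> ?T" "u' \<in> ?T" "HH_sh n u = HH_sh n u'"
    thus "u = u'" using inj0[of "u - u'"] by (simp add: lin_diff[OF lin_HH_sh] fvs.subspace_diff)
  qed
  moreover have "HH_sh n ` ?T = HH AB n"
    using HH_sh_in surj by (auto simp: HH_def[of AB])
  ultimately show ?thesis by (simp add: bij_betw_def)
qed

end

theorem theorem5p4:
  fixes A :: "('k::field, 'o, 'a::ab_group_add) supercat"
    and B :: "('k, 'p, 'b::ab_group_add) supercat"
  assumes "superadditive_category A" and "superadditive_category B"
  shows "(\<forall>n. \<forall>z\<in>tensor_chains A B n. sh A B z \<in> hoch_chains (tensor_cat A B) n \<and>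
              boundary (tensor_cat A B) (sh A B z) = sh A B (tensor_boundary A B z)) \<and>
         (\<forall>n. \<exists>\<Phi>. Vector_Spaces.linear fscale fscale \<Phi> \<and>
              (\<forall>p q x y. p + q = n \<and> x \<in> cycles A p \<and> y \<in> cycles B q \<longrightarrow>
                 \<Phi> (tensor fscale fscale (HH A) (HH B) p (hclass A p x) q (hclass B q y)) =
                 hclass (tensor_cat A B) n
                   (sh A B (tensor fscale fscale (hoch_chains A) (hoch_chains B) p x q y))) \<and>
              bij_betw \<Phi> (tensor_deg fscale fscale (HH A) (HH B) n) (HH (tensor_cat A B) n))"
proof -
  interpret superadditive_pair A B using assms by (rule superadditive_pair.intro)
  show ?thesis
    using sh_in boundary_sh lin_HH_sh HH_sh_hten HH_sh_bij by blast
qed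

end
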